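(* Let $\alpha\in(0,1)$ and $p\in(1,\infty)$ be such that $$\sigma:=1-\frac{d+1/\alpha}{p}\in(0,1).$$ Then, for $\psi\in\mathbb H_{p,0}^{\alpha,1}((0,1)\times\mathbb R^d)$, we have $$[\psi]_{C^{\sigma\alpha,\sigma}((0,1)\times\mathbb R^d)}\le N(d,\alpha,p)\,\|\psi\|_{\mathbb H_p^{\alpha,1}((0,1)\times\mathbb R^d)}.$$
   Context: Hölder semi-norm: for $\mathcal D\subset\mathbb R\times\mathbb R^d$, $$[u]_{C^{\sigma_1,\sigma_2}(\mathcal D)}=\sup_{(t,x),(s,y)\in\mathcal D,\,(t,x)\ne(s,y)}\frac{|u(t,x)-u(s,y)|}{|t-s|^{\sigma_1}+|x-y|^{\sigma_2}}$$ (as usual, for an a.e.-defined function this is understood for its continuous representative). $N(\cdots)$ is a constant depending only on the listed quantities. For $\mathcal D\subset\mathbb R^k$, $C_0^\infty(\mathcal D)$ denotes infinitely differentiable functions on $\mathcal D$ with compact support contained in $\mathcal D$. $I_0^{1-\alpha}u(t,x)=\frac1{\Gamma(1-\alpha)}\int_0^t(t-s)^{-\alpha}u(s,x)\,ds$. For $T\in(0,\infty)$ and a domain $\Omega\subset\mathbb R^d$, $\mathbb H_p^{\alpha,1}((0,T)\times\Omega)$ is the set of $u\in L_p((0,T)\times\Omega)$ with $D_xu\in L_p$ and for which there is $g\in L_p((0,T)\times\Omega)$, denoted $\partial_tI_0^{1-\alpha}u$, such that $\int_0^T\!\int_\Omega g\varphi\,dx\,dt=-\int_0^T\!\int_\Omega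 I_0^{1-\alpha}u\,\partial_t\varphi\,dx\,dt$ for all $\varphi\in C_0^\infty([0,T)\times\Omega)$. Its norm is $\|\partial_tI_0^{1-\alpha}u\|_{L_p}+\|u\|_{L_p}+\|D_xu\|_{L_p}$. $\mathbb H_{p,0}^{\alpha,1}((0,T)\times\Omega)$ is the set of $u\in\mathbb H_p^{\alpha,1}((0,T)\times\Omega)$ that are limits in this norm of functions $u_n\in C^\infty([0,T]\times\Omega)$ which vanish for large $|x|$ and satisfy $u_n(0,x)=0$. *)

theory Defs
  imports "HOL-Analysis.Analysis"
begin

text \<open>Functions on a set \<open>D\<close> are total functions whose values outside \<open>D\<close> are irrelevant.\<close>

section \<open>Smooth functions\<close>

text \<open>Derivatives are taken within \<open>D\<close>, hence one-sided at those boundary points that belong to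
  \<open>D\<close>.  For \<open>D\<close> of the form \<open>J \<times> \<Omega>\<close>, with \<open>J\<close> a nondegenerate interval and \<open>\<Omega>\<close> open, they
  are uniquely determined, and the functions below are those all of whose derivatives are
  continuous up to that part of the boundary.\<close>

primrec Ck_on :: "nat \<Rightarrow> 'a::real_normed_vector set \<Rightarrow> ('a \<Rightarrow> 'b::real_normed_vector) \<Rightarrow> bool"
where
  "Ck_on 0 D f \<longleftrightarrow> continuous_on D f"
| "Ck_on (Suc k) D f \<longleftrightarrow>
     (\<exists>f'. (\<forall>z\<in>D. (f has_derivative f' z) (at z within D)) \<and> (\<forall>v. Ck_on k D (\<lambda>z. f' z v)))"

definition C_infty :: "'a::real_normed_vector set \<Rightarrow> ('a \<Rightarrow> real) set" where
  "C_infty D = {f. \<forall>k. Ck_on k D f}"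

text \<open>The compact support has to lie in \<open>D\<close> itself: an element of \<open>C0_infty ({0..<T} \<times> \<Omega>)\<close> need
  not vanish at time \<open>0\<close>.\<close>

definition C0_infty :: "'a::real_normed_vector set \<Rightarrow> ('a \<Rightarrow> real) set" where
  "C0_infty D = {f \<in> C_infty D. \<exists>K. compact K \<and> K \<subseteq> D \<and> (\<forall>z\<in>D - K. f z = 0)}"

definition partial_t :: "(real \<times> (real ^ 'n) \<Rightarrow> real) \<Rightarrow> real \<times> (real ^ 'n) \<Rightarrow> real" where
  "partial_t f = (\<lambda>(t, x). deriv (\<lambda>s. f (s, x)) t)"

definition partial_x :: "'n \<Rightarrow> (real \<times> (real ^ 'n) \<Rightarrow> real) \<Rightarrow> real \<times> (real ^ 'n) \<Rightarrow> real" where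
  "partial_x i f = (\<lambda>(t, x). deriv (\<lambda>h. f (t, x + h *\<^sub>R axis i 1)) 0)"

section \<open>Lebesgue spaces\<close>

definition Lp :: "real \<Rightarrow> 'a::euclidean_space set \<Rightarrow> ('a \<Rightarrow> 'b::euclidean_space) set" where
  "Lp p D = {f. f \<in> borel_measurable (lebesgue_on D) \<and>
                integrable (lebesgue_on D) (\<lambda>z. norm (f z) powr p)}"

definition Lp_norm :: "real \<Rightarrow> 'a::euclidean_space set \<Rightarrow> ('a \<Rightarrow> 'b::euclidean_space) \<Rightarrow> real" where
  "Lp_norm p D f = (\<integral>z. norm (f z) powr p \<partial>lebesgue_on D) powr (1 / p)"

section \<open>Weak spatial gradient and time-fractional derivative\<close>

definition is_weak_Dx ::
  "(real \<times> (real ^ 'n)) set \<Rightarrow> (real \<times> (real ^ 'n) \<Rightarrow> real) \<Rightarrow> (real \<times> (real ^ 'n) \<Rightarrow> real ^ 'n) \<Rightarrow> bool"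
where
  "is_weak_Dx D u G \<longleftrightarrow>
     (\<forall>\<phi>\<in>C0_infty D. \<forall>i. (\<integral>z. G z $ i * \<phi> z \<partial>lebesgue_on D)
                            = - (\<integral>z. u z * partial_x i \<phi> z \<partial>lebesgue_on D))"

text \<open>\<open>frac_int \<alpha> u\<close> is the Riemann-Liouville integral of order \<open>1 - \<alpha>\<close>, not of order \<open>\<alpha>\<close>.\<close>

definition frac_int ::
  "real \<Rightarrow> (real \<times> (real ^ 'n) \<Rightarrow> real) \<Rightarrow> real \<times> (real ^ 'n) \<Rightarrow> real"
where
  "frac_int \<alpha> u = (\<lambda>(t, x).
     1 / Gamma (1 - \<alpha>) * (\<integral>s. (t - s) powr (- \<alpha>) * u (s, x) \<partial>lebesgue_on {0<..<t}))"

definition is_frac_dt ::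
  "real \<Rightarrow> real \<Rightarrow> (real ^ 'n) set \<Rightarrow> (real \<times> (real ^ 'n) \<Rightarrow> real) \<Rightarrow> (real \<times> (real ^ 'n) \<Rightarrow> real) \<Rightarrow> bool"
where
  "is_frac_dt \<alpha> T \<Omega> u g \<longleftrightarrow>
     (\<forall>\<phi>\<in>C0_infty ({0..<T} \<times> \<Omega>).
        (\<integral>z. g z * \<phi> z \<partial>lebesgue_on ({0<..<T} \<times> \<Omega>))
          = - (\<integral>z. frac_int \<alpha> u z * partial_t \<phi> z \<partial>lebesgue_on ({0<..<T} \<times> \<Omega>)))"

section \<open>Fractional Sobolev spaces of order \<open>(\<alpha>, 1)\<close>\<close>

definition H_space :: "real \<Rightarrow> real \<Rightarrow> real \<Rightarrow> (real ^ 'n) set \<Rightarrow> (real \<times> (real ^ 'n) \<Rightarrow> real) set"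
where
  "H_space \<alpha> p T \<Omega> = {u \<in> Lp p ({0<..<T} \<times> \<Omega>).
     (\<exists>G\<in>Lp p ({0<..<T} \<times> \<Omega>). is_weak_Dx ({0<..<T} \<times> \<Omega>) u G) \<and>
     (\<exists>g\<in>Lp p ({0<..<T} \<times> \<Omega>). is_frac_dt \<alpha> T \<Omega> u g)}"

text \<open>For \<open>u \<in> H_space \<alpha> p T \<Omega>\<close> with \<open>\<Omega>\<close> open, the functions chosen here are unique up to null
  sets, so the norm does not depend on the choice.\<close>

definition weak_Dx ::
  "real \<Rightarrow> (real \<times> (real ^ 'n)) set \<Rightarrow> (real \<times> (real ^ 'n) \<Rightarrow> real) \<Rightarrow> real \<times> (real ^ 'n) \<Rightarrow> real ^ 'n"
where
  "weak_Dx p D u = (SOME G. G \<in> Lp p D \<and> is_weak_Dx D u G)"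

definition frac_dt ::
  "real \<Rightarrow> real \<Rightarrow> real \<Rightarrow> (real ^ 'n) set \<Rightarrow> (real \<times> (real ^ 'n) \<Rightarrow> real) \<Rightarrow> real \<times> (real ^ 'n) \<Rightarrow> real"
where
  "frac_dt \<alpha> p T \<Omega> u = (SOME g. g \<in> Lp p ({0<..<T} \<times> \<Omega>) \<and> is_frac_dt \<alpha> T \<Omega> u g)"

definition H_norm ::
  "real \<Rightarrow> real \<Rightarrow> real \<Rightarrow> (real ^ 'n) set \<Rightarrow> (real \<times> (real ^ 'n) \<Rightarrow> real) \<Rightarrow> real"
where
  "H_norm \<alpha> p T \<Omega> u =
     Lp_norm p ({0<..<T} \<times> \<Omega>) (frac_dt \<alpha> p T \<Omega> u)
     + Lp_norm p ({0<..<T} \<times> \<Omega>) u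
     + Lp_norm p ({0<..<T} \<times> \<Omega>) (weak_Dx p ({0<..<T} \<times> \<Omega>) u)"

definition H0_space :: "real \<Rightarrow> real \<Rightarrow> real \<Rightarrow> (real ^ 'n) set \<Rightarrow> (real \<times> (real ^ 'n) \<Rightarrow> real) set"
where
  "H0_space \<alpha> p T \<Omega> = {u \<in> H_space \<alpha> p T \<Omega>.
     \<exists>v :: nat \<Rightarrow> real \<times> (real ^ 'n) \<Rightarrow> real.
       (\<forall>n. v n \<in> C_infty ({0..T} \<times> \<Omega>) \<and> v n \<in> H_space \<alpha> p T \<Omega> \<and>
            (\<exists>R. \<forall>t\<in>{0..T}. \<forall>x\<in>\<Omega>. norm x > R \<longrightarrow> v n (t, x) = 0) \<and>
            (\<forall>x\<in>\<Omega>. v n (0, x) = 0)) \<and>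
       (\<lambda>n. H_norm \<alpha> p T \<Omega> (\<lambda>z. v n z - u z)) \<longlonglongrightarrow> 0}"

section \<open>Hoelder semi-norm\<close>

text \<open>The supremum is taken in \<open>[0, \<infinity>]\<close>, so that it is infinite for functions that are not
  Hoelder continuous.\<close>

definition holder_seminorm ::
  "real \<Rightarrow> real \<Rightarrow> (real \<times> (real ^ 'n)) set \<Rightarrow> (real \<times> (real ^ 'n) \<Rightarrow> real) \<Rightarrow> ennreal"
where
  "holder_seminorm \<sigma>1 \<sigma>2 D u =
     (SUP ((t, x), (s, y)) \<in> {(z, w). z \<in> D \<and> w \<in> D \<and> z \<noteq> w}.
        ennreal (\<bar>u (t, x) - u (s, y)\<bar> / (\<bar>t - s\<bar> powr \<sigma>1 + norm (x - y) powr \<sigma>2)))"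

definition is_cont_rep ::
  "(real \<times> (real ^ 'n)) set \<Rightarrow> (real \<times> (real ^ 'n) \<Rightarrow> real) \<Rightarrow> (real \<times> (real ^ 'n) \<Rightarrow> real) \<Rightarrow> bool"
where
  "is_cont_rep D u v \<longleftrightarrow> continuous_on D v \<and> (AE z in lebesgue_on D. v z = u z)"

end

theory Submission imports Defs begin

text \<open>
  The estimate is proved for a function \<open>v\<close> that is continuous on \<open>[0, 1] \<times> R\<^sup>d\<close>, vanishes at time \<open>0\<close>
  and has a weak gradient \<open>G\<close> and a weak fractional derivative \<open>g\<close> in \<open>L\<^sub>p\<close>; it then passes to the
  limit along the approximating sequence of \<open>\<psi>\<close>.  Let \<open>A\<^sub>r(t, x)\<close> be the mean of \<open>v(t, \<cdot>)\<close> over a cube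
  of side \<open>r\<close> at \<open>x\<close>, and let \<open>r = \<tau>\<^sup>\<alpha>\<close> link the spatial scale to a time scale \<open>\<tau>\<close>.

  In time, the weak equation integrated over the cube is the Abel equation
  \<open>I\<^sup>1\<^sup>-\<^sup>\<alpha> A\<^sub>r = I\<^sup>1 f\<close>, where \<open>f\<close> is the mean of \<open>g\<close>; hence \<open>A\<^sub>r = I\<^sup>\<alpha> f\<close> by the semigroup property of the
  Riemann-Liouville integrals (\<open>fractional_inversion\<close>, \<open>frac_dt_integrated\<close>).  As \<open>\<alpha> p > 1\<close>, the kernel
  of \<open>I\<^sup>\<alpha>\<close> is in the dual space of \<open>L\<^sub>p\<close>, and \<open>A\<^sub>r\<close> is Hoelder continuous in time of order
  \<open>\<alpha> - 1/p\<close>, with constant \<open>C r\<^sup>-\<^sup>d\<^sup>/\<^sup>p \<parallel>g\<parallel>\<close> (\<open>time_hoelder\<close>).  At time distance \<open>\<tau>\<close> this is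
  \<open>C r\<^sup>\<sigma> \<parallel>g\<parallel>\<close>.

  In space, the gradient is only known to be in \<open>L\<^sub>p\<close> of space-time, so it has to be averaged in time.
  The integral of \<open>v\<close> over a box changes under a translation by \<open>h\<close> by at most \<open>|h|\<close> times an
  integral of \<open>|G|\<close> over a box of the same size (\<open>translation_estimate\<close>).  With the time estimate, a
  mean over a time interval of length \<open>\<tau>\<close> can be exchanged for the value at one time, and
  \<open>A\<^sub>r(t, \<cdot>)\<close> oscillates by at most \<open>C r\<^sup>\<sigma> (1 + |x - x'|/r)\<close> at each fixed time
  (\<open>mean_oscillation\<close>).  A Campanato argument over the scales \<open>r, r/2, r/4, \<dots>\<close> then bounds
  \<open>A\<^sub>r(t, x) - v(t, x)\<close> by \<open>C r\<^sup>\<sigma>\<close> (\<open>cube_mean_approx\<close>).  The choices \<open>r = |x - y|\<close> and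
  \<open>r = |t - s|\<^sup>\<alpha>\<close> give the two parts of the estimate (\<open>hoelder_estimate\<close>).

  The norms of \<open>\<psi>\<close> and of \<open>v\<^sub>n - \<psi>\<close> are formed with particular weak derivatives, whose sums are weak
  derivatives of \<open>v\<^sub>n\<close> (\<open>is_weak_Dx_add\<close>, \<open>is_frac_dt_add\<close>).  So the estimate for \<open>v\<^sub>n\<close> has a constant that converges to
  a multiple of the norm of \<open>\<psi>\<close>.  A subsequence converges almost everywhere, \<open>\<psi>\<close> satisfies the
  estimate on a set of full measure, and the continuous representative is its extension from that dense
  set (\<open>hoelder_extension\<close>).
\<close>

section \<open>Smooth functions and smooth approximations of boxes\<close>

lemma Ck_on_subset: "Ck_on k D f \<Longrightarrow> S \<subseteq> D \<Longrightarrow> Ck_on k S f"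
proof (induction k arbitrary: f)
  case 0 then show ?case by (auto intro: continuous_on_subset)
next
  case (Suc k)
  then show ?case by simp (meson has_derivative_subset subsetD)
qed

lemma Ck_on_Suc_D: "Ck_on (Suc k) D f \<Longrightarrow> Ck_on k D f"
proof (induction k arbitrary: f)
  case 0
  then show ?case
    by simp (meson continuous_on_eq_continuous_within has_derivative_continuous)
next
  case (Suc k)
  from Suc.prems obtain f' where f': "\<forall>z\<in>D. (f has_derivative f' z) (at z within D)"
    "\<And>v. Ck_on (Suc k) D (\<lambda>z. f' z v)" by (subst (asm) Ck_on.simps(2)) blast
  then show ?case using Suc.IH by auto
qed

lemma Ck_on_const: "Ck_on k D (\<lambda>z. c)"
proof (induction k arbitrary: c)
  case (Suc k)
  show ?case unfolding Ck_on.simps by (intro exI[of _ "\<lambda>z v. 0"]) (auto simp: Suc)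
qed simp

lemma Ck_on_add: "Ck_on k D f \<Longrightarrow> Ck_on k D g \<Longrightarrow> Ck_on k D (\<lambda>z. f z + g z)"
proof (induction k arbitrary: f g)
  case 0 then show ?case by (auto intro: continuous_intros)
next
  case (Suc k)
  from Suc.prems obtain f' g' where
    "\<forall>z\<in>D. (f has_derivative f' z) (at z within D)" "\<And>v. Ck_on k D (\<lambda>z. f' z v)"
    "\<forall>z\<in>D. (g has_derivative g' z) (at z within D)" "\<And>v. Ck_on k D (\<lambda>z. g' z v)" by auto
  then show ?case unfolding Ck_on.simps
    by (intro exI[of _ "\<lambda>z v. f' z v + g' z v"]) (auto intro!: Suc.IH derivative_eq_intros)
qed

lemma Ck_on_mult:
  fixes f g :: "'a::real_normed_vector \<Rightarrow> real"
  shows "Ck_on k D f \<Longrightarrow> Ck_on k D g \<Longrightarrow> Ck_on k D (\<lambda>z. f z * g z)"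
proof (induction k arbitrary: f g)
  case 0 then show ?case by (auto intro: continuous_intros)
next
  case (Suc k)
  from Suc.prems obtain f' g' where
    *: "\<forall>z\<in>D. (f has_derivative f' z) (at z within D)" "\<And>v. Ck_on k D (\<lambda>z. f' z v)"
    "\<forall>z\<in>D. (g has_derivative g' z) (at z within D)" "\<And>v. Ck_on k D (\<lambda>z. g' z v)" by auto
  have **: "Ck_on k D f" "Ck_on k D g" using Suc.prems by (blast dest: Ck_on_Suc_D)+
  show ?case unfolding Ck_on.simps
    by (intro exI[of _ "\<lambda>z v. f z * g' z v + f' z v * g z"])
      (auto intro!: Suc.IH Ck_on_add derivative_eq_intros *(2,4) ** simp: *(1,3)[rule_format])
qed

lemma Ck_on_affine_compose:
  fixes A :: "'a::real_normed_vector \<Rightarrow> 'b::real_normed_vector"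
  assumes A: "bounded_linear A"
  shows "Ck_on k UNIV f \<Longrightarrow> Ck_on k UNIV (\<lambda>z. f (A z + c))"
proof (induction k arbitrary: f)
  case 0
  have "continuous_on UNIV (\<lambda>z. f (A z + c))"
    by (rule continuous_on_compose2[of UNIV f])
      (use 0 linear_continuous_on[OF A, of UNIV] in \<open>auto intro: continuous_on_add continuous_on_const\<close>)
  then show ?case by simp
next
  case (Suc k)
  from Suc.prems obtain f' where f': "\<And>z. (f has_derivative f' z) (at z)"
    "\<And>v. Ck_on k UNIV (\<lambda>z. f' z v)" by auto
  have "((\<lambda>z. f (A z + c)) has_derivative (\<lambda>v. f' (A z + c) (A v))) (at z)" for z
    by (rule has_derivative_compose[OF _ f'(1), of "\<lambda>z. A z + c"])
       (auto intro!: derivative_eq_intros bounded_linear_imp_has_derivative A)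
  then show ?case unfolding Ck_on.simps
    by (intro exI[of _ "\<lambda>z v. f' (A z + c) (A v)"]) (auto intro!: Suc.IH f'(2))
qed

text \<open>In one variable a derivative is a single function, which makes smoothness an induction on
  families of functions closed under differentiation.\<close>

lemma Ck_on_Suc_real:
  fixes f :: "real \<Rightarrow> real"
  assumes "\<And>x. (f has_real_derivative f' x) (at x)" "Ck_on k UNIV f'"
  shows "Ck_on (Suc k) UNIV f"
  unfolding Ck_on.simps
  by (intro exI[of _ "\<lambda>z v. f' z * v"])
     (use assms in \<open>auto simp: has_field_derivative_def intro!: Ck_on_mult Ck_on_const\<close>)

text \<open>The functions \<open>P(1/x) exp(-1/x)\<close>, extended by \<open>0\<close> to \<open>x \<le> 0\<close>, with \<open>P\<close> a polynomial: this
  family contains \<open>exp(-1/x)\<close> and is closed under differentiation.\<close>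

definition flat :: "real poly \<Rightarrow> real \<Rightarrow> real" where
  "flat P x = (if x > 0 then poly P (1 / x) * exp (- (1 / x)) else 0)"

lemma poly_exp_decay: "((\<lambda>y. poly P y * exp (- y)) \<longlongrightarrow> 0) at_top" for P :: "real poly"
proof -
  have "((\<lambda>y. \<Sum>i\<le>degree P. coeff P i * (y ^ i / exp y)) \<longlongrightarrow> (\<Sum>i\<le>degree P. coeff P i * 0)) at_top"
    by (intro tendsto_intros tendsto_power_div_exp_0)
  then show ?thesis by (simp add: poly_altdef sum_distrib_right exp_minus divide_inverse mult.assoc)
qed

lemma flat_tendsto_0: "(flat P \<longlongrightarrow> 0) (at_right 0)"
proof -
  have "((\<lambda>x. poly P (inverse x) * exp (- (inverse x))) \<longlongrightarrow> 0) (at_right 0)"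
    by (rule filterlim_compose[OF poly_exp_decay filterlim_inverse_at_top_right])
  moreover have "eventually (\<lambda>x::real. poly P (inverse x) * exp (- (inverse x)) = flat P x) (at_right 0)"
    unfolding eventually_at_right_field by (intro exI[of _ 1]) (auto simp: flat_def inverse_eq_divide)
  ultimately show ?thesis by (rule Lim_transform_eventually)
qed

lemma flat_has_derivative:
  "(flat P has_real_derivative flat ([:0, 0, 1:] * (P - pderiv P)) x) (at x)"
proof -
  consider "x > 0" | "x < 0" | "x = 0" by linarith
  then show ?thesis
  proof cases
    case 1
    have "((\<lambda>x. poly P (1 / x) * exp (- (1 / x))) has_real_derivative
            flat ([:0, 0, 1:] * (P - pderiv P)) x) (at x)"
      using 1 by (auto intro!: derivative_eq_intros poly_DERIV
          simp: flat_def power2_eq_square field_simps)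
    then show ?thesis
      by (rule DERIV_cong_ev[THEN iffD1, rotated 3])
        (use 1 in \<open>auto simp: flat_def intro: eventually_mono[OF eventually_nhds_in_open[of "{0<..}"]]\<close>)
  next
    case 2
    have "((\<lambda>x. 0) has_real_derivative 0) (at x)" by simp
    then show ?thesis
      by (rule DERIV_cong_ev[THEN iffD1, rotated 3])
        (use 2 in \<open>auto simp: flat_def intro: eventually_mono[OF eventually_nhds_in_open[of "{..<0}"]]\<close>)
  next
    case 3
    have "((\<lambda>h. (flat P (0 + h) - flat P 0) / h) \<longlongrightarrow> 0) (at_right 0)"
    proof (rule Lim_transform_eventually[OF flat_tendsto_0[of "[:0, 1:] * P"]])
      show "eventually (\<lambda>x. flat ([:0, 1:] * P) x = (flat P (0 + x) - flat P 0) / x) (at_right 0)"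
        unfolding eventually_at_right_field by (intro exI[of _ 1]) (auto simp: flat_def field_simps)
    qed
    moreover have "((\<lambda>h. (flat P (0 + h) - flat P 0) / h) \<longlongrightarrow> 0) (at_left 0)"
    proof (rule Lim_transform_eventually[OF tendsto_const])
      show "eventually (\<lambda>x. 0 = (flat P (0 + x) - flat P 0) / x) (at_left 0)"
        unfolding eventually_at_left_field by (intro exI[of _ "-1"]) (auto simp: flat_def field_simps)
    qed
    ultimately show ?thesis using 3
      by (simp add: DERIV_def filterlim_split_at flat_def)
  qed
qed

lemma Ck_flat: "Ck_on k UNIV (flat P)"
proof (induction k arbitrary: P)
  case 0
  show ?case using flat_has_derivative[THEN DERIV_isCont] by (simp add: continuous_at_imp_continuous_on)
next
  case (Suc k) show ?case by (rule Ck_on_Suc_real[OF flat_has_derivative Suc])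
qed

abbreviation flat1 :: "real \<Rightarrow> real" where "flat1 \<equiv> flat 1"

lemma flat1_bounds: "0 \<le> flat1 x" "flat1 x \<le> 1" "flat1 x > 0 \<longleftrightarrow> x > 0" "x \<le> 0 \<Longrightarrow> flat1 x = 0"
  by (auto simp: flat_def)

lemma Ck_on_prod:
  fixes f :: "'i \<Rightarrow> 'a::real_normed_vector \<Rightarrow> real"
  assumes "\<And>i. i \<in> I \<Longrightarrow> Ck_on k D (f i)"
  shows "Ck_on k D (\<lambda>z. \<Prod>i\<in>I. f i z)"
  using assms by (induction I rule: infinite_finite_induct) (auto intro!: Ck_on_const Ck_on_mult)

lemma Ck_on_power:
  fixes f :: "'a::real_normed_vector \<Rightarrow> real"
  shows "Ck_on k D f \<Longrightarrow> Ck_on k D (\<lambda>z. f z ^ n)"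
  by (induction n) (auto intro!: Ck_on_const Ck_on_mult)

text \<open>Smooth, with values in \<open>[0, 1]\<close>, and positive exactly on the open box whose faces are moved
  inwards by \<open>\<delta>\<close>.\<close>

definition box_bump :: "'a::euclidean_space \<Rightarrow> 'a \<Rightarrow> real \<Rightarrow> 'a \<Rightarrow> real" where
  "box_bump a b \<delta> z = (\<Prod>i\<in>Basis. flat1 (z \<bullet> i - a \<bullet> i - \<delta>) * flat1 (b \<bullet> i - z \<bullet> i - \<delta>))"

lemma Ck_box_bump: "Ck_on k UNIV (box_bump a b \<delta>)"
proof -
  have "Ck_on k UNIV (\<lambda>z. flat1 (z \<bullet> i - a \<bullet> i - \<delta>))" for i
    using Ck_on_affine_compose[OF bounded_linear_inner_left Ck_flat, of k 1 i "- a \<bullet> i - \<delta>"]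
    by (simp add: algebra_simps)
  moreover have "Ck_on k UNIV (\<lambda>z. flat1 (b \<bullet> i - z \<bullet> i - \<delta>))" for i
    using Ck_on_affine_compose[OF bounded_linear_minus[OF bounded_linear_inner_left] Ck_flat, of k 1 i "b \<bullet> i - \<delta>"]
    by (simp add: algebra_simps)
  ultimately show ?thesis unfolding box_bump_def by (intro Ck_on_prod Ck_on_mult)
qed

lemma box_bump_bounds: "0 \<le> box_bump a b \<delta> z" "box_bump a b \<delta> z \<le> 1"
  unfolding box_bump_def
  by (auto intro!: prod_nonneg prod_le_1 mult_nonneg_nonneg mult_le_one simp: flat1_bounds)

lemma box_bump_pos: "z \<in> box a b \<Longrightarrow> box_bump a b 0 z > 0"
  unfolding box_bump_def
  by (intro prod_pos mult_pos_pos ballI) (auto simp: flat1_bounds mem_box)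

lemma box_bump_zero:
  assumes "\<delta> \<ge> 0" "z \<notin> cbox (a + \<delta> *\<^sub>R One) (b - \<delta> *\<^sub>R One)"
  shows "box_bump a b \<delta> z = 0"
proof -
  from assms obtain i where "i \<in> Basis" "z \<bullet> i - a \<bullet> i - \<delta> < 0 \<or> b \<bullet> i - z \<bullet> i - \<delta> < 0"
    by (force simp: mem_box algebra_simps)
  then show ?thesis unfolding box_bump_def
    by (intro prod_zero) (auto intro!: bexI[of _ i] simp: flat1_bounds)
qed

lemma shrunk_cbox_subset:
  fixes a b :: "'a::euclidean_space"
  assumes "\<delta> > 0"
  shows "cbox (a + \<delta> *\<^sub>R One) (b - \<delta> *\<^sub>R One) \<subseteq> box a b"
proof
  fix z assume z: "z \<in> cbox (a + \<delta> *\<^sub>R One) (b - \<delta> *\<^sub>R One)"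
  show "z \<in> box a b" unfolding mem_box
  proof
    fix i :: 'a assume "i \<in> Basis"
    with z have "a \<bullet> i + \<delta> \<le> z \<bullet> i \<and> z \<bullet> i \<le> b \<bullet> i - \<delta>"
      by (simp add: mem_box algebra_simps)
    with assms show "a \<bullet> i < z \<bullet> i \<and> z \<bullet> i < b \<bullet> i" by linarith
  qed
qed

text \<open>Take \<open>\<phi>\<^sub>n = 1 - (1 - w\<^sub>n)\<^sup>n\<close>, where \<open>w\<^sub>n\<close> is the bump of the box shrunk by \<open>1/(n + 1)\<close>.  It
  is a polynomial in \<open>w\<^sub>n\<close>, hence smooth; it vanishes where \<open>w\<^sub>n\<close> does, and at a point of the box
  \<open>w\<^sub>n\<close> stays away from \<open>0\<close>, so that the power tends to \<open>0\<close>.\<close>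

lemma smooth_box_approximation:
  fixes a b :: "'a::euclidean_space"
  obtains \<phi> :: "nat \<Rightarrow> 'a \<Rightarrow> real" where
    "\<And>n k. Ck_on k UNIV (\<phi> n)" "\<And>n z. 0 \<le> \<phi> n z" "\<And>n z. \<phi> n z \<le> 1"
    "\<And>n. \<exists>K. compact K \<and> K \<subseteq> box a b \<and> (\<forall>z. z \<notin> K \<longrightarrow> \<phi> n z = 0)"
    "\<And>z. (\<lambda>n. \<phi> n z) \<longlonglongrightarrow> indicator (box a b) z"
proof
  define \<phi> where "\<phi> n z = 1 - (1 - box_bump a b (1 / Suc n) z) ^ n" for n and z :: 'a
  note w = box_bump_bounds[of a b]
  show "Ck_on k UNIV (\<phi> n)" for n k
    using Ck_on_add[OF Ck_on_const[of k UNIV 1] Ck_on_mult[OF Ck_on_const[of k UNIV "-1"]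
      Ck_on_power[OF Ck_on_add[OF Ck_on_const[of k UNIV 1]  Ck_on_mult[OF Ck_on_const[of k UNIV "-1"] Ck_box_bump]]]]]
    unfolding \<phi>_def by simp
  show "0 \<le> \<phi> n z" "\<phi> n z \<le> 1" for n z
    using w[of "1 / Suc n" z] by (auto simp: \<phi>_def power_le_one)
  show "\<exists>K. compact K \<and> K \<subseteq> box a b \<and> (\<forall>z. z \<notin> K \<longrightarrow> \<phi> n z = 0)" for n
  proof -
    define K where "K = cbox (a + (1 / Suc n) *\<^sub>R One) (b - (1 / Suc n) *\<^sub>R One)"
    have "compact K" "K \<subseteq> box a b"
      unfolding K_def by (auto intro!: shrunk_cbox_subset[THEN subsetD])
    moreover have "\<phi> n z = 0" if "z \<notin> K" for z
      using box_bump_zero[of "1 / Suc n" z a b] that by (simp add: \<phi>_def K_def)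
    ultimately show ?thesis by blast
  qed
  show "(\<lambda>n. \<phi> n z) \<longlonglongrightarrow> indicator (box a b) z" for z
  proof (cases "z \<in> box a b")
    case True
    define c where "c = box_bump a b 0 z"
    have c: "0 < c" using box_bump_pos[OF True] by (simp add: c_def)
    have cf: "isCont flat1 x" for x by (rule DERIV_isCont[OF flat_has_derivative])
    have "(\<lambda>n. box_bump a b (1 / Suc n) z) \<longlonglongrightarrow> box_bump a b 0 z"
      unfolding box_bump_def
      by (intro tendsto_prod tendsto_mult isCont_tendsto_compose[OF cf] tendsto_diff tendsto_const
            LIMSEQ_inverse_real_of_nat[unfolded inverse_eq_divide])
    then have ev: "eventually (\<lambda>n. box_bump a b (1 / Suc n) z > c / 2) sequentially"
      by (rule order_tendstoD) (use c in \<open>simp add: c_def\<close>)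
    have "(\<lambda>n. (1 - box_bump a b (1 / Suc n) z) ^ n) \<longlonglongrightarrow> 0"
    proof (rule tendsto_sandwich[of "\<lambda>n. 0" _ _ "\<lambda>n. (1 - c / 2) ^ n"])
      show "(\<lambda>n. (1 - c / 2) ^ n) \<longlonglongrightarrow> 0"
        by (intro LIMSEQ_power_zero) (use c w(2)[of 0 z] in \<open>auto simp: c_def\<close>)
      show "(\<lambda>n. 0::real) \<longlonglongrightarrow> 0" by simp
      show "eventually (\<lambda>n. (1 - box_bump a b (1 / Suc n) z) ^ n \<le> (1 - c / 2) ^ n) sequentially"
        using ev by eventually_elim (use w(2) in \<open>auto intro!: power_mono\<close>)
    qed (use w(2) in \<open>auto intro!: always_eventually\<close>)
    then have "(\<lambda>n. 1 - (1 - box_bump a b (1 / Suc n) z) ^ n) \<longlonglongrightarrow> 1 - 0"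
      by (intro tendsto_intros)
    then show ?thesis using True by (simp add: \<phi>_def)
  next
    case False
    have "box_bump a b (1 / Suc n) z = 0" for n
    proof (rule box_bump_zero)
      show "z \<notin> cbox (a + (1 / Suc n) *\<^sub>R One) (b - (1 / Suc n) *\<^sub>R One)"
        using False shrunk_cbox_subset[of "1 / Suc n" a b] by auto
    qed simp
    then show ?thesis using False by (simp add: \<phi>_def)
  qed
qed

section \<open>Inequalities in Lebesgue spaces\<close>

lemma Hoelder_integrable:
  fixes f g :: "'a \<Rightarrow> real"
  assumes pq: "1 < p" "1 < q" "1 / p + 1 / q = 1"
    and [measurable]: "f \<in> borel_measurable M" "g \<in> borel_measurable M"
    and f: "integrable M (\<lambda>x. \<bar>f x\<bar> powr p)" and g: "integrable M (\<lambda>x. \<bar>g x\<bar> powr q)"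
  shows "integrable M (\<lambda>x. f x * g x)"
proof (rule Bochner_Integration.integrable_bound)
  show "integrable M (\<lambda>x. \<bar>f x\<bar> powr p / p + \<bar>g x\<bar> powr q / q)"
    using f g by auto
  show "AE x in M. norm (f x * g x) \<le> norm (\<bar>f x\<bar> powr p / p + \<bar>g x\<bar> powr q / q)"
    using Youngs_inequality[OF pq, of "\<bar>f _\<bar>" "\<bar>g _\<bar>"] pq
    by (intro AE_I2) (auto simp: abs_mult intro: order_trans)
qed simp

lemma Hoelder_inequality:
  fixes f g :: "'a \<Rightarrow> real"
  assumes pq: "1 < p" "1 < q" "1 / p + 1 / q = 1"
    and [measurable]: "f \<in> borel_measurable M" "g \<in> borel_measurable M"
    and f: "integrable M (\<lambda>x. \<bar>f x\<bar> powr p)" and g: "integrable M (\<lambda>x. \<bar>g x\<bar> powr q)"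
  shows "(\<integral>x. \<bar>f x * g x\<bar> \<partial>M) \<le> (\<integral>x. \<bar>f x\<bar> powr p \<partial>M) powr (1 / p) * (\<integral>x. \<bar>g x\<bar> powr q \<partial>M) powr (1 / q)"
proof -
  define A where "A = (\<integral>x. \<bar>f x\<bar> powr p \<partial>M)"
  define B where "B = (\<integral>x. \<bar>g x\<bar> powr q \<partial>M)"
  have "A \<ge> 0" "B \<ge> 0" by (auto simp: A_def B_def)
  show ?thesis
  proof (cases "A = 0 \<or> B = 0")
    case True
    have "AE x in M. f x * g x = 0"
      using True
    proof
      assume "A = 0"
      then have "AE x in M. \<bar>f x\<bar> powr p = 0"
        using f by (subst (asm) A_def, subst (asm) integral_nonneg_eq_0_iff_AE) auto
      then show ?thesis by auto
    next
      assume "B = 0"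
      then have "AE x in M. \<bar>g x\<bar> powr q = 0"
        using g by (subst (asm) B_def, subst (asm) integral_nonneg_eq_0_iff_AE) auto
      then show ?thesis by auto
    qed
    then have "(\<integral>x. \<bar>f x * g x\<bar> \<partial>M) = (\<integral>x. 0 \<partial>M)" by (intro integral_cong_AE) auto
    then show ?thesis by simp
  next
    case False
    with \<open>A \<ge> 0\<close> \<open>B \<ge> 0\<close> have AB: "A > 0" "B > 0" by auto
    \<comment> \<open>Young's inequality is applied to the functions normalised to norm one.\<close>
    define a b where "a = A powr (1 / p)" and "b = B powr (1 / q)"
    have ab: "a > 0" "b > 0" "a powr p = A" "b powr q = B"
      using AB pq by (auto simp: a_def b_def powr_powr)
    have "\<bar>f x * g x\<bar> / (a * b) \<le> \<bar>f x\<bar> powr p / (p * A) + \<bar>g x\<bar> powr q / (q * B)" for x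
      using Youngs_inequality[OF pq, of "\<bar>f x\<bar> / a" "\<bar>g x\<bar> / b"] ab
      by (simp add: abs_mult powr_divide mult.commute[of p] mult.commute[of q])
    then have "(\<integral>x. \<bar>f x * g x\<bar> / (a * b) \<partial>M) \<le> (\<integral>x. \<bar>f x\<bar> powr p / (p * A) + \<bar>g x\<bar> powr q / (q * B) \<partial>M)"
      using f g Hoelder_integrable[OF assms] by (intro integral_mono) auto
    also have "\<dots> = A / (p * A) + B / (q * B)"
      using f g by (simp add: A_def B_def)
    also have "\<dots> = 1" using AB pq by (simp add: field_simps)
    finally have "(\<integral>x. \<bar>f x * g x\<bar> \<partial>M) / (a * b) \<le> 1" by simp
    then have "(\<integral>x. \<bar>f x * g x\<bar> \<partial>M) \<le> a * b" using ab by (simp add: pos_divide_le_eq)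
    then show ?thesis by (simp add: a_def b_def A_def B_def)
  qed
qed

text \<open>The inequality \<open>(a + b)\<^sup>p \<le> 2\<^sup>p (a\<^sup>p + b\<^sup>p)\<close> gives a triangle inequality with a constant, which is
  absorbed by the constant of the embedding.\<close>

lemma Lp_add:
  assumes p: "1 < p" and f: "f \<in> Lp p D" and g: "g \<in> Lp p D"
  shows "(\<lambda>z. f z + g z) \<in> Lp p D"
    and "Lp_norm p D (\<lambda>z. f z + g z) \<le> 4 * (Lp_norm p D f + Lp_norm p D g)"
proof -
  have [measurable]: "f \<in> borel_measurable (lebesgue_on D)" "g \<in> borel_measurable (lebesgue_on D)"
    and i: "integrable (lebesgue_on D) (\<lambda>z. norm (f z) powr p)"
           "integrable (lebesgue_on D) (\<lambda>z. norm (g z) powr p)"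
    using f g by (auto simp: Lp_def)
  define A B where "A = (\<integral>z. norm (f z) powr p \<partial>lebesgue_on D)" and "B = (\<integral>z. norm (g z) powr p \<partial>lebesgue_on D)"
  have AB: "A \<ge> 0" "B \<ge> 0" by (auto simp: A_def B_def)
  have le: "norm (f z + g z) powr p \<le> 2 powr p * (norm (f z) powr p + norm (g z) powr p)" for z
  proof -
    have "norm (f z + g z) \<le> 2 * max (norm (f z)) (norm (g z))"
      using norm_triangle_ineq[of "f z" "g z"] by simp
    then have "norm (f z + g z) powr p \<le> (2 * max (norm (f z)) (norm (g z))) powr p"
      using p by (intro powr_mono2) auto
    also have "\<dots> = 2 powr p * max (norm (f z)) (norm (g z)) powr p"
      by (auto simp: powr_mult)
    also have "max (norm (f z)) (norm (g z)) powr p \<le> norm (f z) powr p + norm (g z) powr p"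
      by (auto simp: max_def)
    finally show ?thesis by simp
  qed
  have int: "integrable (lebesgue_on D) (\<lambda>z. norm (f z + g z) powr p)"
    by (rule Bochner_Integration.integrable_bound[of _ "\<lambda>z. 2 powr p * (norm (f z) powr p + norm (g z) powr p)"])
      (use i le in auto)
  then show "(\<lambda>z. f z + g z) \<in> Lp p D" by (simp add: Lp_def)
  have "(\<integral>z. norm (f z + g z) powr p \<partial>lebesgue_on D)
      \<le> (\<integral>z. 2 powr p * (norm (f z) powr p + norm (g z) powr p) \<partial>lebesgue_on D)"
    using int i le by (intro integral_mono) auto
  also have "\<dots> = 2 powr p * (A + B)" using i by (simp add: A_def B_def)
  finally have "Lp_norm p D (\<lambda>z. f z + g z) \<le> (2 powr p * (A + B)) powr (1 / p)"
    unfolding Lp_norm_def using p by (intro powr_mono2) auto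
  also have "\<dots> = 2 * (A + B) powr (1 / p)"
    using p AB by (simp add: powr_mult powr_powr)
  also have "(A + B) powr (1 / p) \<le> (2 * max A B) powr (1 / p)"
    using p AB by (intro powr_mono2) auto
  also have "\<dots> = 2 powr (1 / p) * max A B powr (1 / p)"
    using AB by (simp add: powr_mult)
  also have "\<dots> \<le> 2 powr 1 * (A powr (1 / p) + B powr (1 / p))"
    using p AB by (intro mult_mono powr_mono) (auto simp: max_def)
  finally show "Lp_norm p D (\<lambda>z. f z + g z) \<le> 4 * (Lp_norm p D f + Lp_norm p D g)"
    by (simp add: A_def B_def Lp_norm_def)
qed

lemma Lp_minus:
  assumes "f \<in> Lp p D" shows "(\<lambda>z. - f z) \<in> Lp p D"
  using assms by (simp add: Lp_def)

lemma Lp_norm_nonneg: "Lp_norm p D f \<ge> 0"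
  by (simp add: Lp_norm_def)

text \<open>On a compact set \<open>L\<^sub>p\<close> is contained in \<open>L\<^sub>1\<close>, because \<open>|f| \<le> 1 + |f|\<^sup>p\<close>.  This makes
  the pairings with test functions convergent.\<close>

lemma Lp_imp_integrable_bounded_support:
  assumes p: "1 < p" and D: "D \<in> sets lebesgue" and f: "f \<in> Lp p D" and K: "compact K"
    and [measurable]: "\<phi> \<in> borel_measurable (lebesgue_on D)"
    and b: "\<And>z. z \<in> D \<Longrightarrow> \<bar>\<phi> z :: real\<bar> \<le> C" and s: "\<And>z. z \<in> D - K \<Longrightarrow> \<phi> z = 0"
  shows "integrable (lebesgue_on D) (\<lambda>z. \<phi> z *\<^sub>R f z)"
proof (rule Bochner_Integration.integrable_bound)
  have [measurable]: "f \<in> borel_measurable (lebesgue_on D)" and fi: "integrable (lebesgue_on D) (\<lambda>z. norm (f z) powr p)"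
    using f by (auto simp: Lp_def)
  have "integrable (lebesgue_on D) (\<lambda>z. indicator K z :: real)"
  proof -
    have "K \<in> lmeasurable" using K by (rule lmeasurable_compact)
    then have "integrable lebesgue (indicator K :: _ \<Rightarrow> real)"
      by (intro integrable_real_indicator) (auto simp: fmeasurable_def)
    then show ?thesis using D integrable_mult_indicator[of D lebesgue "indicator K :: _ \<Rightarrow> real"]
      by (subst integrable_restrict_space) auto
  qed
  then show "integrable (lebesgue_on D) (\<lambda>z. \<bar>C\<bar> * (indicator K z + norm (f z) powr p))"
    using fi by auto
  show "(\<lambda>z. \<phi> z *\<^sub>R f z) \<in> borel_measurable (lebesgue_on D)" by measurable
  have "norm (\<phi> z *\<^sub>R f z) \<le> \<bar>C\<bar> * (indicator K z + norm (f z) powr p)" if "z \<in> D" for z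
  proof (cases "z \<in> K")
    case True
    have "norm (f z) \<le> 1 + norm (f z) powr p"
    proof (cases "norm (f z) \<le> 1")
      case False
      then have "norm (f z) powr 1 \<le> norm (f z) powr p" using p by (intro powr_mono) auto
      with False show ?thesis by simp
    qed (simp add: add_increasing2)
    with True b[OF that] show ?thesis by (auto intro!: mult_mono)
  qed (use s that in auto)
  then show "AE z in lebesgue_on D. norm (\<phi> z *\<^sub>R f z) \<le> norm (\<bar>C\<bar> * (indicator K z + norm (f z) powr p))"
    by (intro AE_I2) (auto intro: order_trans simp: space_restrict_space)
qed

section \<open>Riemann-Liouville integrals in one variable\<close>

text \<open>The kernel \<open>s\<^sub>+\<^sup>a\<^sup>-\<^sup>1 / \<Gamma>(a)\<close> of the Riemann-Liouville integral of order \<open>a\<close>.\<close>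

definition RL_ker :: "real \<Rightarrow> real \<Rightarrow> real" where
  "RL_ker a s = (if 0 < s then s powr (a - 1) / Gamma a else 0)"

text \<open>The convolution runs over the whole line.  It is the Riemann-Liouville integral from \<open>0\<close> for
  functions that vanish on \<open>(-\<infinity>, 0]\<close>.\<close>

definition RL :: "real \<Rightarrow> (real \<Rightarrow> real) \<Rightarrow> real \<Rightarrow> real" where
  "RL a f t = (\<integral>s. RL_ker a (t - s) * f s \<partial>lborel)"

lemma RL_ker_measurable [measurable]: "RL_ker a \<in> borel_measurable borel"
  unfolding RL_ker_def by measurable

lemma RL_ker_nonneg: "a > 0 \<Longrightarrow> RL_ker a s \<ge> 0"
  by (simp add: RL_ker_def Gamma_real_pos less_imp_le)

text \<open>An affine substitution maps \<open>[q, t]\<close> to \<open>[0, 1]\<close> and turns the convolution into Euler's Beta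
  integral.\<close>

lemma nn_integral_RL_ker_convolution:
  assumes a: "a > 0" and b: "b > 0"
  shows "(\<integral>\<^sup>+s. ennreal (RL_ker a (t - s) * RL_ker b (s - q)) \<partial>lborel) = ennreal (RL_ker (a + b) (t - q))"
proof (cases "q < t")
  case False
  then have "(\<integral>\<^sup>+s. ennreal (RL_ker a (t - s) * RL_ker b (s - q)) \<partial>lborel) = (\<integral>\<^sup>+s. 0 \<partial>(lborel :: real measure))"
    by (intro nn_integral_cong) (auto simp: RL_ker_def)
  then show ?thesis using False by (simp add: RL_ker_def)
next
  case True
  define L where "L = t - q"
  have L: "L > 0" using True by (simp add: L_def)
  have G: "Gamma a > 0" "Gamma b > 0" "Gamma (a + b) > 0" using a b by (auto intro: Gamma_real_pos)
  define c where "c = L powr (a + b - 2) / (Gamma a * Gamma b)"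
  have c: "c \<ge> 0" using G by (simp add: c_def)
  have eq: "RL_ker a (t - (q + L * u)) * RL_ker b (q + L * u - q)
      = c * (indicator {0..1} u * (u powr (b - 1) * (1 - u) powr (a - 1)))" for u
  proof (cases "0 < u \<and> u < 1")
    case True
    have "t - (q + L * u) = L * (1 - u)" by (simp add: L_def algebra_simps)
    moreover have "L powr (a - 1) * L powr (b - 1) = L powr (a + b - 2)"
      by (simp flip: powr_add)
    ultimately show ?thesis using True L by (auto simp: RL_ker_def c_def powr_mult)
  next
    case False
    have "t - (q + L * u) = L * (1 - u)" by (simp add: L_def algebra_simps)
    with False L show ?thesis by (auto simp: RL_ker_def indicator_def zero_less_mult_iff)
  qed
  have B: "(\<integral>\<^sup>+u. ennreal (indicator {0..1} u * (u powr (b - 1) * (1 - u) powr (a - 1))) \<partial>lborel)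
      = ennreal (Beta b a)"
    by (rule nn_integral_has_integral_lebesgue[OF _ has_integral_Beta_real[OF b a]]) auto
  have "(\<integral>\<^sup>+s. ennreal (RL_ker a (t - s) * RL_ker b (s - q)) \<partial>lborel)
      = ennreal L * (\<integral>\<^sup>+u. ennreal (RL_ker a (t - (q + L * u)) * RL_ker b (q + L * u - q)) \<partial>lborel)"
    using L by (subst nn_integral_real_affine[of _ L q]) auto
  also have "\<dots> = ennreal L * (ennreal c * ennreal (Beta b a))"
    unfolding eq B[symmetric] using c by (simp add: ennreal_mult' nn_integral_cmult)
  also have "\<dots> = ennreal (L * (c * Beta b a))"
    using c L a b by (simp add: ennreal_mult')
  also have "L * (c * Beta b a) = RL_ker (a + b) (t - q)"
  proof -
    have "L * L powr (a + b - 2) = L powr (a + b - 1)"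
      using L powr_add[of L 1 "a + b - 2"] by simp
    moreover have "L * (c * Beta b a) = L * L powr (a + b - 2) / Gamma (a + b)"
      using G by (simp add: c_def Beta_def rGamma_inverse_Gamma add.commute[of b a] field_simps)
    ultimately show ?thesis using L by (simp add: RL_ker_def L_def)
  qed
  finally show ?thesis .
qed

lemma integral_RL_ker_convolution:
  assumes a: "a > 0" and b: "b > 0"
  shows "(\<integral>s. RL_ker a (t - s) * RL_ker b (s - q) \<partial>lborel) = RL_ker (a + b) (t - q)"
  by (rule integral_eq_nn_integral[THEN trans])
    (use assms in \<open>auto simp: nn_integral_RL_ker_convolution RL_ker_nonneg\<close>)

text \<open>Fubini's theorem together with the convolution of the kernels.  As \<open>a + b \<ge> 1\<close>, the kernel of
  order \<open>a + b\<close> is bounded on bounded sets, so that the double integral converges absolutely and the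
  identity holds at every \<open>t\<close>, not only almost everywhere.\<close>

lemma RL_semigroup:
  assumes a: "a > 0" and b: "b > 0" and ab: "a + b \<ge> 1"
    and f: "integrable lborel f" and f0: "\<And>s. s \<le> 0 \<Longrightarrow> f s = 0"
  shows "RL a (RL b f) t = RL (a + b) f t"
proof -
  have [measurable]: "f \<in> borel_measurable borel" using f by auto
  define F where "F q s = RL_ker a (t - s) * RL_ker b (s - q) * f q" for q s
  have [measurable]: "case_prod F \<in> borel_measurable (lborel \<Otimes>\<^sub>M lborel)"
    unfolding F_def by measurable
  define C where "C = max t 0 powr (a + b - 1) / Gamma (a + b)"
  have G: "Gamma (a + b) > 0" using a b by (intro Gamma_real_pos) auto
  have C: "C \<ge> 0" using G by (simp add: C_def)
  have bd: "RL_ker (a + b) (t - q) * \<bar>f q\<bar> \<le> C * \<bar>f q\<bar>" for q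
  proof (cases "0 < q \<and> q < t")
    case True
    then have "(t - q) powr (a + b - 1) \<le> max t 0 powr (a + b - 1)"
      using ab by (intro powr_mono2) auto
    then show ?thesis using True G by (auto simp: RL_ker_def C_def intro!: mult_right_mono divide_right_mono)
  next
    case False
    then have "f q = 0 \<or> RL_ker (a + b) (t - q) = 0" using f0 by (auto simp: RL_ker_def)
    then show ?thesis using C by auto
  qed
  have int: "integrable (lborel \<Otimes>\<^sub>M lborel) (case_prod F)"
  proof (rule integrableI_bounded)
    have "(\<integral>\<^sup>+x. ennreal (norm (case_prod F x)) \<partial>(lborel \<Otimes>\<^sub>M lborel))
        = (\<integral>\<^sup>+q. \<integral>\<^sup>+s. ennreal (norm (F q s)) \<partial>lborel \<partial>lborel)"
      by (subst lborel.nn_integral_fst[symmetric]) auto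
    also have "\<dots> = (\<integral>\<^sup>+q. \<integral>\<^sup>+s. ennreal (RL_ker a (t - s) * RL_ker b (s - q)) * ennreal \<bar>f q\<bar> \<partial>lborel \<partial>lborel)"
      using a b by (auto simp: F_def abs_mult RL_ker_nonneg ennreal_mult' intro!: nn_integral_cong)
    also have "\<dots> = (\<integral>\<^sup>+q. ennreal (RL_ker (a + b) (t - q) * \<bar>f q\<bar>) \<partial>lborel)"
      using a b by (auto simp: nn_integral_multc nn_integral_RL_ker_convolution ennreal_mult'' intro!: nn_integral_cong)
    also have "\<dots> \<le> (\<integral>\<^sup>+q. ennreal (C * \<bar>f q\<bar>) \<partial>lborel)"
      by (intro nn_integral_mono ennreal_leI bd)
    also have "\<dots> < \<infinity>"
      using f C by (auto simp: ennreal_mult' nn_integral_cmult integrable_iff_bounded ennreal_mult_less_top)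
    finally show "(\<integral>\<^sup>+x. ennreal (norm (case_prod F x)) \<partial>(lborel \<Otimes>\<^sub>M lborel)) < \<infinity>" .
  qed simp
  have "RL a (RL b f) t = (\<integral>s. \<integral>q. F q s \<partial>lborel \<partial>lborel)"
    by (simp add: RL_def F_def mult.assoc)
  also have "\<dots> = (\<integral>q. \<integral>s. F q s \<partial>lborel \<partial>lborel)"
    by (rule lborel_pair.Fubini_integral[OF int])
  also have "\<dots> = RL (a + b) f t"
    by (simp add: RL_def F_def integral_RL_ker_convolution a b)
  finally show ?thesis .
qed

lemma RL_nonpos:
  assumes "\<And>s. s \<le> 0 \<Longrightarrow> f s = 0" "t \<le> 0"
  shows "RL a f t = 0"
proof -
  have "(\<lambda>s. RL_ker a (t - s) * f s) = (\<lambda>s. 0)"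
  proof
    fix s show "RL_ker a (t - s) * f s = 0"
      using assms by (cases "s \<le> 0") (auto simp: RL_ker_def)
  qed
  then show ?thesis by (simp add: RL_def)
qed

lemma RL_cong:
  assumes "\<And>s. s < t \<Longrightarrow> f s = g s"
  shows "RL a f t = RL a g t"
  unfolding RL_def using assms by (intro Bochner_Integration.integral_cong) (auto simp: RL_ker_def)

lemma RL2_eq_integral:
  assumes "continuous_on {0..1} k" "0 < t" "t < 1"
  shows "RL 2 (\<lambda>s. indicator {0<..<1} s * k s) t = integral {0..t} (\<lambda>s. (t - s) * k s)"
proof -
  have "continuous_on {0..t} (\<lambda>s. (t - s) * k s)"
    using assms by (intro continuous_intros) (auto elim: continuous_on_subset)
  then have i: "set_integrable lborel {0..t} (\<lambda>s. (t - s) * k s)"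
    by (intro borel_integrable_compact[unfolded set_integrable_def[symmetric]] compact_Icc)
  have "RL 2 (\<lambda>s. indicator {0<..<1} s * k s) t = (LINT s:{0..t}|lborel. (t - s) * k s)"
    unfolding RL_def set_lebesgue_integral_def
  proof (rule integral_cong_AE)
    have "k \<in> borel_measurable (restrict_space borel {0<..<1})"
      by (rule borel_measurable_continuous_on_restrict, rule continuous_on_subset[OF assms(1)]) auto
    then have [measurable]: "(\<lambda>s. indicator {0<..<1} s * k s) \<in> borel_measurable borel"
      by (subst (asm) borel_measurable_restrict_space_iff) auto
    show "(\<lambda>s. RL_ker 2 (t - s) * (indicator {0<..<1} s * k s)) \<in> borel_measurable lborel" by measurable
    show "(\<lambda>s. indicator {0..t} s *\<^sub>R ((t - s) * k s)) \<in> borel_measurable lborel"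
      using i unfolding set_integrable_def by (rule borel_measurable_integrable)
    have "Gamma 2 = (1::real)" using Gamma_fact[of 1, where 'a = real] by simp
    then have eq: "RL_ker 2 (t - s) * (indicator {0<..<1} s * k s) = indicator {0..t} s *\<^sub>R ((t - s) * k s)"
      if "s \<noteq> 0 \<and> s \<noteq> t" for s
      using assms(2,3) that by (auto simp: RL_ker_def split: split_indicator)
    have "AE s in lborel. s \<noteq> 0 \<and> s \<noteq> t" by (simp add: AE_conj_iff AE_lborel_singleton)
    then show "AE s in lborel. RL_ker 2 (t - s) * (indicator {0<..<1} s * k s) =
            indicator {0..t} s *\<^sub>R ((t - s) * k s)"
      by (rule eventually_mono) (rule eq)
  qed
  also have "\<dots> = integral {0..t} (\<lambda>s. (t - s) * k s)"
    using i by (rule set_borel_integral_eq_integral)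
  finally show ?thesis .
qed

text \<open>The integral is \<open>t \<integral>\<^sub>0\<^sup>t k - \<integral>\<^sub>0\<^sup>t s k(s) ds\<close>; its derivative is the primitive of \<open>k\<close>, and a second
  differentiation gives \<open>k\<close>.\<close>

lemma second_primitive_zero:
  fixes k :: "real \<Rightarrow> real"
  assumes k: "continuous_on {0..1} k" and z: "\<And>t. 0 < t \<Longrightarrow> t < 1 \<Longrightarrow> integral {0..t} (\<lambda>s. (t - s) * k s) = 0"
    and t: "t \<in> {0..1}"
  shows "k t = 0"
proof -
  define K where "K t = integral {0..t} k" for t
  have zero_deriv: "d = 0" if "(f has_real_derivative d) (at t within {0..1})" "0 < t" "t < 1"
    "\<And>x. 0 < x \<Longrightarrow> x < 1 \<Longrightarrow> f x = 0" for f d t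
  proof -
    have "(f has_real_derivative d) (at t)"
      using that(1-3) at_within_interior[of t "{0..1}"] by auto
    moreover have "((\<lambda>x. 0) has_real_derivative 0) (at t)" by simp
    then have "(f has_real_derivative 0) (at t)"
      by (rule DERIV_cong_ev[THEN iffD1, rotated 3])
        (use that in \<open>auto intro: eventually_mono[OF eventually_nhds_in_open[of "{0<..<1}"]]\<close>)
    ultimately show ?thesis by (rule DERIV_unique)
  qed
  have K0: "K t = 0" if t: "0 < t" "t < 1" for t
  proof -
    have "((\<lambda>t. t * integral {0..t} k - integral {0..t} (\<lambda>s. s * k s)) has_real_derivative
        (1 * integral {0..t} k + k t * t) - t * k t) (at t within {0..1})"
      using t k by (intro DERIV_diff DERIV_mult DERIV_ident integral_has_real_derivative continuous_intros) auto
    then have "1 * integral {0..t} k + k t * t - t * k t = 0"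
    proof (rule zero_deriv)
      fix x :: real assume x: "0 < x" "x < 1"
      have "continuous_on {0..x} k" using k x by (auto intro: continuous_on_subset)
      then have "(\<lambda>s. x * k s) integrable_on {0..x}" "(\<lambda>s. s * k s) integrable_on {0..x}"
        by (auto intro!: integrable_continuous_interval continuous_intros)
      then have "integral {0..x} (\<lambda>s. (x - s) * k s) = x * integral {0..x} k - integral {0..x} (\<lambda>s. s * k s)"
        by (simp add: left_diff_distrib integral_diff)
      then show "x * integral {0..x} k - integral {0..x} (\<lambda>s. s * k s) = 0"
        using z[OF x] by simp
    qed (use t in auto)
    then show ?thesis by (simp add: K_def mult.commute)
  qed
  have k0: "k t = 0" if t: "t \<in> {0<..<1}" for t
    by (rule zero_deriv[of K]) (use K0 t integral_has_real_derivative[OF k, of t] in \<open>auto simp: K_def[abs_def]\<close>)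
  have "closure {0<..<1} = {0..(1::real)}" by simp
  then show "k t = 0"
    using continuous_constant_on_closure[of "{0<..<1}" k 0 t] k k0 t by auto
qed

text \<open>Inversion of Abel's equation \<open>I\<^sup>1\<^sup>-\<^sup>\<alpha> V = I\<^sup>1 f\<close>.  The equation is assumed after one more
  integration, the form in which a weak formulation tested with \<open>(T - t)\<^sub>+\<close> provides it.  It reads
  \<open>I\<^sup>2\<^sup>-\<^sup>\<alpha> V = I\<^sup>2 f\<close>, and \<open>I\<^sup>\<alpha>\<close> turns it into \<open>I\<^sup>2 V = I\<^sup>2 I\<^sup>\<alpha> f\<close>, which can be
  differentiated twice.\<close>

lemma fractional_inversion:
  fixes V f :: "real \<Rightarrow> real"
  assumes \<alpha>: "0 < \<alpha>" "\<alpha> < 1"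
    and f: "integrable lborel f" and f0: "\<And>s. s \<le> 0 \<Longrightarrow> f s = 0"
    and V: "continuous_on {0..1} V" and R: "continuous_on {0..1} (RL \<alpha> f)"
    and eq: "\<And>t. 0 < t \<Longrightarrow> t < 1 \<Longrightarrow>
       RL 2 f t = RL 1 (RL (1 - \<alpha>) (\<lambda>s. indicator {0<..<1} s * V s)) t"
    and t: "t \<in> {0..1}"
  shows "V t = RL \<alpha> f t"
proof -
  define V0 where "V0 s = indicator {0<..<1} s * V s" for s
  define h where "h s = indicator {0<..<1} s * RL \<alpha> f s" for s
  have int: "integrable lborel (\<lambda>s. indicator {0<..<1} s * k s)"
    if "continuous_on {0..1} k" for k :: "real \<Rightarrow> real"
  proof -
    have "set_integrable lborel {0..1} k"
      using that by (intro borel_integrable_compact[unfolded set_integrable_def[symmetric]] compact_Icc)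
    then have "set_integrable lborel {0<..<1} k" by (rule set_integrable_subset) auto
    then show ?thesis by (simp add: set_integrable_def)
  qed
  have V0: "integrable lborel V0" "\<And>s. s \<le> 0 \<Longrightarrow> V0 s = 0" using int[OF V] by (auto simp: V0_def[abs_def])
  have RL2: "RL 2 f s = RL (2 - \<alpha>) V0 s" if "s < 1" for s
  proof (cases "s \<le> 0")
    case True
    then show ?thesis using f0 V0(2) RL_nonpos by metis
  next
    case False
    then show ?thesis
      using eq[of s] that RL_semigroup[of 1 "1 - \<alpha>" V0 s] V0 \<alpha> by (simp add: V0_def[abs_def])
  qed
  have "RL 2 V0 t = RL 2 h t" if t: "0 < t" "t < 1" for t
  proof -
    have "RL 2 V0 t = RL \<alpha> (RL (2 - \<alpha>) V0) t"
      using RL_semigroup[of \<alpha> "2 - \<alpha>" V0 t] V0 \<alpha> by simp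
    also have "\<dots> = RL \<alpha> (RL 2 f) t" by (rule RL_cong) (use RL2 t in auto)
    also have "\<dots> = RL (\<alpha> + 2) f t" using f f0 \<alpha> by (intro RL_semigroup) auto
    also have "\<dots> = RL 2 (RL \<alpha> f) t" using f f0 \<alpha> by (subst RL_semigroup) (auto simp: add.commute)
    also have "\<dots> = RL 2 h t"
    proof (rule RL_cong)
      fix s assume "s < t"
      then show "RL \<alpha> f s = h s"
        using RL_nonpos[of f s \<alpha>] f0 t by (cases "s \<le> 0") (auto simp: h_def)
    qed
    finally show ?thesis .
  qed
  then have "integral {0..t} (\<lambda>s. (t - s) * (V s - RL \<alpha> f s)) = 0" if t: "0 < t" "t < 1" for t
  proof -
    have c: "continuous_on {0..t} (\<lambda>s. (t - s) * V s)" "continuous_on {0..t} (\<lambda>s. (t - s) * RL \<alpha> f s)"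
      using V R t by (auto intro!: continuous_intros intro: continuous_on_subset)
    have "integral {0..t} (\<lambda>s. (t - s) * V s) = integral {0..t} (\<lambda>s. (t - s) * RL \<alpha> f s)"
      using RL2_eq_integral[OF V t] RL2_eq_integral[OF R t] \<open>\<And>t. 0 < t \<Longrightarrow> t < 1 \<Longrightarrow> RL 2 V0 t = RL 2 h t\<close>[OF t]
      by (simp add: V0_def[abs_def] h_def[abs_def])
    then show ?thesis
      using c by (simp add: right_diff_distrib integral_diff integrable_continuous_interval)
  qed
  then have "V t - RL \<alpha> f t = 0"
    by (rule second_primitive_zero[rotated]) (use V R t in \<open>auto intro: continuous_intros\<close>)
  then show ?thesis by simp
qed

text \<open>Superadditivity of \<open>x \<mapsto> x\<^sup>q\<close> on the nonnegative half-line.\<close>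

lemma powr_diff_le:
  fixes a b q :: real
  assumes "0 \<le> b" "b \<le> a" "1 \<le> q"
  shows "(a - b) powr q \<le> a powr q - b powr q"
proof (cases "b = a \<or> b = 0")
  case False
  then have ab: "0 < b" "b < a" using assms by auto
  have p: "x powr q = x * x powr (q - 1)" if "x > 0" for x
    using powr_add[of x 1 "q - 1"] that by simp
  have "(a - b) powr q + b powr q = (a - b) * (a - b) powr (q - 1) + b * b powr (q - 1)"
    using ab by (simp add: p)
  also have "\<dots> \<le> (a - b) * a powr (q - 1) + b * a powr (q - 1)"
    using ab assms by (intro add_mono mult_left_mono powr_mono2) auto
  also have "\<dots> = a powr q" using ab by (simp add: p flip: distrib_right)
  finally show ?thesis by simp
qed (use assms in auto)

lemma has_bochner_integral_powr_reflected:
  assumes \<gamma>: "\<gamma> > -1" and uv: "u \<le> v" "v \<le> (t::real)"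
  shows "has_bochner_integral lborel (\<lambda>r. indicator {u..v} r * (t - r) powr \<gamma>)
     (((t - u) powr (\<gamma> + 1) - (t - v) powr (\<gamma> + 1)) / (\<gamma> + 1))"
proof -
  have "((\<lambda>r. (t - r) powr \<gamma>) has_integral
      (- ((t - v) powr (\<gamma> + 1) / (\<gamma> + 1)) - - ((t - u) powr (\<gamma> + 1) / (\<gamma> + 1)))) {u..v}"
  proof (rule fundamental_theorem_of_calculus_interior[OF uv(1)])
    show "continuous_on {u..v} (\<lambda>r. - ((t - r) powr (\<gamma> + 1) / (\<gamma> + 1)))"
      using \<gamma> uv by (intro continuous_intros continuous_on_powr') auto
    fix r assume "r \<in> {u<..<v}"
    then have r: "t - r > 0" using uv by auto
    have "((\<lambda>r. (t - r) powr (\<gamma> + 1)) has_real_derivative (\<gamma> + 1) * (t - r) powr (\<gamma> + 1 - 1) * (-1)) (at r)"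
      by (rule DERIV_chain2[of "\<lambda>z. z powr (\<gamma> + 1)" _ "\<lambda>r. t - r"])
        (use r in \<open>auto intro!: derivative_eq_intros has_real_derivative_powr\<close>)
    from DERIV_minus[OF DERIV_cdivide[OF this, of "\<gamma> + 1"]]
    have "((\<lambda>r. - ((t - r) powr (\<gamma> + 1) / (\<gamma> + 1))) has_real_derivative (t - r) powr \<gamma>) (at r)"
      using \<gamma> by simp
    then show "((\<lambda>r. - ((t - r) powr (\<gamma> + 1) / (\<gamma> + 1))) has_vector_derivative (t - r) powr \<gamma>) (at r)"
      by (simp add: has_real_derivative_iff_has_vector_derivative)
  qed
  then have I: "((\<lambda>r. (t - r) powr \<gamma>) has_integral
      ((t - u) powr (\<gamma> + 1) - (t - v) powr (\<gamma> + 1)) / (\<gamma> + 1)) {u..v}"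
    by (simp add: diff_divide_distrib)
  show ?thesis
  proof (rule has_bochner_integral_nn_integral)
    show "0 \<le> ((t - u) powr (\<gamma> + 1) - (t - v) powr (\<gamma> + 1)) / (\<gamma> + 1)"
      using \<gamma> uv by (auto intro!: divide_nonneg_pos powr_mono2)
    show "(\<integral>\<^sup>+r. ennreal (indicator {u..v} r * (t - r) powr \<gamma>) \<partial>lborel)
      = ennreal (((t - u) powr (\<gamma> + 1) - (t - v) powr (\<gamma> + 1)) / (\<gamma> + 1))"
      by (rule nn_integral_has_integral_lebesgue[OF _ I]) auto
  qed auto
qed

text \<open>With \<open>\<gamma> = (\<alpha> - 1) q\<close>, superadditivity bounds the integrand for \<open>r < s\<close> by
  \<open>(s - r)\<^sup>\<gamma> - (t - r)\<^sup>\<gamma>\<close>, up to the factor \<open>\<Gamma>(\<alpha>)\<^sup>-\<^sup>q\<close>.  This has an explicit primitive, and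
  the terms \<open>s\<^sup>\<beta> - t\<^sup>\<beta> \<le> 0\<close> that do not depend on \<open>t - s\<close> can be dropped.\<close>

lemma RL_ker_difference_bound:
  assumes \<alpha>: "0 < \<alpha>" "\<alpha> < 1" and q: "1 < q" and \<beta>: "\<beta> = (\<alpha> - 1) * q + 1" "\<beta> > 0"
    and st: "0 \<le> s" "s \<le> t"
  defines "D \<equiv> (\<lambda>r. indicator {0<..} r * \<bar>RL_ker \<alpha> (t - r) - RL_ker \<alpha> (s - r)\<bar> powr q)"
  shows "integrable lborel D" and "(\<integral>r. D r \<partial>lborel) \<le> 2 * (t - s) powr \<beta> / (\<beta> * Gamma \<alpha> powr q)"
proof -
  define \<gamma> where "\<gamma> = (\<alpha> - 1) * q"
  have \<gamma>: "\<gamma> > -1" "\<gamma> + 1 = \<beta>" using \<beta> by (auto simp: \<gamma>_def)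
  define G where "G = Gamma \<alpha> powr q"
  have Gp: "Gamma \<alpha> > 0" using \<alpha> by (intro Gamma_real_pos)
  then have G: "G > 0" by (simp add: G_def)
  define E where "E r = indicator {s..t} r * (t - r) powr \<gamma> +
      (indicator {0..s} r * (s - r) powr \<gamma> - indicator {0..s} r * (t - r) powr \<gamma>)" for r
  have hE: "has_bochner_integral lborel E (((t - s) powr \<beta> - (t - t) powr \<beta>) / \<beta> +
      (((s - 0) powr \<beta> - (s - s) powr \<beta>) / \<beta> - ((t - 0) powr \<beta> - (t - s) powr \<beta>) / \<beta>))"
    unfolding E_def \<gamma>(2)[symmetric]
    by (intro has_bochner_integral_add has_bochner_integral_diff has_bochner_integral_powr_reflected)
      (use st \<gamma> in auto)
  have pw: "(x powr (\<alpha> - 1)) powr q = x powr \<gamma>" for x by (simp add: powr_powr \<gamma>_def)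
  have le: "D r \<le> E r / G" if r: "r \<noteq> s" "r \<noteq> t" "r \<noteq> 0" for r
  proof -
    consider "r < 0" | "r > t" | "s < r" "r < t" "r > 0" | "0 < r" "r < s" using r st by linarith
    then show ?thesis
    proof cases
      case 1
      then show ?thesis using st by (simp add: D_def E_def)
    next
      case 2 then show ?thesis using st G by (auto simp: D_def E_def RL_ker_def)
    next
      case 3
      then have "D r = (t - r) powr \<gamma> / G"
        using Gp by (simp add: D_def RL_ker_def powr_divide pw G_def)
      then show ?thesis using 3 st by (simp add: E_def)
    next
      case 4
      have m: "(t - r) powr (\<alpha> - 1) \<le> (s - r) powr (\<alpha> - 1)"
        using 4 st \<alpha> by (intro powr_mono2') auto
      have "RL_ker \<alpha> (t - r) - RL_ker \<alpha> (s - r) = - (((s - r) powr (\<alpha> - 1) - (t - r) powr (\<alpha> - 1)) / Gamma \<alpha>)"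
        using 4 st by (simp add: RL_ker_def diff_divide_distrib)
      then have "D r = ((s - r) powr (\<alpha> - 1) - (t - r) powr (\<alpha> - 1)) powr q / G"
        using 4 m Gp by (simp add: D_def powr_divide G_def)
      also have "\<dots> \<le> ((s - r) powr \<gamma> - (t - r) powr \<gamma>) / G"
        using powr_diff_le[OF _ m, of q] q G by (intro divide_right_mono) (auto simp: pw)
      also have "\<dots> = E r / G" using 4 st by (simp add: E_def)
      finally show ?thesis .
    qed
  qed
  have D0: "D r \<ge> 0" for r by (simp add: D_def)
  have AE: "AE r in lborel. D r \<le> E r / G"
  proof (rule eventually_mono)
    show "AE r in lborel. r \<noteq> s \<and> r \<noteq> t \<and> r \<noteq> 0" by (simp add: AE_conj_iff AE_lborel_singleton)
  qed (use le in auto)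
  have EG: "integrable lborel (\<lambda>r. E r / G)" using hE by (auto simp: has_bochner_integral_iff)
  show int: "integrable lborel D"
  proof (rule Bochner_Integration.integrable_bound[OF EG])
    show "D \<in> borel_measurable lborel" unfolding D_def by measurable
    show "AE r in lborel. norm (D r) \<le> norm (E r / G)" using AE
    proof (rule eventually_mono)
      fix r assume "D r \<le> E r / G"
      then show "norm (D r) \<le> norm (E r / G)" using D0[of r] abs_ge_self[of "E r / G"] by simp
    qed
  qed
  have "(\<integral>r. D r \<partial>lborel) \<le> (\<integral>r. E r / G \<partial>lborel)"
    by (rule integral_mono_AE[OF int EG AE])
  also have "\<dots> = (2 * (t - s) powr \<beta> + (s powr \<beta> - t powr \<beta>)) / \<beta> / G"
    using hE by (auto simp: has_bochner_integral_iff add_divide_distrib diff_divide_distrib)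
  also have "\<dots> \<le> 2 * (t - s) powr \<beta> / \<beta> / G"
    using G \<beta> st by (intro divide_right_mono) (auto intro!: powr_mono2)
  finally show "(\<integral>r. D r \<partial>lborel) \<le> 2 * (t - s) powr \<beta> / (\<beta> * Gamma \<alpha> powr q)"
    by (simp add: G_def)
qed

section \<open>The weak gradient and translations of boxes\<close>

lemma box_Pair_eq: "box (a, c) (b, d) = box a b \<times> box c d"
  by (force simp: box_def Basis_prod_def)

text \<open>Hoelder's inequality against a function that is dominated by the indicator of a set; the constant
  depends only on the measure of that set.\<close>

lemma Lp_pairing:
  fixes f \<phi> :: "'a::euclidean_space \<Rightarrow> real"
  assumes p: "1 < p" and f: "f \<in> Lp p D" and \<phi>m [measurable]: "\<phi> \<in> borel_measurable (lebesgue_on D)"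
    and D: "D \<in> sets lebesgue" and S: "S \<in> lmeasurable"
    and le: "\<And>z. z \<in> D \<Longrightarrow> \<bar>\<phi> z\<bar> \<le> indicator S z"
  shows "integrable (lebesgue_on D) (\<lambda>z. f z * \<phi> z)"
    and "\<bar>\<integral>z. f z * \<phi> z \<partial>lebesgue_on D\<bar> \<le> Lp_norm p D f * measure lebesgue S powr (1 - 1 / p)"
proof -
  define q where "q = p / (p - 1)"
  have q: "1 < q" "1 / p + 1 / q = 1" "1 / q = 1 - 1 / p" using p by (auto simp: q_def field_simps)
  have fm [measurable]: "f \<in> borel_measurable (lebesgue_on D)"
    and fi: "integrable (lebesgue_on D) (\<lambda>z. \<bar>f z\<bar> powr p)"
    using f by (auto simp: Lp_def)
  have "integrable lebesgue (indicator S :: _ \<Rightarrow> real)"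
    using S by (intro integrable_real_indicator) (auto simp: fmeasurable_def)
  then have iS: "integrable lebesgue (\<lambda>z. indicator D z *\<^sub>R indicator S z :: real)"
    using D by (intro integrable_mult_indicator)
  then have iS': "integrable (lebesgue_on D) (indicator S :: _ \<Rightarrow> real)"
    using D by (subst integrable_restrict_space) auto
  have le': "\<bar>\<phi> z\<bar> powr q \<le> indicator S z" if "z \<in> D" for z
  proof -
    have "\<bar>\<phi> z\<bar> powr q \<le> indicator S z powr q" using le[OF that] q by (intro powr_mono2) auto
    then show ?thesis by (auto simp: indicator_def split: if_splits)
  qed
  have i\<phi>: "integrable (lebesgue_on D) (\<lambda>z. \<bar>\<phi> z\<bar> powr q)"
    by (rule Bochner_Integration.integrable_bound[OF iS'])
      (use le' in \<open>auto intro!: AE_I2 simp: space_restrict_space\<close>)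
  show "integrable (lebesgue_on D) (\<lambda>z. f z * \<phi> z)"
    using Hoelder_integrable[OF p q(1,2) _ _ fi i\<phi>] by simp
  have "(\<integral>z. \<bar>\<phi> z\<bar> powr q \<partial>lebesgue_on D) \<le> (\<integral>z. indicator S z \<partial>lebesgue_on D)"
    using i\<phi> iS' le' by (intro integral_mono) (auto simp: space_restrict_space)
  also have "\<dots> = (\<integral>z. indicator D z *\<^sub>R indicator S z \<partial>lebesgue)"
    using D by (subst integral_restrict_space) auto
  also have "\<dots> \<le> (\<integral>z. indicator S z \<partial>lebesgue)"
    using \<open>integrable lebesgue (indicator S :: _ \<Rightarrow> real)\<close> iS by (intro integral_mono) (auto split: split_indicator)
  also have "\<dots> = measure lebesgue S" using S by simp
  finally have "(\<integral>z. \<bar>\<phi> z\<bar> powr q \<partial>lebesgue_on D) powr (1 / q) \<le> measure lebesgue S powr (1 / q)"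
    using q(1) by (intro powr_mono2) auto
  then have "Lp_norm p D f * (\<integral>z. \<bar>\<phi> z\<bar> powr q \<partial>lebesgue_on D) powr (1 / q)
      \<le> Lp_norm p D f * measure lebesgue S powr (1 / q)"
    by (intro mult_left_mono Lp_norm_nonneg)
  moreover have "\<bar>\<integral>z. f z * \<phi> z \<partial>lebesgue_on D\<bar> \<le> (\<integral>z. \<bar>f z * \<phi> z\<bar> \<partial>lebesgue_on D)"
    using integral_norm_bound[of "lebesgue_on D" "\<lambda>z. f z * \<phi> z"] by simp
  ultimately show "\<bar>\<integral>z. f z * \<phi> z \<partial>lebesgue_on D\<bar> \<le> Lp_norm p D f * measure lebesgue S powr (1 - 1 / p)"
    using Hoelder_inequality[OF p q(1,2) fm \<phi>m fi i\<phi>] unfolding Lp_norm_def q(3) real_norm_def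
    by linarith
qed

lemma Lp_inner:
  fixes G :: "'a::euclidean_space \<Rightarrow> 'b::euclidean_space"
  assumes p: "1 < p" and G: "G \<in> Lp p D"
  shows "(\<lambda>z. h \<bullet> G z) \<in> Lp p D" and "Lp_norm p D (\<lambda>z. h \<bullet> G z) \<le> norm h * Lp_norm p D G"
proof -
  have [measurable]: "G \<in> borel_measurable (lebesgue_on D)"
    and i: "integrable (lebesgue_on D) (\<lambda>z. norm (G z) powr p)"
    using G by (auto simp: Lp_def)
  have le: "\<bar>h \<bullet> G z\<bar> powr p \<le> norm h powr p * norm (G z) powr p" for z
  proof -
    have "\<bar>h \<bullet> G z\<bar> powr p \<le> (norm h * norm (G z)) powr p"
      using p Cauchy_Schwarz_ineq2 by (intro powr_mono2) auto
    then show ?thesis by (simp add: powr_mult)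
  qed
  have i2: "integrable (lebesgue_on D) (\<lambda>z. \<bar>h \<bullet> G z\<bar> powr p)"
    by (rule Bochner_Integration.integrable_bound[of _ "\<lambda>z. norm h powr p * norm (G z) powr p"])
      (use le i in auto)
  then show "(\<lambda>z. h \<bullet> G z) \<in> Lp p D" by (simp add: Lp_def)
  have "(\<integral>z. \<bar>h \<bullet> G z\<bar> powr p \<partial>lebesgue_on D) \<le> (\<integral>z. norm h powr p * norm (G z) powr p \<partial>lebesgue_on D)"
    using i i2 le by (intro integral_mono) auto
  then have "Lp_norm p D (\<lambda>z. h \<bullet> G z) \<le> (norm h powr p * (\<integral>z. norm (G z) powr p \<partial>lebesgue_on D)) powr (1 / p)"
    unfolding Lp_norm_def using p by (intro powr_mono2) auto
  also have "\<dots> = norm h * Lp_norm p D G"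
    using p by (simp add: powr_mult powr_powr Lp_norm_def)
  finally show "Lp_norm p D (\<lambda>z. h \<bullet> G z) \<le> norm h * Lp_norm p D G" .
qed

lemma lebesgue_on_eq_integral_cbox:
  fixes f :: "'a::euclidean_space \<Rightarrow> real"
  assumes f: "continuous_on (cbox a b) f" and D: "D \<in> sets lebesgue"
    and z: "\<And>z. z \<in> D - cbox a b \<Longrightarrow> f z = 0" "\<And>z. z \<in> cbox a b - D \<Longrightarrow> f z = 0"
  shows "integrable (lebesgue_on D) f" and "(\<integral>z. f z \<partial>lebesgue_on D) = integral (cbox a b) f"
proof -
  have eq: "(\<lambda>z. indicator D z *\<^sub>R f z) = (\<lambda>z. indicator (cbox a b) z *\<^sub>R f z)"
    using z by (auto split: split_indicator)
  have i: "set_integrable lebesgue (cbox a b) f"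
    using f by (rule absolutely_integrable_continuous)
  then show "integrable (lebesgue_on D) f"
    using D by (subst integrable_restrict_space) (simp, unfold eq, simp add: set_integrable_def)
  have "(\<integral>z. f z \<partial>lebesgue_on D) = (\<integral>z. indicator D z *\<^sub>R f z \<partial>lebesgue)"
    using D by (subst integral_restrict_space) auto
  also have "\<dots> = integral (cbox a b) f"
    using set_lebesgue_integral_eq_integral(2)[OF i] unfolding eq set_lebesgue_integral_def .
  finally show "(\<integral>z. f z \<partial>lebesgue_on D) = integral (cbox a b) f" .
qed

lemma partial_x_eq:
  assumes "(f has_derivative f') (at z)"
  shows "partial_x i f z = f' (0, axis i 1)"
proof -
  obtain t x where z: "z = (t, x)" by (cases z)
  interpret f': bounded_linear f' using assms by (rule has_derivative_bounded_linear)
  have "((\<lambda>h. (t, x + h *\<^sub>R axis i 1)) has_derivative (\<lambda>h. (0, h *\<^sub>R axis i 1))) (at 0)"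
    by (auto intro!: derivative_eq_intros)
  then have "((\<lambda>h. f (t, x + h *\<^sub>R axis i 1)) has_derivative (\<lambda>h. f' (0, h *\<^sub>R axis i 1))) (at 0)"
    by (rule has_derivative_compose) (use assms in \<open>simp add: z\<close>)
  moreover have "f' (0, h *\<^sub>R axis i 1) = f' (0, axis i 1) * h" for h
    using f'.scaleR[of h "(0, axis i 1)"] by simp
  ultimately have "((\<lambda>h. f (t, x + h *\<^sub>R axis i 1)) has_real_derivative f' (0, axis i 1)) (at 0)"
    by (simp add: has_field_derivative_def)
  then show ?thesis by (simp add: partial_x_def z DERIV_imp_deriv)
qed

lemma integral_indicator_box:
  fixes f :: "'a::euclidean_space \<Rightarrow> real"
  assumes "cbox a b \<subseteq> cbox c d"
  shows "integral (cbox c d) (\<lambda>z. f z * indicator (box a b) z) = integral (cbox a b) f"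
proof -
  have "integral (cbox c d) (\<lambda>z. f z * indicator (box a b) z)
      = integral (cbox c d) (\<lambda>z. if z \<in> box a b then f z else 0)"
    by (intro arg_cong[of _ _ "integral _"]) (auto simp: indicator_def)
  also have "\<dots> = integral (box a b) f"
  proof -
    have "box a b \<inter> cbox c d = box a b" using assms box_subset_cbox[of a b] by auto
    then show ?thesis by (simp only: Henstock_Kurzweil_Integration.integral_restrict_Int)
  qed
  also have "\<dots> = integral (cbox a b) f" by (rule integral_open_interval)
  finally show ?thesis .
qed

text \<open>Let \<open>F(l) = \<integral> v(z) q(z - l (0, h)) dz\<close>.  The derivative of \<open>F\<close> falls on the test function,
  so it equals \<open>\<integral> (h \<bullet> G)(z) q(z - l (0, h)) dz\<close> by the definition of the weak gradient, and
  Hoelder's inequality bounds it uniformly in \<open>l\<close>.  The mean value theorem concludes.\<close>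

lemma translation_estimate_test:
  fixes v :: "real \<times> (real ^ 'n) \<Rightarrow> real" and q :: "real \<times> (real ^ 'n) \<Rightarrow> real"
  assumes p: "1 < p" and v: "continuous_on ({0..1} \<times> UNIV) v"
    and G: "G \<in> Lp p ({0<..<1} \<times> UNIV)" and weak: "is_weak_Dx ({0<..<1} \<times> UNIV) v G"
    and s: "0 \<le> s" and t: "t \<le> 1"
    and q: "\<And>k. Ck_on k UNIV q" "\<And>z. 0 \<le> q z" "\<And>z. q z \<le> 1"
    and K: "compact K" "K \<subseteq> box (s, a) (t, b)" "\<And>z. z \<notin> K \<Longrightarrow> q z = 0"
    and big: "\<And>x l. x \<in> cbox a b \<Longrightarrow> 0 \<le> l \<Longrightarrow> l \<le> 1 \<Longrightarrow> x + l *\<^sub>R h \<in> cbox a' b'"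
  shows "\<bar>integral (cbox (s, a') (t, b')) (\<lambda>z. v z * q (z - (0, h)))
      - integral (cbox (s, a') (t, b')) (\<lambda>z. v z * q z)\<bar>
      \<le> norm h * Lp_norm p ({0<..<1} \<times> UNIV) G * measure lebesgue (cbox (s, a) (t, b)) powr (1 - 1 / p)"
proof -
  define D :: "(real \<times> (real ^ 'n)) set" where "D = {0<..<1} \<times> UNIV"
  define H :: "real \<times> (real ^ 'n)" where "H = (0, h)"
  define CB where "CB = cbox (s, a') (t, b')"
  have "open D" unfolding D_def by (auto intro!: open_Times)
  then have D: "open D" "D \<in> sets lebesgue" by (simp_all add: borel_open sets_completionI_sets)
  have CB: "CB \<subseteq> {0..1} \<times> UNIV" using s t by (auto simp: CB_def cbox_Pair_eq)
  have vCB: "continuous_on CB v" by (rule continuous_on_subset[OF v CB])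
  from q(1)[of 1] obtain q' where q': "\<And>z. (q has_derivative q' z) (at z)"
    "\<And>v. continuous_on UNIV (\<lambda>z. q' z v)" by auto
  have lin: "bounded_linear (q' z)" for z using q'(1) by (rule has_derivative_bounded_linear)
  have q'0: "q' z = (\<lambda>_. 0)" if "z \<notin> K" for z
  proof -
    have "open (- K)" using K by (simp add: open_Compl compact_imp_closed)
    have "((\<lambda>_. 0) has_derivative (\<lambda>_. 0)) (at z)" by simp
    then have "(q has_derivative (\<lambda>_. 0)) (at z)"
      by (rule has_derivative_transform_within_open[OF _ \<open>open (- K)\<close>]) (use that K in auto)
    then show ?thesis using q'(1) by (rule has_derivative_unique[rotated])
  qed
  have KCB: "z \<in> CB \<inter> D" if "z - l *\<^sub>R H \<in> K" "0 \<le> l" "l \<le> 1" for z l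
  proof -
    obtain \<tau> x where z: "z = (\<tau>, x)" by (cases z)
    have "(\<tau>, x - l *\<^sub>R h) \<in> box (s, a) (t, b)" using that K z by (auto simp: H_def)
    then have "s < \<tau>" "\<tau> < t" "x - l *\<^sub>R h \<in> cbox a b"
      using box_subset_cbox[of a b] by (auto simp: box_Pair_eq)
    then show ?thesis using big[of "x - l *\<^sub>R h" l] that s t by (auto simp: CB_def D_def z)
  qed
  have cq: "continuous_on UNIV (\<lambda>z. q (z - l *\<^sub>R H))" for l
    by (rule continuous_on_compose2[of UNIV q]) (use q(1)[of 0] in \<open>auto intro!: continuous_intros\<close>)
  define F where "F l = integral CB (\<lambda>z. v z * q (z - l *\<^sub>R H))" for l
  define F' where "F' l = integral CB (\<lambda>z. v z * - q' (z - l *\<^sub>R H) H)" for l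
  have F: "(F has_real_derivative F' l) (at l)" for l
    unfolding F_def[abs_def] F'_def CB_def
  proof (rule leibniz_rule_field_derivative[where U = UNIV, simplified])
    fix l z
    have "((\<lambda>l. z - l *\<^sub>R H) has_derivative (\<lambda>x. - x *\<^sub>R H)) (at l)"
      by (auto intro!: derivative_eq_intros)
    then have d: "((\<lambda>l. q (z - l *\<^sub>R H)) has_derivative (\<lambda>x. q' (z - l *\<^sub>R H) (- x *\<^sub>R H))) (at l)"
      by (rule has_derivative_compose) (rule q'(1))
    have eq: "q' (z - l *\<^sub>R H) (- x *\<^sub>R H) = - q' (z - l *\<^sub>R H) H * x" for x
      using linear_scale[OF bounded_linear.linear[OF lin], of _ "- x" H] by simp
    have "((\<lambda>l. q (z - l *\<^sub>R H)) has_real_derivative - q' (z - l *\<^sub>R H) H) (at l)"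
      by (rule has_derivative_imp_has_field_derivative[OF d]) (unfold eq, simp)
    then show "((\<lambda>l. v z * q (z - l *\<^sub>R H)) has_real_derivative v z * - q' (z - l *\<^sub>R H) H) (at l)"
      by (rule DERIV_cmult)
  next
    fix l show "(\<lambda>z. v z * q (z - l *\<^sub>R H)) integrable_on cbox (s, a') (t, b')"
      using vCB continuous_on_subset[OF cq subset_UNIV]
      by (intro integrable_continuous continuous_on_mult) (auto simp: CB_def)
  next
    have "continuous_on (UNIV \<times> CB) (\<lambda>x. v (snd x))"
      by (rule continuous_on_compose2[OF vCB]) (auto intro!: continuous_intros)
    moreover have "continuous_on (UNIV \<times> CB) (\<lambda>x. q' (snd x - fst x *\<^sub>R H) H)"
      by (rule continuous_on_compose2[OF q'(2)]) (auto intro!: continuous_intros)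
    ultimately show "continuous_on (UNIV \<times> cbox (s, a') (t, b')) (\<lambda>(l, z). v z * - q' (z - l *\<^sub>R H) H)"
      unfolding split_def CB_def by (intro continuous_intros)
  qed
  have bound: "\<bar>F' l\<bar> \<le> norm h * Lp_norm p D G * measure lebesgue (cbox (s, a) (t, b)) powr (1 - 1 / p)"
    if l: "0 \<le> l" "l \<le> 1" for l
  proof -
    define \<phi> where "\<phi> z = q (z - l *\<^sub>R H)" for z
    have d\<phi>: "(\<phi> has_derivative q' (z - l *\<^sub>R H)) (at z)" for z
    proof -
      have "((\<lambda>z. z - l *\<^sub>R H) has_derivative (\<lambda>v. v)) (at z)" by (auto intro!: derivative_eq_intros)
      then show ?thesis unfolding \<phi>_def[abs_def] by (rule has_derivative_compose) (rule q'(1))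
    qed
    have "Ck_on k D \<phi>" for k
      using Ck_on_affine_compose[OF bounded_linear_ident q(1), of k "- l *\<^sub>R H"]
      by (auto simp: \<phi>_def[abs_def] intro: Ck_on_subset)
    moreover have "compact ((\<lambda>z. l *\<^sub>R H + z) ` K)" using K(1) by (rule compact_translation)
    moreover have "(\<lambda>z. l *\<^sub>R H + z) ` K \<subseteq> D"
    proof (rule image_subsetI)
      fix z assume "z \<in> K"
      then show "l *\<^sub>R H + z \<in> D" using KCB[of "l *\<^sub>R H + z" l] l by simp
    qed
    moreover have "\<phi> z = 0" if "z \<notin> (\<lambda>z. l *\<^sub>R H + z) ` K" for z
      unfolding \<phi>_def using that by (intro K(3)) (auto simp: image_iff algebra_simps)
    ultimately have "\<phi> \<in> C0_infty D" unfolding C0_infty_def C_infty_def by blast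
    then have w: "(\<integral>z. G z $ i * \<phi> z \<partial>lebesgue_on D) = - (\<integral>z. v z * partial_x i \<phi> z \<partial>lebesgue_on D)" for i
      using weak by (auto simp: is_weak_Dx_def D_def)
    have px: "partial_x i \<phi> z = q' (z - l *\<^sub>R H) (0, axis i 1)" for i z
      by (rule partial_x_eq[OF d\<phi>])
    have ci: "continuous_on CB (\<lambda>z. v z * q' (z - l *\<^sub>R H) u)" for u
      by (rule continuous_on_mult[OF vCB continuous_on_compose2[OF q'(2)]]) (auto intro!: continuous_intros)
    note conv = lebesgue_on_eq_integral_cbox[OF ci[unfolded CB_def] D(2)]
    have outside: "v z * q' (z - l *\<^sub>R H) u = 0" if "z \<notin> CB \<inter> D" for z u
    proof -
      have "z - l *\<^sub>R H \<notin> K" using KCB[OF _ l, of z] that by blast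
      then show ?thesis by (simp add: q'0)
    qed
    have conv1: "integrable (lebesgue_on D) (\<lambda>z. v z * q' (z - l *\<^sub>R H) u)" for u
      by (rule conv(1)) (use outside in \<open>auto simp: CB_def\<close>)
    have conv2: "(\<integral>z. v z * q' (z - l *\<^sub>R H) u \<partial>lebesgue_on D) = integral CB (\<lambda>z. v z * q' (z - l *\<^sub>R H) u)" for u
      unfolding CB_def by (rule conv(2)) (use outside in \<open>auto simp: CB_def\<close>)
    have Hq: "q' z H = (\<Sum>i\<in>UNIV. h $ i * q' z (0, axis i 1))" for z
    proof -
      have Heq: "H = (\<Sum>i\<in>UNIV. h $ i *\<^sub>R (0, axis i 1))"
        using basis_expansion[of h] by (simp add: H_def sum_prod scalar_mult_eq_scaleR)
      note L = bounded_linear.linear[OF lin, of z]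
      have "q' z H = (\<Sum>i\<in>UNIV. q' z (h $ i *\<^sub>R (0, axis i 1)))"
        by (subst Heq) (rule linear_sum[OF L])
      then show ?thesis by (simp only: linear_scale[OF L] real_scaleR_def)
    qed
    have \<phi>m: "\<phi> \<in> borel_measurable (lebesgue_on D)"
      using cq[of l] D(2) unfolding \<phi>_def[abs_def]
      by (intro continuous_imp_measurable_on_sets_lebesgue) (auto intro: continuous_on_subset)
    define S where "S = cbox (s, a + l *\<^sub>R h) (t, b + l *\<^sub>R h)"
    have Sle: "\<bar>\<phi> z\<bar> \<le> indicator S z" for z
    proof (cases "z - l *\<^sub>R H \<in> K")
      case True
      then have "z - l *\<^sub>R H \<in> cbox (s, a) (t, b)" using K box_subset_cbox by blast
      then have "z \<in> S" by (cases z) (auto simp: S_def H_def mem_box algebra_simps inner_add_left inner_diff_left)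
      then show ?thesis using q by (simp add: \<phi>_def)
    qed (use K in \<open>simp add: \<phi>_def\<close>)
    have Sm: "S \<in> lmeasurable" by (simp add: S_def)
    have Smeas: "measure lebesgue S = measure lebesgue (cbox (s, a) (t, b))"
    proof -
      have "S = (+) (l *\<^sub>R H) ` cbox (s, a) (t, b)"
        unfolding S_def H_def by (subst cbox_translation[symmetric]) (simp add: add.commute)
      then show ?thesis by (simp add: measure_translation)
    qed
    have "F' l = - integral CB (\<lambda>z. v z * q' (z - l *\<^sub>R H) H)" by (simp add: F'_def)
    also have "\<dots> = - (\<integral>z. v z * q' (z - l *\<^sub>R H) H \<partial>lebesgue_on D)" by (simp add: conv2)
    also have "\<dots> = - (\<Sum>i\<in>UNIV. h $ i * (\<integral>z. v z * partial_x i \<phi> z \<partial>lebesgue_on D))"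
      using conv1 by (simp add: Hq px sum_distrib_left mult.left_commute[of _ "h $ _"])
    also have "\<dots> = (\<Sum>i\<in>UNIV. h $ i * (\<integral>z. G z $ i * \<phi> z \<partial>lebesgue_on D))"
      by (simp add: w sum_negf)
    also have "\<dots> = (\<integral>z. (\<Sum>i\<in>UNIV. h $ i * (G z $ i * \<phi> z)) \<partial>lebesgue_on D)"
    proof -
      have "integrable (lebesgue_on D) (\<lambda>z. (axis i 1 \<bullet> G z) * \<phi> z)" for i
        by (rule Lp_pairing[OF p Lp_inner(1)[OF p G[folded D_def]] \<phi>m D(2) Sm Sle])
      then show ?thesis by (simp add: inner_axis')
    qed
    also have "\<dots> = (\<integral>z. (h \<bullet> G z) * \<phi> z \<partial>lebesgue_on D)"
      by (simp add: inner_vec_def sum_distrib_right mult.assoc)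
    also have "\<bar>\<dots>\<bar> \<le> Lp_norm p D (\<lambda>z. h \<bullet> G z) * measure lebesgue S powr (1 - 1 / p)"
      by (rule Lp_pairing[OF p Lp_inner(1)[OF p G[folded D_def]] \<phi>m D(2) Sm Sle])
    also have "\<dots> \<le> norm h * Lp_norm p D G * measure lebesgue S powr (1 - 1 / p)"
      by (intro mult_right_mono Lp_inner(2)[OF p G[folded D_def]]) auto
    finally show ?thesis unfolding Smeas .
  qed
  obtain l where l: "0 < l" "l < 1" "F 1 - F 0 = (1 - 0) * F' l"
    using MVT2[of 0 1 F F'] F by auto
  then show ?thesis using bound[of l] by (simp add: F_def CB_def H_def D_def flip: zero_prod_def)
qed

text \<open>The previous bound depends on the test function only through the box that carries it, so it
  survives the passage from smooth functions to the indicator of the box.\<close>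

lemma translation_estimate:
  fixes v :: "real \<times> (real ^ 'n) \<Rightarrow> real"
  assumes p: "1 < p" and v: "continuous_on ({0..1} \<times> UNIV) v"
    and G: "G \<in> Lp p ({0<..<1} \<times> UNIV)" and weak: "is_weak_Dx ({0<..<1} \<times> UNIV) v G"
    and s: "0 \<le> s" and t: "t \<le> 1"
  shows "\<bar>integral (cbox (s, a + h) (t, b + h)) v - integral (cbox (s, a) (t, b)) v\<bar>
      \<le> norm h * Lp_norm p ({0<..<1} \<times> UNIV) G * measure lebesgue (cbox (s, a) (t, b)) powr (1 - 1 / p)"
proof -
  obtain \<phi> :: "nat \<Rightarrow> real \<times> (real ^ 'n) \<Rightarrow> real" where \<phi>:
    "\<And>n k. Ck_on k UNIV (\<phi> n)" "\<And>n z. 0 \<le> \<phi> n z" "\<And>n z. \<phi> n z \<le> 1"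
    "\<And>n. \<exists>K. compact K \<and> K \<subseteq> box (s, a) (t, b) \<and> (\<forall>z. z \<notin> K \<longrightarrow> \<phi> n z = 0)"
    "\<And>z. (\<lambda>n. \<phi> n z) \<longlonglongrightarrow> indicator (box (s, a) (t, b)) z"
    using smooth_box_approximation[of "(s, a)" "(t, b)"] by blast
  have "bounded ((\<lambda>(x, l). x + l *\<^sub>R h) ` (cbox a b \<times> {0..1::real}))"
    unfolding split_def
    by (intro compact_imp_bounded compact_continuous_image continuous_intros compact_Times compact_cbox compact_Icc)
  then obtain a' b' where ab': "(\<lambda>(x, l). x + l *\<^sub>R h) ` (cbox a b \<times> {0..1::real}) \<subseteq> cbox a' b'"
    using bounded_subset_cbox_symmetric by metis
  then have big: "x + l *\<^sub>R h \<in> cbox a' b'" if "x \<in> cbox a b" "0 \<le> l" "l \<le> 1" for x l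
    using that by force
  define CB where "CB = cbox (s, a') (t, b')"
  have vCB: "continuous_on CB v" by (rule continuous_on_subset[OF v]) (use s t in \<open>auto simp: CB_def cbox_Pair_eq\<close>)
  have conv: "(\<lambda>n. integral CB (\<lambda>z. v z * \<phi> n (z - u))) \<longlonglongrightarrow>
      integral CB (\<lambda>z. v z * indicator (box (s, a) (t, b)) (z - u))" for u
  proof (rule dominated_convergence(2))
    have "continuous_on CB (\<lambda>z. \<phi> n (z - u))" for n
      by (rule continuous_on_compose2[of UNIV "\<phi> n"]) (use \<phi>(1)[of 0 n] in \<open>auto intro!: continuous_intros\<close>)
    then show "(\<lambda>z. v z * \<phi> n (z - u)) integrable_on CB" for n
      unfolding CB_def using vCB by (intro integrable_continuous continuous_intros) (auto simp: CB_def)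
    show "(\<lambda>z. \<bar>v z\<bar>) integrable_on CB"
      unfolding CB_def using vCB by (intro integrable_continuous continuous_intros) (auto simp: CB_def)
    show "norm (v z * \<phi> n (z - u)) \<le> \<bar>v z\<bar>" for n z
      using \<phi>(2,3)[of n "z - u"] by (simp add: abs_mult mult_left_le)
    show "(\<lambda>n. v z * \<phi> n (z - u)) \<longlonglongrightarrow> v z * indicator (box (s, a) (t, b)) (z - u)" for z
      by (intro tendsto_intros \<phi>)
  qed
  have ind: "indicator (box (s, a) (t, b)) (z - (0, h)) = indicator (box (s, a + h) (t, b + h)) z" for z
    by (cases z) (auto simp: indicator_def box_Pair_eq mem_box algebra_simps inner_add_left inner_diff_left)
  have sub0: "cbox (s, a) (t, b) \<subseteq> CB" using big[of _ 0] by (auto simp: CB_def cbox_Pair_eq)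
  have sub1: "cbox (s, a + h) (t, b + h) \<subseteq> CB"
  proof -
    have "x \<in> cbox a' b'" if "x \<in> cbox (a + h) (b + h)" for x
      using big[of "x - h" 1] that by (auto simp: mem_box algebra_simps inner_add_left inner_diff_left)
    then show ?thesis by (auto simp: CB_def cbox_Pair_eq)
  qed
  have "\<bar>integral CB (\<lambda>z. v z * indicator (box (s, a + h) (t, b + h)) z)
      - integral CB (\<lambda>z. v z * indicator (box (s, a) (t, b)) z)\<bar>
      \<le> norm h * Lp_norm p ({0<..<1} \<times> UNIV) G * measure lebesgue (cbox (s, a) (t, b)) powr (1 - 1 / p)"
  proof (rule LIMSEQ_le_const2)
    show "(\<lambda>n. \<bar>integral CB (\<lambda>z. v z * \<phi> n (z - (0, h))) - integral CB (\<lambda>z. v z * \<phi> n z)\<bar>) \<longlonglongrightarrow>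
       \<bar>integral CB (\<lambda>z. v z * indicator (box (s, a + h) (t, b + h)) z)
      - integral CB (\<lambda>z. v z * indicator (box (s, a) (t, b)) z)\<bar>"
      using conv[of "(0, h)"] conv[of 0] by (intro tendsto_intros) (simp_all add: ind)
    have "\<bar>integral CB (\<lambda>z. v z * \<phi> n (z - (0, h))) - integral CB (\<lambda>z. v z * \<phi> n z)\<bar>
        \<le> norm h * Lp_norm p ({0<..<1} \<times> UNIV) G * measure lebesgue (cbox (s, a) (t, b)) powr (1 - 1 / p)" for n
    proof -
      obtain K where "compact K" "K \<subseteq> box (s, a) (t, b)" "\<And>z. z \<notin> K \<Longrightarrow> \<phi> n z = 0" using \<phi>(4) by metis
      then show ?thesis unfolding CB_def
        by (intro translation_estimate_test[OF p v G weak s t \<phi>(1-3) _ _ _ big])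
    qed
    then show "\<exists>N. \<forall>n\<ge>N. \<bar>integral CB (\<lambda>z. v z * \<phi> n (z - (0, h))) - integral CB (\<lambda>z. v z * \<phi> n z)\<bar>
        \<le> norm h * Lp_norm p ({0<..<1} \<times> UNIV) G * measure lebesgue (cbox (s, a) (t, b)) powr (1 - 1 / p)"
      by blast
  qed
  then show ?thesis
    using integral_indicator_box[OF sub0[unfolded CB_def], of v] integral_indicator_box[OF sub1[unfolded CB_def], of v]
    by (simp add: CB_def)
qed

section \<open>Time regularity of spatial means\<close>

text \<open>Slices of a Lebesgue measurable function of several variables need not be measurable, so
  that Fubini's theorem is applied to a Borel representative, extended by \<open>0\<close>.\<close>

lemma Lp_borel_version:
  fixes g :: "'a::euclidean_space \<Rightarrow> real"
  assumes g: "g \<in> Lp p D" and D: "D \<in> sets borel"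
  obtains g' where "g' \<in> borel_measurable borel" "\<And>z. z \<notin> D \<Longrightarrow> g' z = 0"
    "AE z in lborel. z \<in> D \<longrightarrow> g' z = g z"
    "integrable lborel (\<lambda>z. \<bar>g' z\<bar> powr p)"
    "(\<integral>z. \<bar>g' z\<bar> powr p \<partial>lborel) powr (1 / p) = Lp_norm p D g"
    "\<And>\<phi>. \<phi> \<in> borel_measurable borel \<Longrightarrow>
      (\<integral>z. g z * \<phi> z \<partial>lebesgue_on D) = (\<integral>z. g' z * \<phi> z \<partial>lborel)"
proof -
  have Dl: "D \<in> sets lebesgue" using D by (simp add: sets_completionI_sets)
  have gm: "g \<in> borel_measurable (lebesgue_on D)" and gi: "integrable (lebesgue_on D) (\<lambda>z. \<bar>g z\<bar> powr p)"
    using g by (auto simp: Lp_def)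
  have "(\<lambda>z. indicator D z * g z) \<in> borel_measurable lebesgue"
    using gm Dl by (subst (asm) borel_measurable_restrict_space_iff) auto
  then obtain g0 where [measurable]: "g0 \<in> borel_measurable lborel" and g0: "AE z in lborel. indicator D z * g z = g0 z"
    using completion_ex_borel_measurable_real by blast
  define g' where "g' z = indicator D z * g0 z" for z
  have [measurable]: "g' \<in> borel_measurable borel"
    using D unfolding g'_def by measurable
  have ae: "AE z in lborel. z \<in> D \<longrightarrow> g' z = g z"
    using g0 by eventually_elim (auto simp: g'_def)
  then have aeL: "AE z in lebesgue. z \<in> D \<longrightarrow> g' z = g z" by (rule AE_completion)
  have transfer: "(\<integral>z. F z (g z) \<partial>lebesgue_on D) = (\<integral>z. F z (g' z) \<partial>lborel)"
     "integrable (lebesgue_on D) (\<lambda>z. F z (g z)) \<longleftrightarrow> integrable lborel (\<lambda>z. F z (g' z))"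
    if [measurable]: "case_prod F \<in> borel_measurable (borel \<Otimes>\<^sub>M borel)" and F0: "\<And>z. F z 0 = (0::real)" for F
  proof -
    have Fg: "(\<lambda>z. F z (g z)) \<in> borel_measurable (lebesgue_on D)"
    proof -
      have "(\<lambda>z. (z, g z)) \<in> lebesgue_on D \<rightarrow>\<^sub>M borel \<Otimes>\<^sub>M borel"
        using gm by (intro measurable_Pair) (auto intro!: measurable_restrict_space1 measurable_completion)
      from measurable_compose[OF this that(1)] show ?thesis by simp
    qed
    then have m1: "(\<lambda>z. indicator D z * F z (g z)) \<in> borel_measurable lebesgue"
      using Dl by (subst (asm) borel_measurable_restrict_space_iff) auto
    have m2: "(\<lambda>z. F z (g' z)) \<in> borel_measurable borel" by measurable
    then have m2': "(\<lambda>z. F z (g' z)) \<in> borel_measurable lebesgue"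
      by (intro measurable_completion) simp
    have ae2: "AE z in lebesgue. indicator D z * F z (g z) = F z (g' z)"
      using aeL by eventually_elim (auto simp: g'_def F0 split: split_indicator)
    have "(\<integral>z. F z (g z) \<partial>lebesgue_on D) = (\<integral>z. indicator D z * F z (g z) \<partial>lebesgue)"
      using Dl by (subst integral_restrict_space) auto
    also have "\<dots> = (\<integral>z. F z (g' z) \<partial>lebesgue)"
      by (rule integral_cong_AE[OF m1 m2' ae2])
    also have "\<dots> = (\<integral>z. F z (g' z) \<partial>lborel)" using m2 by (intro integral_completion) simp
    finally show "(\<integral>z. F z (g z) \<partial>lebesgue_on D) = (\<integral>z. F z (g' z) \<partial>lborel)" .
    have "integrable (lebesgue_on D) (\<lambda>z. F z (g z)) \<longleftrightarrow> integrable lebesgue (\<lambda>z. indicator D z * F z (g z))"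
      using Dl by (subst integrable_restrict_space) auto
    also have "\<dots> \<longleftrightarrow> integrable lebesgue (\<lambda>z. F z (g' z))"
      by (rule integrable_cong_AE[OF m1 m2' ae2])
    also have "\<dots> \<longleftrightarrow> integrable lborel (\<lambda>z. F z (g' z))" using m2 by (intro integrable_completion) simp
    finally show "integrable (lebesgue_on D) (\<lambda>z. F z (g z)) \<longleftrightarrow> integrable lborel (\<lambda>z. F z (g' z))" .
  qed
  show thesis
  proof (rule that[of g'])
    show "integrable lborel (\<lambda>z. \<bar>g' z\<bar> powr p)"
      using transfer(2)[of "\<lambda>z x. \<bar>x\<bar> powr p"] gi by simp
    show "(\<integral>z. \<bar>g' z\<bar> powr p \<partial>lborel) powr (1 / p) = Lp_norm p D g"
      using transfer(1)[of "\<lambda>z x. \<bar>x\<bar> powr p"] by (simp add: Lp_norm_def)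
    show "(\<integral>z. g z * \<phi> z \<partial>lebesgue_on D) = (\<integral>z. g' z * \<phi> z \<partial>lborel)"
      if [measurable]: "\<phi> \<in> borel_measurable borel" for \<phi>
      by (rule transfer(1)[of "\<lambda>z x. x * \<phi> z"]) auto
  qed (use ae in \<open>auto simp: g'_def\<close>)
qed

lemma lborel_product:
  fixes a :: "'a::euclidean_space \<Rightarrow> real" and b :: "'b::euclidean_space \<Rightarrow> real"
  assumes a: "integrable lborel a" and b: "integrable lborel b"
  shows "integrable lborel (\<lambda>z. a (fst z) * b (snd z))"
    and "(\<integral>z. a (fst z) * b (snd z) \<partial>lborel) = (\<integral>x. a x \<partial>lborel) * (\<integral>y. b y \<partial>lborel)"
proof -
  have [measurable]: "a \<in> borel_measurable borel" "b \<in> borel_measurable borel" using a b by auto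
  have i: "integrable (lborel \<Otimes>\<^sub>M lborel) (\<lambda>z. a (fst z) * b (snd z))"
    by (rule lborel_pair.Fubini_integrable) (use a b in \<open>auto simp: abs_mult\<close>)
  then show "integrable lborel (\<lambda>z. a (fst z) * b (snd z))" by (simp add: lborel_prod)
  show "(\<integral>z. a (fst z) * b (snd z) \<partial>lborel) = (\<integral>x. a x \<partial>lborel) * (\<integral>y. b y \<partial>lborel)"
    using lborel_pair.integral_fst'[OF i] by (simp add: lborel_prod)
qed

lemma integral_slice:
  fixes g :: "real \<times> 'a::euclidean_space \<Rightarrow> real" and k :: "real \<Rightarrow> real"
  assumes i: "integrable lborel (\<lambda>z. k (fst z) * (b (snd z) * g z))"
  shows "(\<integral>\<tau>. k \<tau> * (\<integral>y. b y * g (\<tau>, y) \<partial>lborel) \<partial>lborel) = (\<integral>z. k (fst z) * (b (snd z) * g z) \<partial>lborel)"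
proof -
  have "integrable (lborel \<Otimes>\<^sub>M lborel) (\<lambda>z. k (fst z) * (b (snd z) * g z))" using i by (simp add: lborel_prod)
  from lborel_pair.integral_fst'[OF this] show ?thesis by (simp add: lborel_prod)
qed

lemma RL_ker_nonpos: "s \<le> 0 \<Longrightarrow> RL_ker a s = 0"
  by (simp add: RL_ker_def)

text \<open>The constant that \<open>RL_ker_difference_bound\<close> gives for the exponent \<open>q = p / (p - 1)\<close> conjugate
  to \<open>p\<close>, raised to the power \<open>1 / q\<close>.\<close>

definition time_const :: "real \<Rightarrow> real \<Rightarrow> real" where
  "time_const \<alpha> p = (2 / (((\<alpha> - 1) * (p / (p - 1)) + 1) * Gamma \<alpha> powr (p / (p - 1)))) powr (1 - 1 / p)"

text \<open>The fractional integral of the spatial integral \<open>f\<close> is the pairing of \<open>g\<close> with a product of a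
  kernel in time and an indicator in space.  The kernel belongs to \<open>L\<^sub>q\<close> with \<open>1/p + 1/q = 1\<close>
  because \<open>\<alpha> > 1/p\<close>, so Hoelder's inequality on space-time gives convergence and the estimate.\<close>

lemma RL_average_hoelder:
  fixes g :: "real \<times> 'a::euclidean_space \<Rightarrow> real" and a b :: 'a
  assumes \<alpha>: "0 < \<alpha>" "\<alpha> < 1" and p: "1 < p" "1 / p < \<alpha>"
    and gm [measurable]: "g \<in> borel_measurable borel" and g0: "\<And>z. fst z \<notin> {0<..<1} \<Longrightarrow> g z = 0"
    and gi: "integrable lborel (\<lambda>z. \<bar>g z\<bar> powr p)"
  defines "f \<equiv> (\<lambda>\<tau>. \<integral>y. indicator (box a b) y * g (\<tau>, y) \<partial>lborel)"
    and "M \<equiv> (\<integral>z. \<bar>g z\<bar> powr p \<partial>lborel) powr (1 / p)"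
  shows "integrable lborel f" and "integrable lborel (\<lambda>z. indicator (box a b) (snd z) * g z)"
    and "0 \<le> t \<Longrightarrow> RL \<alpha> f t = (\<integral>z. RL_ker \<alpha> (t - fst z) * (indicator (box a b) (snd z) * g z) \<partial>lborel)"
    and "0 \<le> s \<Longrightarrow> s \<le> t \<Longrightarrow>
      \<bar>RL \<alpha> f t - RL \<alpha> f s\<bar> \<le> time_const \<alpha> p * M * (t - s) powr (\<alpha> - 1 / p) * measure lborel (box a b) powr (1 - 1 / p)"
proof -
  define q where "q = p / (p - 1)"
  have q: "1 < q" "1 / p + 1 / q = 1" "1 / q = 1 - 1 / p" using p by (auto simp: q_def field_simps)
  define \<beta> where "\<beta> = (\<alpha> - 1) * q + 1"
  have \<beta>q: "\<beta> = q * (\<alpha> - 1 / p)"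
  proof -
    have "q * (1 - 1 / p) = 1" unfolding q(3)[symmetric] using q(1) by simp
    then show ?thesis by (simp add: \<beta>_def algebra_simps)
  qed
  have \<beta>: "\<beta> > 0" unfolding \<beta>q using p q by auto
  define I :: "'a \<Rightarrow> real" where "I = indicator (box a b)"
  have [measurable]: "I \<in> borel_measurable borel" unfolding I_def by measurable
  have Ii: "integrable lborel I"
    unfolding I_def by (intro integrable_real_indicator) (use emeasure_lborel_box_finite[of a b] in auto)
  have Iint: "(\<integral>y. I y \<partial>lborel) = measure lborel (box a b)" by (simp add: I_def)
  have kernel: "integrable lborel (\<lambda>z. k (fst z) * (I (snd z) * g z))"
    "\<bar>\<integral>z. k (fst z) * (I (snd z) * g z) \<partial>lborel\<bar>
       \<le> M * ((\<integral>r. indicator {0<..} r * \<bar>k r\<bar> powr q \<partial>lborel) * measure lborel (box a b)) powr (1 - 1 / p)"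
    if km [measurable]: "k \<in> borel_measurable borel" and ki: "integrable lborel (\<lambda>r. indicator {0<..} r * \<bar>k r\<bar> powr q)" for k
  proof -
    define \<kappa> where "\<kappa> z = indicator {0<..} (fst z) * k (fst z) * I (snd z)" for z
    have \<kappa>m: "\<kappa> \<in> borel_measurable lborel" unfolding \<kappa>_def borel_prod[symmetric] lborel_prod[symmetric] by measurable
    have \<kappa>q: "\<bar>\<kappa> z\<bar> powr q = (indicator {0<..} (fst z) * \<bar>k (fst z)\<bar> powr q) * I (snd z)" for z
      using q by (auto simp: \<kappa>_def I_def abs_mult split: split_indicator)
    have \<kappa>i: "integrable lborel (\<lambda>z. \<bar>\<kappa> z\<bar> powr q)"
      unfolding \<kappa>q by (rule lborel_product(1)[OF ki Ii])
    have \<kappa>int: "(\<integral>z. \<bar>\<kappa> z\<bar> powr q \<partial>lborel) = (\<integral>r. indicator {0<..} r * \<bar>k r\<bar> powr q \<partial>lborel) * measure lborel (box a b)"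
      unfolding \<kappa>q using lborel_product(2)[OF ki Ii] by (simp add: Iint)
    have eq: "g z * \<kappa> z = k (fst z) * (I (snd z) * g z)" for z
      using g0[of z] by (auto simp: \<kappa>_def split: split_indicator)
    have gm': "g \<in> borel_measurable lborel" by simp
    show "integrable lborel (\<lambda>z. k (fst z) * (I (snd z) * g z))"
      using Hoelder_integrable[OF p(1) q(1,2) gm' \<kappa>m gi \<kappa>i] by (simp add: eq)
    have "\<bar>\<integral>z. g z * \<kappa> z \<partial>lborel\<bar> \<le> (\<integral>z. \<bar>g z * \<kappa> z\<bar> \<partial>lborel)" by simp
    also have "\<dots> \<le> M * (\<integral>z. \<bar>\<kappa> z\<bar> powr q \<partial>lborel) powr (1 / q)"
      unfolding M_def by (rule Hoelder_inequality[OF p(1) q(1,2) gm' \<kappa>m gi \<kappa>i])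
    finally show "\<bar>\<integral>z. k (fst z) * (I (snd z) * g z) \<partial>lborel\<bar>
       \<le> M * ((\<integral>r. indicator {0<..} r * \<bar>k r\<bar> powr q \<partial>lborel) * measure lborel (box a b)) powr (1 - 1 / p)"
      unfolding eq \<kappa>int q(3) .
  qed
  have "integrable lborel (\<lambda>z. indicator {0<..<1} (fst z) * (I (snd z) * g z))"
  proof (rule kernel(1))
    have "(\<lambda>r. indicator {0<..} r * \<bar>indicator {0<..<1::real} r\<bar> powr q) = (indicator {0<..<1} :: _ \<Rightarrow> real)"
      by (auto split: split_indicator)
    then show "integrable lborel (\<lambda>r. indicator {0<..} r * \<bar>indicator {0<..<1::real} r\<bar> powr q)"
      by (simp add: integrable_real_indicator)
  qed simp
  moreover have "indicator {0<..<1} (fst z) * (I (snd z) * g z) = I (snd z) * g z" for z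
    using g0[of z] by (auto split: split_indicator)
  ultimately have gI: "integrable lborel (\<lambda>z. I (snd z) * g z)" by simp
  then show "integrable lborel (\<lambda>z. indicator (box a b) (snd z) * g z)" by (simp add: I_def)
  have "integrable (lborel \<Otimes>\<^sub>M lborel) (\<lambda>z. I (snd z) * g z)" using gI by (simp add: lborel_prod)
  from lborel_pair.integrable_fst'[OF this] show "integrable lborel f"
    by (simp add: f_def I_def)
  have diff: "integrable lborel (\<lambda>r. indicator {0<..} r * \<bar>RL_ker \<alpha> (t - r) - RL_ker \<alpha> (s - r)\<bar> powr q)"
    "(\<integral>r. indicator {0<..} r * \<bar>RL_ker \<alpha> (t - r) - RL_ker \<alpha> (s - r)\<bar> powr q \<partial>lborel) \<le> 2 * (t - s) powr \<beta> / (\<beta> * Gamma \<alpha> powr q)"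
    if "0 \<le> s" "s \<le> t" for s t
    using RL_ker_difference_bound[OF \<alpha> q(1) \<beta>_def \<beta> that] by auto
  have RL_keri: "integrable lborel (\<lambda>z. RL_ker \<alpha> (t - fst z) * (I (snd z) * g z))" if "0 \<le> t" for t
  proof (rule kernel(1))
    have "(\<lambda>r. indicator {0<..} r * \<bar>RL_ker \<alpha> (t - r) - RL_ker \<alpha> (0 - r)\<bar> powr q) = (\<lambda>r. indicator {0<..} r * \<bar>RL_ker \<alpha> (t - r)\<bar> powr q)"
      by (auto simp: fun_eq_iff RL_ker_nonpos split: split_indicator)
    then show "integrable lborel (\<lambda>r. indicator {0<..} r * \<bar>RL_ker \<alpha> (t - r)\<bar> powr q)"
      using diff(1)[of 0 t] that by (simp only: order.refl)
  qed simp
  have RL: "RL \<alpha> f t = (\<integral>z. RL_ker \<alpha> (t - fst z) * (I (snd z) * g z) \<partial>lborel)" if "0 \<le> t" for t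
    using integral_slice[OF RL_keri[OF that]] by (simp add: RL_def f_def I_def)
  show "0 \<le> t \<Longrightarrow> RL \<alpha> f t = (\<integral>z. RL_ker \<alpha> (t - fst z) * (indicator (box a b) (snd z) * g z) \<partial>lborel)"
    using RL[of t] by (simp add: I_def)
  assume st: "0 \<le> s" "s \<le> t"
  have km: "(\<lambda>r. RL_ker \<alpha> (t - r) - RL_ker \<alpha> (s - r)) \<in> borel_measurable borel" by measurable
  have "RL \<alpha> f t - RL \<alpha> f s = (\<integral>z. RL_ker \<alpha> (t - fst z) * (I (snd z) * g z) - RL_ker \<alpha> (s - fst z) * (I (snd z) * g z) \<partial>lborel)"
    using RL RL_keri st by simp
  also have "\<dots> = (\<integral>z. (RL_ker \<alpha> (t - fst z) - RL_ker \<alpha> (s - fst z)) * (I (snd z) * g z) \<partial>lborel)"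
    by (simp add: left_diff_distrib)
  also have "\<bar>\<dots>\<bar> \<le> M * ((\<integral>r. indicator {0<..} r * \<bar>RL_ker \<alpha> (t - r) - RL_ker \<alpha> (s - r)\<bar> powr q \<partial>lborel) * measure lborel (box a b)) powr (1 - 1 / p)"
    using kernel(2)[of "\<lambda>r. RL_ker \<alpha> (t - r) - RL_ker \<alpha> (s - r)", OF km diff(1)[OF st]] .
  also have "\<dots> \<le> M * (2 * (t - s) powr \<beta> / (\<beta> * Gamma \<alpha> powr q) * measure lborel (box a b)) powr (1 - 1 / p)"
  proof (rule mult_left_mono)
    define J where "J = (\<integral>r. indicator {0<..} r * \<bar>RL_ker \<alpha> (t - r) - RL_ker \<alpha> (s - r)\<bar> powr q \<partial>lborel)"
    define X where "X = 2 * (t - s) powr \<beta> / (\<beta> * Gamma \<alpha> powr q)"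
    have J: "0 \<le> J" unfolding J_def by (rule Bochner_Integration.integral_nonneg) simp
    have "J \<le> X" unfolding J_def X_def by (rule diff(2)[OF st])
    then have JX: "J * measure lborel (box a b) \<le> X * measure lborel (box a b)" by (rule mult_right_mono) simp
    have "0 \<le> J * measure lborel (box a b)" using J by simp
    with p(1) JX have "(J * measure lborel (box a b)) powr (1 - 1 / p) \<le> (X * measure lborel (box a b)) powr (1 - 1 / p)"
      by (intro powr_mono2) auto
    then show "((\<integral>r. indicator {0<..} r * \<bar>RL_ker \<alpha> (t - r) - RL_ker \<alpha> (s - r)\<bar> powr q \<partial>lborel) * measure lborel (box a b)) powr (1 - 1 / p)
        \<le> (2 * (t - s) powr \<beta> / (\<beta> * Gamma \<alpha> powr q) * measure lborel (box a b)) powr (1 - 1 / p)"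
      by (simp only: J_def X_def)
    show "0 \<le> M" by (simp add: M_def)
  qed
  also have "2 * (t - s) powr \<beta> / (\<beta> * Gamma \<alpha> powr q) * measure lborel (box a b)
      = 2 / (\<beta> * Gamma \<alpha> powr q) * (t - s) powr \<beta> * measure lborel (box a b)" by simp
  also have "\<dots> powr (1 - 1 / p) = (2 / (\<beta> * Gamma \<alpha> powr q)) powr (1 - 1 / p) * ((t - s) powr \<beta>) powr (1 - 1 / p)
        * measure lborel (box a b) powr (1 - 1 / p)"
    by (simp only: powr_mult)
  also have "((t - s) powr \<beta>) powr (1 - 1 / p) = (t - s) powr (\<alpha> - 1 / p)"
  proof -
    have "\<beta> * (1 - 1 / p) = \<alpha> - 1 / p" unfolding q(3)[symmetric] \<beta>q using q(1) by simp
    then show ?thesis by (simp only: powr_powr)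
  qed
  finally show "\<bar>RL \<alpha> f t - RL \<alpha> f s\<bar> \<le> time_const \<alpha> p * M * (t - s) powr (\<alpha> - 1 / p) * measure lborel (box a b) powr (1 - 1 / p)"
    unfolding time_const_def q_def[symmetric] \<beta>_def[symmetric] by (simp only: mult_ac)
qed

text \<open>Test functions on \<open>[0, 1)\<close> that approximate \<open>(T - t)\<^sub>+\<close> together with their derivatives.  They are
  primitives of smooth approximations of the indicator of \<open>(-1, T)\<close>: the interval starts before
  time \<open>0\<close>, so that the test functions tend to the positive value \<open>T\<close> at time \<open>0\<close>.\<close>

lemma time_test_function:
  fixes T :: real
  assumes T: "0 < T" "T < 1"
  obtains \<eta> \<zeta> :: "nat \<Rightarrow> real \<Rightarrow> real" where
    "\<And>n k. Ck_on k UNIV (\<eta> n)" "\<And>n t. (\<eta> n has_real_derivative - \<zeta> n t) (at t)"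
    "\<And>n t. T \<le> t \<Longrightarrow> \<eta> n t = 0" "\<And>n t. 0 \<le> t \<Longrightarrow> \<bar>\<eta> n t\<bar> \<le> 2"
    "\<And>n t. \<bar>\<zeta> n t\<bar> \<le> 1" "\<And>n. continuous_on UNIV (\<zeta> n)"
    "\<And>t. 0 < t \<Longrightarrow> (\<lambda>n. \<eta> n t) \<longlonglongrightarrow> RL_ker 2 (T - t)"
    "\<And>t. 0 < t \<Longrightarrow> (\<lambda>n. \<zeta> n t) \<longlonglongrightarrow> RL_ker 1 (T - t)"
proof -
  obtain \<zeta> :: "nat \<Rightarrow> real \<Rightarrow> real" where \<zeta>:
    "\<And>n k. Ck_on k UNIV (\<zeta> n)" "\<And>n z. 0 \<le> \<zeta> n z" "\<And>n z. \<zeta> n z \<le> 1"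
    "\<And>n. \<exists>K. compact K \<and> K \<subseteq> box (- 1) T \<and> (\<forall>z. z \<notin> K \<longrightarrow> \<zeta> n z = 0)"
    "\<And>z. (\<lambda>n. \<zeta> n z) \<longlonglongrightarrow> indicator (box (- 1) T) z"
    using smooth_box_approximation[of "- 1" T] by blast
  have cont: "continuous_on S (\<zeta> n)" for n S using \<zeta>(1)[of 0 n] by (auto intro: continuous_on_subset)
  have \<zeta>0: "\<zeta> n t = 0" if "T \<le> t" for n t
  proof -
    obtain K where "K \<subseteq> box (- 1) T" "\<forall>z. z \<notin> K \<longrightarrow> \<zeta> n z = 0" using \<zeta>(4) by metis
    then show ?thesis using that by (auto simp: box_real)
  qed
  define \<eta> where "\<eta> n t = integral {t..2} (\<zeta> n)" for n t
  have \<eta>0: "\<eta> n t = 0" if "T \<le> t" for n t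
  proof -
    have "integral {t..2} (\<zeta> n) = integral {t..2} (\<lambda>_. 0)"
      by (rule Henstock_Kurzweil_Integration.integral_cong) (use that \<zeta>0 in auto)
    then show ?thesis by (simp add: \<eta>_def)
  qed
  have d\<eta>: "(\<eta> n has_real_derivative - \<zeta> n t) (at t)" for n t
  proof (cases "t < 2")
    case True
    have "((\<lambda>x. integral {x..2} (\<zeta> n)) has_real_derivative - \<zeta> n t) (at t within {t - 1..2})"
      using True by (intro integral_has_real_derivative' cont) auto
    moreover have "at t within {t - 1..2} = at t" using True by (intro at_within_interior) auto
    ultimately show ?thesis by (simp add: \<eta>_def[abs_def])
  next
    case False
    have "((\<lambda>t. 0) has_real_derivative 0) (at t)" by simp
    then have "(\<eta> n has_real_derivative 0) (at t)"
      by (rule DERIV_cong_ev[THEN iffD1, rotated 3])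
        (use False T \<eta>0 in \<open>auto intro: eventually_mono[OF eventually_nhds_in_open[of "{1<..}"]]\<close>)
    then show ?thesis using \<zeta>0[of t n] False T by simp
  qed
  show thesis
  proof (rule that[of \<eta> \<zeta>])
    show "Ck_on k UNIV (\<eta> n)" for n k
    proof (rule Ck_on_Suc_D, rule Ck_on_Suc_real[OF d\<eta>])
      show "Ck_on k UNIV (\<lambda>t. - \<zeta> n t)"
        using Ck_on_mult[OF Ck_on_const[of k UNIV "-1"] \<zeta>(1)[of k n]] by simp
    qed
    show "\<bar>\<eta> n t\<bar> \<le> 2" if "0 \<le> t" for n t
    proof (cases "t \<le> 2")
      case True
      have "norm (integral (cbox t 2) (\<zeta> n)) \<le> 1 * Henstock_Kurzweil_Integration.content (cbox t 2)"
        using \<zeta>(2,3) cont by (intro integrable_bound integrable_continuous) auto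
      then show ?thesis using True that by (simp add: \<eta>_def)
    qed (use T \<eta>0[of t n] in auto)
    show "(\<lambda>n. \<eta> n t) \<longlonglongrightarrow> RL_ker 2 (T - t)" if t: "0 < t" for t
    proof (cases "t < T")
      case True
      have "(\<lambda>n. integral {t..2} (\<zeta> n)) \<longlonglongrightarrow> integral {t..2} (indicator (box (- 1) T))"
        by (rule dominated_convergence(2)[where h = "\<lambda>_. 1"])
          (use \<zeta>(2,3,5) cont in \<open>auto intro: integrable_continuous_interval\<close>)
      also have "integral {t..2} (indicator (box (- 1) T)) = integral {t..2} (\<lambda>x. if x \<in> {-1<..<T} then 1 else 0::real)"
        by (intro arg_cong[of _ _ "integral _"]) (auto simp: indicator_def box_real)
      also have "\<dots> = integral ({-1<..<T} \<inter> {t..2}) (\<lambda>x. 1)"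
        by (rule Henstock_Kurzweil_Integration.integral_restrict_Int)
      also have "{-1<..<T} \<inter> {t..2} = {t..<T}" using t T by auto
      also have "integral {t..<T} (\<lambda>x. 1::real) = integral {t..T} (\<lambda>x. 1)"
      proof (rule integral_subset_negligible)
        have "{t..T} - {t..<T} = {T}" using True by auto
        then show "negligible ({t..T} - {t..<T})" by simp
      qed auto
      also have "\<dots> = T - t" using True by simp
      also have "\<dots> = RL_ker 2 (T - t)"
        using True Gamma_fact[of 1, where 'a = real] by (simp add: RL_ker_def)
      finally show ?thesis by (simp add: \<eta>_def)
    qed (use \<eta>0 in \<open>simp add: RL_ker_def\<close>)
    show "(\<lambda>n. \<zeta> n t) \<longlonglongrightarrow> RL_ker 1 (T - t)" if "0 < t" for t
      using \<zeta>(5)[of t] that T by (auto simp: RL_ker_def indicator_def box_real split: if_splits)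
  qed (use \<zeta>(2,3) d\<eta> \<eta>0 cont in \<open>auto simp: abs_le_iff intro: order_trans[of _ 0]\<close>)
qed

lemma partial_t_eq:
  assumes "(f has_derivative f') (at z)"
  shows "partial_t f z = f' (1, 0)"
proof -
  obtain t x where z: "z = (t, x)" by (cases z)
  interpret f': bounded_linear f' using assms by (rule has_derivative_bounded_linear)
  have "((\<lambda>s. (s, x)) has_derivative (\<lambda>h. (h, 0))) (at t)"
    by (auto intro!: derivative_eq_intros)
  then have d: "((\<lambda>s. f (s, x)) has_derivative (\<lambda>h. f' (h, 0))) (at t)"
    by (rule has_derivative_compose) (use assms in \<open>simp add: z\<close>)
  have "((\<lambda>s. f (s, x)) has_real_derivative f' (1, 0)) (at t)"
  proof (rule has_derivative_imp_has_field_derivative[OF d])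
    show "h * f' (1, 0) = f' (h, 0)" for h using f'.scaleR[of h "(1, 0)"] by simp
  qed
  then show ?thesis by (simp add: partial_t_def z DERIV_imp_deriv)
qed

lemma frac_int_eq:
  fixes v :: "real \<times> (real ^ 'n) \<Rightarrow> real"
  assumes vm: "(\<lambda>z. indicator ({0..1} \<times> UNIV) z * v z) \<in> borel_measurable borel"
    and t: "0 < t" "t < 1"
  shows "frac_int \<alpha> v (t, y) = (\<integral>s. RL_ker (1 - \<alpha>) (t - s) *
     (indicator {0<..<1} s * (indicator ({0..1} \<times> UNIV) (s, y) * v (s, y))) \<partial>lborel)"
proof -
  define w where "w s = indicator {0..1} s * v (s, y)" for s
  have "(\<lambda>s. indicator ({0..1} \<times> UNIV) (s, y) * v (s, y)) \<in> borel_measurable borel"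
    using measurable_compose[OF _ vm, of "\<lambda>s. (s, y)" borel] by (simp add: borel_prod[symmetric])
  then have [measurable]: "w \<in> borel_measurable borel"
    by (simp add: w_def[abs_def] indicator_times)
  have "(\<integral>s. (t - s) powr (- \<alpha>) * v (s, y) \<partial>lebesgue_on {0<..<t})
      = (\<integral>s. indicator {0<..<t} s *\<^sub>R ((t - s) powr (- \<alpha>) * v (s, y)) \<partial>lebesgue)"
    by (subst integral_restrict_space) auto
  also have "\<dots> = (\<integral>s. indicator {0<..<t} s * ((t - s) powr (- \<alpha>) * w s) \<partial>lebesgue)"
    using t by (intro Bochner_Integration.integral_cong) (auto simp: w_def split: split_indicator)
  also have "\<dots> = (\<integral>s. indicator {0<..<t} s * ((t - s) powr (- \<alpha>) * w s) \<partial>lborel)"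
    by (rule integral_completion) measurable
  finally have "frac_int \<alpha> v (t, y)
      = (\<integral>s. 1 / Gamma (1 - \<alpha>) * (indicator {0<..<t} s * ((t - s) powr (- \<alpha>) * w s)) \<partial>lborel)"
    by (simp add: frac_int_def)
  also have "\<dots> = (\<integral>s. RL_ker (1 - \<alpha>) (t - s) *
     (indicator {0<..<1} s * (indicator ({0..1} \<times> UNIV) (s, y) * v (s, y))) \<partial>lborel)"
    using t by (intro Bochner_Integration.integral_cong) (auto simp: w_def RL_ker_def split: split_indicator)
  finally show ?thesis .
qed

text \<open>The weak equation is tested with the product of an approximation of \<open>(T - t)\<^sub>+\<close> in time and one
  of the indicator of the box in space.  In the limit the left-hand side is the double time integral of
  \<open>f\<close>, and the right-hand side is the time integral of the fractional integral of \<open>v\<close> over the box, in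
  which the space integral can be moved inside.\<close>

lemma frac_dt_integrated:
  fixes v g g' :: "real \<times> (real ^ 'n) \<Rightarrow> real"
  assumes \<alpha>: "0 < \<alpha>" "\<alpha> < 1" and T: "0 < T" "T < 1"
    and v: "continuous_on ({0..1} \<times> UNIV) v"
    and frac: "is_frac_dt \<alpha> 1 UNIV v g"
    and g'm [measurable]: "g' \<in> borel_measurable borel" and g'0: "\<And>z. fst z \<notin> {0<..<1} \<Longrightarrow> g' z = 0"
    and g'i: "integrable lborel (\<lambda>z. indicator (box a b) (snd z) * g' z)"
    and g'eq: "\<And>\<phi>. \<phi> \<in> borel_measurable borel \<Longrightarrow>
      (\<integral>z. g z * \<phi> z \<partial>lebesgue_on ({0<..<1} \<times> UNIV)) = (\<integral>z. g' z * \<phi> z \<partial>lborel)"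
  defines "f \<equiv> (\<lambda>\<tau>. \<integral>y. indicator (box a b) y * g' (\<tau>, y) \<partial>lborel)"
    and "V \<equiv> (\<lambda>s. integral (cbox a b) (\<lambda>y. v (s, y)))"
  shows "RL 2 f T = RL 1 (RL (1 - \<alpha>) (\<lambda>s. indicator {0<..<1} s * V s)) T"
proof -
  define D :: "(real \<times> (real ^ 'n)) set" where "D = {0<..<1} \<times> UNIV"
  define I :: "real ^ 'n \<Rightarrow> real" where "I = indicator (box a b)"
  have Im [measurable]: "I \<in> borel_measurable borel" unfolding I_def by measurable
  have Ii: "integrable lborel I"
    unfolding I_def by (intro integrable_real_indicator) (use emeasure_lborel_box_finite[of a b] in auto)
  have I01: "0 \<le> I y" "I y \<le> 1" for y by (auto simp: I_def)
  define v0 where "v0 z = indicator ({0..1} \<times> UNIV) z * v z" for z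
  have v0m [measurable]: "v0 \<in> borel_measurable borel"
    using borel_measurable_continuous_on_indicator[OF _ v] by (simp add: v0_def[abs_def] closed_Times)
  have Dm: "D \<in> sets borel" unfolding D_def by (intro borel_open open_Times) auto
  define w where "w z = (\<integral>s. RL_ker (1 - \<alpha>) (fst z - s) * (indicator {0<..<1} s * v0 (s, snd z)) \<partial>lborel)" for z
  have wm [measurable]: "w \<in> borel_measurable borel"
    unfolding w_def[abs_def] borel_prod[symmetric] by measurable
  have fw: "frac_int \<alpha> v z = w z" if "z \<in> D" for z
    using frac_int_eq[of v "fst z" \<alpha> "snd z"] v0m[unfolded v0_def] that by (auto simp: w_def v0_def D_def mem_Times_iff)
  obtain B where B: "\<And>s y. s \<in> {0..1} \<Longrightarrow> y \<in> cbox a b \<Longrightarrow> \<bar>v (s, y)\<bar> \<le> B" "B \<ge> 0"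
  proof -
    have "compact (v ` ({0..1} \<times> cbox a b))"
      by (intro compact_continuous_image compact_Times compact_Icc compact_cbox continuous_on_subset[OF v]) auto
    then obtain B where "\<forall>x\<in>v ` ({0..1} \<times> cbox a b). norm x \<le> B"
      using compact_imp_bounded bounded_iff by metis
    then show thesis by (intro that[of "max B 0"]) force+
  qed
  have Bv: "\<bar>I y * v0 (s, y)\<bar> \<le> B * I y" for s y
    using B(1)[of s y] B(2) box_subset_cbox[of a b]
    by (auto simp: I_def v0_def indicator_times split: split_indicator)
  define \<kappa> where "\<kappa> t s = RL_ker (1 - \<alpha>) (t - s) * RL_ker 1 (s - 0)" for t s
  have \<kappa>m [measurable]: "\<kappa> t \<in> borel_measurable borel" for t unfolding \<kappa>_def[abs_def] by measurable
  have \<kappa>0: "\<kappa> t s \<ge> 0" for t s unfolding \<kappa>_def using \<alpha> by (intro mult_nonneg_nonneg RL_ker_nonneg) auto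
  have \<kappa>: "has_bochner_integral lborel (\<kappa> t) (RL_ker (2 - \<alpha>) t)" for t
  proof (rule has_bochner_integral_nn_integral)
    show "(\<integral>\<^sup>+s. ennreal (\<kappa> t s) \<partial>lborel) = ennreal (RL_ker (2 - \<alpha>) t)"
      using nn_integral_RL_ker_convolution[of "1 - \<alpha>" 1 t 0] \<alpha> by (simp add: \<kappa>_def)
  qed (use \<alpha> \<kappa>0 in \<open>auto intro: RL_ker_nonneg\<close>)
  have \<kappa>ge: "RL_ker (1 - \<alpha>) (t - s) * indicator {0<..<1} s \<le> \<kappa> t s" "0 \<le> RL_ker (1 - \<alpha>) (t - s)" for t s
    using \<kappa>0[of t s] RL_ker_nonneg[of "1 - \<alpha>" "t - s"] \<alpha> by (auto simp: \<kappa>_def RL_ker_def[of 1] split: split_indicator)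
  define Cw where "Cw = B / Gamma (2 - \<alpha>)"
  have Cw0: "Cw \<ge> 0" using B(2) \<alpha> Gamma_real_pos[of "2 - \<alpha>"] by (simp add: Cw_def)
  have wb: "\<bar>I (snd z) * w z\<bar> \<le> Cw * I (snd z)" if "z \<in> D" for z
  proof -
    obtain t y where z: "z = (t, y)" by (cases z)
    have t: "0 < t" "t < 1" using that by (auto simp: D_def z)
    have "\<bar>I y * w z\<bar> = \<bar>\<integral>s. I y * (RL_ker (1 - \<alpha>) (t - s) * (indicator {0<..<1} s * v0 (s, y))) \<partial>lborel\<bar>"
      by (simp add: w_def z)
    also have "\<dots> \<le> (\<integral>s. \<bar>I y * (RL_ker (1 - \<alpha>) (t - s) * (indicator {0<..<1} s * v0 (s, y)))\<bar> \<partial>lborel)"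
      by (rule integral_abs_bound)
    also have "\<dots> \<le> (\<integral>s. B * I y * \<kappa> t s \<partial>lborel)"
    proof (rule integral_mono_AE')
      show "integrable lborel (\<lambda>s. B * I y * \<kappa> t s)" using \<kappa>[of t] by (auto simp: has_bochner_integral_iff)
      show "AE s in lborel. \<bar>I y * (RL_ker (1 - \<alpha>) (t - s) * (indicator {0<..<1} s * v0 (s, y)))\<bar> \<le> B * I y * \<kappa> t s"
      proof (rule AE_I2)
        fix s
        have "\<bar>I y * (RL_ker (1 - \<alpha>) (t - s) * (indicator {0<..<1} s * v0 (s, y)))\<bar>
            = \<bar>I y * v0 (s, y)\<bar> * (RL_ker (1 - \<alpha>) (t - s) * indicator {0<..<1} s)"
          using \<kappa>ge(2)[of t s] by (simp add: abs_mult mult_ac)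
        also have "\<dots> \<le> B * I y * \<kappa> t s"
          using \<kappa>ge[of t s] Bv[of y s] B(2) I01 by (intro mult_mono) auto
        finally show "\<bar>I y * (RL_ker (1 - \<alpha>) (t - s) * (indicator {0<..<1} s * v0 (s, y)))\<bar> \<le> B * I y * \<kappa> t s" .
      qed
    qed (use B(2) I01 \<kappa>0 in auto)
    also have "(\<integral>s. B * I y * \<kappa> t s \<partial>lborel) = B * I y * RL_ker (2 - \<alpha>) t" using \<kappa>[of t] by (simp add: has_bochner_integral_iff)
    also have "\<dots> \<le> B * I y * (1 / Gamma (2 - \<alpha>))"
    proof (intro mult_left_mono mult_nonneg_nonneg B(2) I01(1))
      have "t powr (1 - \<alpha>) \<le> 1" using t \<alpha> by (intro powr_le1) auto
      then show "RL_ker (2 - \<alpha>) t \<le> 1 / Gamma (2 - \<alpha>)"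
        using t \<alpha> Gamma_real_pos[of "2 - \<alpha>"] by (auto simp: RL_ker_def intro!: divide_right_mono)
    qed
    finally show ?thesis by (simp add: Cw_def z mult_ac)
  qed
  have Vt: "RL (1 - \<alpha>) (\<lambda>s. indicator {0<..<1} s * V s) t = (\<integral>y. I y * w (t, y) \<partial>lborel)" for t
  proof -
    define F where "F s y = RL_ker (1 - \<alpha>) (t - s) * (indicator {0<..<1} s * (I y * v0 (s, y)))" for s y
    have "integrable lborel (\<lambda>z. \<kappa> t (fst z) * (B * I (snd z)))"
      by (rule lborel_product(1)) (use \<kappa>[of t] Ii in \<open>auto simp: has_bochner_integral_iff\<close>)
    then have "integrable lborel (\<lambda>z. F (fst z) (snd z))"
    proof (rule Bochner_Integration.integrable_bound)
      show "(\<lambda>z. F (fst z) (snd z)) \<in> borel_measurable lborel"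
        unfolding F_def lborel_prod[symmetric] by measurable
      have "\<bar>F s y\<bar> \<le> \<kappa> t s * (B * I y)" for s y
      proof -
        have "\<bar>F s y\<bar> = (RL_ker (1 - \<alpha>) (t - s) * indicator {0<..<1} s) * \<bar>I y * v0 (s, y)\<bar>"
          using \<kappa>ge(2)[of t s] by (simp add: F_def abs_mult mult_ac)
        also have "\<dots> \<le> \<kappa> t s * (B * I y)"
          using \<kappa>ge[of t s] Bv[of y s] \<kappa>0 by (intro mult_mono) auto
        finally show ?thesis .
      qed
      then show "AE z in lborel. norm (F (fst z) (snd z)) \<le> norm (\<kappa> t (fst z) * (B * I (snd z)))"
        using \<kappa>0 B(2) I01 by (intro AE_I2) (auto simp: abs_mult)
    qed
    then have "integrable (lborel \<Otimes>\<^sub>M lborel) (case_prod F)" by (simp add: lborel_prod split_def)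
    from lborel_pair.Fubini_integral[OF this]
    have Fub: "(\<integral>y. (\<integral>s. F s y \<partial>lborel) \<partial>lborel) = (\<integral>s. (\<integral>y. F s y \<partial>lborel) \<partial>lborel)" .
    have F1: "(\<integral>s. F s y \<partial>lborel) = I y * w (t, y)" for y
      by (simp add: w_def F_def mult_ac flip: integral_mult_right_zero)
    have F2: "(\<integral>y. F s y \<partial>lborel) = RL_ker (1 - \<alpha>) (t - s) * (indicator {0<..<1} s * V s)" for s
    proof (cases "s \<in> {0<..<1}")
      case True
      have "continuous_on (cbox a b) (\<lambda>y. v (s, y))"
        by (rule continuous_on_compose2[OF v]) (use True in \<open>auto intro!: continuous_intros\<close>)
      then have "set_integrable lborel (cbox a b) (\<lambda>y. v (s, y))"
        by (intro borel_integrable_compact[unfolded set_integrable_def[symmetric]] compact_cbox)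
      then have si: "set_integrable lborel (box a b) (\<lambda>y. v (s, y))"
        by (rule set_integrable_subset) (auto simp: box_subset_cbox)
      have "(\<integral>y. I y * v0 (s, y) \<partial>lborel) = (LINT y:box a b|lborel. v (s, y))"
        using True by (auto simp: set_lebesgue_integral_def I_def v0_def)
      also have "\<dots> = integral (box a b) (\<lambda>y. v (s, y))" by (rule set_borel_integral_eq_integral(2)[OF si])
      also have "\<dots> = V s" by (simp add: V_def integral_open_interval)
      finally show ?thesis by (simp add: F_def)
    qed (simp add: F_def)
    show ?thesis using Fub unfolding F1 F2 by (simp add: RL_def)
  qed
  have Ir: "integrable lborel (\<lambda>z :: real \<times> (real ^ 'n). indicator {0<..<1} (fst z) * I (snd z))"
    by (rule lborel_product(1)[OF integrable_real_indicator Ii]) auto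
  have Dind: "indicator D z = indicator {0<..<1} (fst z)" for z
    by (auto simp: D_def indicator_def mem_Times_iff)
  have KIw: "integrable lborel (\<lambda>z. RL_ker 1 (T - fst z) * (indicator {0<..<1} (fst z) * (I (snd z) * w z)))"
  proof (rule Bochner_Integration.integrable_bound)
    show "integrable lborel (\<lambda>z :: real \<times> (real ^ 'n). Cw * (indicator {0<..<1} (fst z) * I (snd z)))" using Ir by simp
    show "(\<lambda>z. RL_ker 1 (T - fst z) * (indicator {0<..<1} (fst z) * (I (snd z) * w z))) \<in> borel_measurable lborel"
      unfolding lborel_prod[symmetric] using wm unfolding borel_prod[symmetric] by measurable
    have "\<bar>RL_ker 1 (T - fst z) * (indicator {0<..<1} (fst z) * (I (snd z) * w z))\<bar>
        \<le> Cw * (indicator {0<..<1} (fst z) * I (snd z))" for z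
      using wb[of z] mult_nonneg_nonneg[OF Cw0 I01(1)[of "snd z"]]
      by (auto simp: RL_ker_def D_def mem_Times_iff abs_mult split: split_indicator)
    then show "AE z in lborel. norm (RL_ker 1 (T - fst z) * (indicator {0<..<1} (fst z) * (I (snd z) * w z)))
        \<le> norm (Cw * (indicator {0<..<1} (fst z) * I (snd z)))"
      by (intro AE_I2) (auto intro: order_trans[OF _ abs_ge_self])
  qed
  have RHS: "RL 1 (RL (1 - \<alpha>) (\<lambda>s. indicator {0<..<1} s * V s)) T
      = (\<integral>z. RL_ker 1 (T - fst z) * (indicator {0<..<1} (fst z) * (I (snd z) * w z)) \<partial>lborel)"
  proof -
    have "integrable (lborel \<Otimes>\<^sub>M lborel) (\<lambda>z. RL_ker 1 (T - fst z) * (indicator {0<..<1} (fst z) * (I (snd z) * w z)))"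
      using KIw by (simp add: lborel_prod)
    from lborel_pair.integral_fst'[OF this]
    have "(\<integral>z. RL_ker 1 (T - fst z) * (indicator {0<..<1} (fst z) * (I (snd z) * w z)) \<partial>lborel)
        = (\<integral>t. RL_ker 1 (T - t) * (indicator {0<..<1} t * (\<integral>y. I y * w (t, y) \<partial>lborel)) \<partial>lborel)"
      by (simp add: lborel_prod)
    also have "\<dots> = (\<integral>t. RL_ker 1 (T - t) * RL (1 - \<alpha>) (\<lambda>s. indicator {0<..<1} s * V s) t \<partial>lborel)"
    proof (rule Bochner_Integration.integral_cong[OF refl])
      fix t
      show "RL_ker 1 (T - t) * (indicator {0<..<1} t * (\<integral>y. I y * w (t, y) \<partial>lborel))
        = RL_ker 1 (T - t) * RL (1 - \<alpha>) (\<lambda>s. indicator {0<..<1} s * V s) t"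
      proof (cases "t \<le> 0")
        case True
        then have "RL (1 - \<alpha>) (\<lambda>s. indicator {0<..<1} s * V s) t = 0" by (intro RL_nonpos) auto
        then show ?thesis using True by simp
      next
        case False
        then show ?thesis using T by (cases "t < 1") (auto simp: Vt RL_ker_def)
      qed
    qed
    finally show ?thesis by (simp add: RL_def)
  qed
  have Kg: "integrable lborel (\<lambda>z. RL_ker 2 (T - fst z) * (I (snd z) * g' z))"
  proof (rule Bochner_Integration.integrable_bound)
    show "integrable lborel (\<lambda>z. I (snd z) * g' z)" using g'i by (simp add: I_def)
    show "(\<lambda>z. RL_ker 2 (T - fst z) * (I (snd z) * g' z)) \<in> borel_measurable lborel"
      unfolding lborel_prod[symmetric] using g'm unfolding borel_prod[symmetric] by measurable
    have "\<bar>RL_ker 2 (T - fst z) * (I (snd z) * g' z)\<bar> \<le> \<bar>I (snd z) * g' z\<bar>" for z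
    proof (cases "fst z \<in> {0<..<1}")
      case True
      have "Gamma 2 = (1::real)" using Gamma_fact[of 1, where 'a = real] by simp
      then have "\<bar>RL_ker 2 (T - fst z)\<bar> \<le> 1" using True T by (auto simp: RL_ker_def)
      then show ?thesis unfolding abs_mult by (intro mult_left_le_one_le) auto
    qed (use g'0 in simp)
    then show "AE z in lborel. norm (RL_ker 2 (T - fst z) * (I (snd z) * g' z)) \<le> norm (I (snd z) * g' z)"
      by (intro AE_I2) simp
  qed
  have LHS: "RL 2 f T = (\<integral>z. RL_ker 2 (T - fst z) * (I (snd z) * g' z) \<partial>lborel)"
    using integral_slice[OF Kg] by (simp add: RL_def f_def I_def)
  obtain \<eta> \<zeta> :: "nat \<Rightarrow> real \<Rightarrow> real" where \<eta>:
    "\<And>n k. Ck_on k UNIV (\<eta> n)" "\<And>n t. (\<eta> n has_real_derivative - \<zeta> n t) (at t)"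
    "\<And>n t. T \<le> t \<Longrightarrow> \<eta> n t = 0" "\<And>n t. 0 \<le> t \<Longrightarrow> \<bar>\<eta> n t\<bar> \<le> 2"
    "\<And>n t. \<bar>\<zeta> n t\<bar> \<le> 1" "\<And>n. continuous_on UNIV (\<zeta> n)"
    "\<And>t. 0 < t \<Longrightarrow> (\<lambda>n. \<eta> n t) \<longlonglongrightarrow> RL_ker 2 (T - t)"
    "\<And>t. 0 < t \<Longrightarrow> (\<lambda>n. \<zeta> n t) \<longlonglongrightarrow> RL_ker 1 (T - t)"
    by (rule time_test_function[OF T]) blast
  obtain \<xi> :: "nat \<Rightarrow> real ^ 'n \<Rightarrow> real" where \<xi>:
    "\<And>n k. Ck_on k UNIV (\<xi> n)" "\<And>n z. 0 \<le> \<xi> n z" "\<And>n z. \<xi> n z \<le> 1"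
    "\<And>n. \<exists>K. compact K \<and> K \<subseteq> box a b \<and> (\<forall>z. z \<notin> K \<longrightarrow> \<xi> n z = 0)"
    "\<And>z. (\<lambda>n. \<xi> n z) \<longlonglongrightarrow> I z"
    using smooth_box_approximation[of a b] unfolding I_def by blast
  have \<eta>m [measurable]: "\<eta> n \<in> borel_measurable borel" for n
    using \<eta>(1)[of 0 n] by (simp add: borel_measurable_continuous_onI)
  have \<zeta>m [measurable]: "\<zeta> n \<in> borel_measurable borel" for n
    using \<eta>(6)[of n] by (rule borel_measurable_continuous_onI)
  have \<xi>m [measurable]: "\<xi> n \<in> borel_measurable borel" for n
    using \<xi>(1)[of 0 n] by (simp add: borel_measurable_continuous_onI)
  have \<xi>I: "\<xi> n y = \<xi> n y * I y" for n y
  proof -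
    obtain K where "K \<subseteq> box a b" "\<forall>z. z \<notin> K \<longrightarrow> \<xi> n z = 0" using \<xi>(4) by metis
    then show ?thesis by (auto simp: I_def split: split_indicator)
  qed
  define \<phi> where "\<phi> n z = \<eta> n (fst z) * \<xi> n (snd z)" for n and z :: "real \<times> (real ^ 'n)"
  have \<phi>m [measurable]: "\<phi> n \<in> borel_measurable borel" for n
    unfolding \<phi>_def[abs_def] borel_prod[symmetric] by measurable
  have pt: "partial_t (\<phi> n) z = - \<zeta> n (fst z) * \<xi> n (snd z)" for n z
  proof -
    from \<xi>(1)[of 1 n] obtain \<xi>' where \<xi>': "\<And>y. (\<xi> n has_derivative \<xi>' y) (at y)" by auto
    have "((\<lambda>z. \<eta> n (fst z)) has_derivative (\<lambda>h. - \<zeta> n (fst z) * fst h)) (at z)"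
      by (rule has_derivative_compose[OF has_derivative_fst[OF has_derivative_ident]])
        (rule \<eta>(2)[unfolded has_field_derivative_def])
    moreover have "((\<lambda>z. \<xi> n (snd z)) has_derivative (\<lambda>h. \<xi>' (snd z) (snd h))) (at z)"
      by (rule has_derivative_compose[OF has_derivative_snd[OF has_derivative_ident]]) (rule \<xi>')
    ultimately have "(\<phi> n has_derivative (\<lambda>h. \<eta> n (fst z) * \<xi>' (snd z) (snd h) + - \<zeta> n (fst z) * fst h * \<xi> n (snd z))) (at z)"
      unfolding \<phi>_def[abs_def] by (rule has_derivative_mult)
    from partial_t_eq[OF this] show ?thesis
      using linear_0[OF bounded_linear.linear[OF has_derivative_bounded_linear[OF \<xi>', of "snd z"]]] by simp
  qed
  have test: "\<phi> n \<in> C0_infty ({0..<1} \<times> UNIV)" for n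
  proof -
    obtain K where K: "compact K" "K \<subseteq> box a b" "\<And>z. z \<notin> K \<Longrightarrow> \<xi> n z = 0" using \<xi>(4) by metis
    have "Ck_on k ({0..<1} \<times> UNIV) (\<phi> n)" for k
    proof (rule Ck_on_subset[OF _ subset_UNIV])
      show "Ck_on k UNIV (\<phi> n)"
        using Ck_on_mult[OF Ck_on_affine_compose[OF bounded_linear_fst \<eta>(1)[of k n], of 0]
            Ck_on_affine_compose[OF bounded_linear_snd \<xi>(1)[of k n], of 0]]
        by (simp add: \<phi>_def[abs_def])
    qed
    moreover have "compact ({0..T} \<times> K)" using K(1) by (intro compact_Times) auto
    moreover have "{0..T} \<times> K \<subseteq> {0..<1} \<times> UNIV" using T by auto
    moreover have "\<phi> n z = 0" if "z \<in> {0..<1} \<times> UNIV - {0..T} \<times> K" for z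
    proof -
      have "T \<le> fst z \<or> snd z \<notin> K" using that by (cases z) auto
      then show ?thesis using \<eta>(3) K(3) by (auto simp: \<phi>_def)
    qed
    ultimately show ?thesis unfolding C0_infty_def C_infty_def by blast
  qed
  have id: "(\<integral>z. g' z * \<phi> n z \<partial>lborel) = (\<integral>z. \<zeta> n (fst z) * \<xi> n (snd z) * (indicator {0<..<1} (fst z) * (I (snd z) * w z)) \<partial>lborel)" for n
  proof -
    have "(\<integral>z. g' z * \<phi> n z \<partial>lborel) = (\<integral>z. g z * \<phi> n z \<partial>lebesgue_on D)"
      unfolding D_def by (rule g'eq[symmetric]) simp
    also have "\<dots> = - (\<integral>z. frac_int \<alpha> v z * partial_t (\<phi> n) z \<partial>lebesgue_on D)"
      using frac test[of n] by (simp add: is_frac_dt_def D_def)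
    also have "\<dots> = - (\<integral>z. indicator D z *\<^sub>R (frac_int \<alpha> v z * partial_t (\<phi> n) z) \<partial>lebesgue)"
      using Dm by (subst integral_restrict_space) (auto simp: sets_completionI_sets)
    also have "(\<lambda>z. indicator D z *\<^sub>R (frac_int \<alpha> v z * partial_t (\<phi> n) z))
        = (\<lambda>z. - (\<zeta> n (fst z) * \<xi> n (snd z) * (indicator {0<..<1} (fst z) * (I (snd z) * w z))))"
    proof
      fix z
      show "indicator D z *\<^sub>R (frac_int \<alpha> v z * partial_t (\<phi> n) z)
        = - (\<zeta> n (fst z) * \<xi> n (snd z) * (indicator {0<..<1} (fst z) * (I (snd z) * w z)))"
      proof (cases "z \<in> D")
        case True
        then have "indicator D z *\<^sub>R (frac_int \<alpha> v z * partial_t (\<phi> n) z) = - (\<zeta> n (fst z) * \<xi> n (snd z) * w z)"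
          by (simp add: fw pt)
        also have "\<xi> n (snd z) = \<xi> n (snd z) * I (snd z)" by (rule \<xi>I)
        finally show ?thesis using True by (simp add: Dind[symmetric])
      qed (simp add: Dind[symmetric])
    qed
    also have "- (\<integral>z. - (\<zeta> n (fst z) * \<xi> n (snd z) * (indicator {0<..<1} (fst z) * (I (snd z) * w z))) \<partial>lebesgue)
      = (\<integral>z. \<zeta> n (fst z) * \<xi> n (snd z) * (indicator {0<..<1} (fst z) * (I (snd z) * w z)) \<partial>lebesgue)" by simp
    also have "\<dots> = (\<integral>z. \<zeta> n (fst z) * \<xi> n (snd z) * (indicator {0<..<1} (fst z) * (I (snd z) * w z)) \<partial>lborel)"
      by (rule integral_completion) (unfold lborel_prod[symmetric], use wm[unfolded borel_prod[symmetric]] in measurable)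
    finally show ?thesis .
  qed
  have lim1: "(\<lambda>n. \<integral>z. g' z * \<phi> n z \<partial>lborel) \<longlonglongrightarrow> (\<integral>z. RL_ker 2 (T - fst z) * (I (snd z) * g' z) \<partial>lborel)"
  proof (rule integral_dominated_convergence)
    show "integrable lborel (\<lambda>z. 2 * \<bar>I (snd z) * g' z\<bar>)" using g'i by (simp add: I_def)
    show "AE z in lborel. (\<lambda>n. g' z * \<phi> n z) \<longlonglongrightarrow> RL_ker 2 (T - fst z) * (I (snd z) * g' z)"
    proof (rule AE_I2)
      fix z :: "real \<times> (real ^ 'n)"
      show "(\<lambda>n. g' z * \<phi> n z) \<longlonglongrightarrow> RL_ker 2 (T - fst z) * (I (snd z) * g' z)"
      proof (cases "fst z \<in> {0<..<1}")
        case True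
        then have "(\<lambda>n. g' z * \<phi> n z) \<longlonglongrightarrow> g' z * (RL_ker 2 (T - fst z) * I (snd z))"
          unfolding \<phi>_def by (intro tendsto_mult tendsto_const \<eta>(7) \<xi>(5)) auto
        then show ?thesis by (simp add: mult_ac)
      qed (use g'0 in simp)
    qed
    have "\<bar>g' z * \<phi> n z\<bar> \<le> 2 * \<bar>I (snd z) * g' z\<bar>" for n z
    proof (cases "fst z \<in> {0<..<1}")
      case True
      have "\<bar>g' z * \<phi> n z\<bar> = \<bar>\<eta> n (fst z)\<bar> * (\<xi> n (snd z) * (I (snd z) * \<bar>g' z\<bar>))"
        using \<xi>I[of n "snd z"] \<xi>(2)[of n "snd z"] I01 by (auto simp: \<phi>_def abs_mult mult_ac)
      also have "\<dots> \<le> 2 * (1 * (I (snd z) * \<bar>g' z\<bar>))"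
        using \<eta>(4)[of "fst z" n] \<xi>(2,3)[of n "snd z"] True I01 by (intro mult_mono) auto
      finally show ?thesis using I01 by (simp add: abs_mult)
    qed (use g'0 in simp)
    then show "AE z in lborel. norm (g' z * \<phi> n z) \<le> 2 * \<bar>I (snd z) * g' z\<bar>" for n by (intro AE_I2) simp
    show "(\<lambda>z. RL_ker 2 (T - fst z) * (I (snd z) * g' z)) \<in> borel_measurable lborel" using Kg by (rule borel_measurable_integrable)
  qed simp
  have lim2: "(\<lambda>n. \<integral>z. \<zeta> n (fst z) * \<xi> n (snd z) * (indicator {0<..<1} (fst z) * (I (snd z) * w z)) \<partial>lborel)
      \<longlonglongrightarrow> (\<integral>z. RL_ker 1 (T - fst z) * (indicator {0<..<1} (fst z) * (I (snd z) * w z)) \<partial>lborel)"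
  proof (rule integral_dominated_convergence)
    show "integrable lborel (\<lambda>z :: real \<times> (real ^ 'n). Cw * (indicator {0<..<1} (fst z) * I (snd z)))" using Ir by simp
    show "AE z in lborel. (\<lambda>n. \<zeta> n (fst z) * \<xi> n (snd z) * (indicator {0<..<1} (fst z) * (I (snd z) * w z)))
       \<longlonglongrightarrow> RL_ker 1 (T - fst z) * (indicator {0<..<1} (fst z) * (I (snd z) * w z))"
    proof (rule AE_I2)
      fix z :: "real \<times> (real ^ 'n)"
      show "(\<lambda>n. \<zeta> n (fst z) * \<xi> n (snd z) * (indicator {0<..<1} (fst z) * (I (snd z) * w z)))
       \<longlonglongrightarrow> RL_ker 1 (T - fst z) * (indicator {0<..<1} (fst z) * (I (snd z) * w z))"
      proof (cases "fst z \<in> {0<..<1}")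
        case True
        then have "(\<lambda>n. \<zeta> n (fst z) * \<xi> n (snd z) * (indicator {0<..<1} (fst z) * (I (snd z) * w z)))
         \<longlonglongrightarrow> RL_ker 1 (T - fst z) * I (snd z) * (indicator {0<..<1} (fst z) * (I (snd z) * w z))"
          by (intro tendsto_mult tendsto_const \<eta>(8) \<xi>(5)) auto
        moreover have "I (snd z) * I (snd z) = I (snd z)" by (auto simp: I_def split: split_indicator)
        ultimately show ?thesis by (simp add: mult_ac flip: mult.assoc[of "I (snd z)" "I (snd z)"])
      qed simp
    qed
    have "\<bar>\<zeta> n (fst z) * \<xi> n (snd z) * (indicator {0<..<1} (fst z) * (I (snd z) * w z))\<bar>
        \<le> Cw * (indicator {0<..<1} (fst z) * I (snd z))" for n z
    proof (cases "z \<in> D")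
      case True
      have "\<bar>\<zeta> n (fst z) * \<xi> n (snd z)\<bar> \<le> 1 * 1"
        unfolding abs_mult using \<eta>(5)[of n "fst z"] \<xi>(2,3)[of n "snd z"] by (intro mult_mono) auto
      then have "\<bar>\<zeta> n (fst z) * \<xi> n (snd z)\<bar> * \<bar>I (snd z) * w z\<bar> \<le> 1 * (Cw * I (snd z))"
        using wb[OF True] by (intro mult_mono) auto
      then show ?thesis using True by (simp add: abs_mult mult.assoc Dind[symmetric])
    qed (simp add: Dind[symmetric])
    then show "AE z in lborel. norm (\<zeta> n (fst z) * \<xi> n (snd z) * (indicator {0<..<1} (fst z) * (I (snd z) * w z)))
        \<le> Cw * (indicator {0<..<1} (fst z) * I (snd z))" for n by (intro AE_I2) simp
    show "(\<lambda>z. RL_ker 1 (T - fst z) * (indicator {0<..<1} (fst z) * (I (snd z) * w z))) \<in> borel_measurable lborel"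
      using KIw by (rule borel_measurable_integrable)
    show "(\<lambda>z. \<zeta> n (fst z) * \<xi> n (snd z) * (indicator {0<..<1} (fst z) * (I (snd z) * w z))) \<in> borel_measurable lborel" for n
      unfolding lborel_prod[symmetric] using wm unfolding borel_prod[symmetric] by measurable
  qed
  show ?thesis using LIMSEQ_unique[OF lim1] lim2 unfolding id LHS RHS by blast
qed

lemma hoelder_imp_continuous_on:
  fixes f :: "'a::real_normed_vector \<Rightarrow> real"
  assumes e: "e > 0" and f: "\<And>s t. s \<in> S \<Longrightarrow> t \<in> S \<Longrightarrow> \<bar>f t - f s\<bar> \<le> K * norm (t - s) powr e"
  shows "continuous_on S f"
  unfolding continuous_on_def
proof
  fix s assume s: "s \<in> S"
  have "continuous_on UNIV (\<lambda>t. K * norm (t - s) powr e)"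
    using e by (intro continuous_on_mult continuous_on_const continuous_on_powr' continuous_intros) auto
  then have "((\<lambda>t. K * norm (t - s) powr e) \<longlongrightarrow> K * norm (s - s) powr e) (at s within S)"
    by (meson UNIV_I continuous_on_def continuous_on_subset subset_UNIV s)
  then have "((\<lambda>t. K * norm (t - s) powr e) \<longlongrightarrow> 0) (at s within S)" by simp
  moreover have "eventually (\<lambda>t. norm (f t - f s) \<le> K * norm (t - s) powr e) (at s within S)"
    using f s by (auto simp: eventually_at_filter)
  ultimately have "((\<lambda>t. f t - f s) \<longlongrightarrow> 0) (at s within S)" by (rule Lim_null_comparison[rotated])
  then show "(f \<longlongrightarrow> f s) (at s within S)" by (rule LIM_zero_cancel)
qed

text \<open>By \<open>frac_dt_integrated\<close> and \<open>fractional_inversion\<close>, \<open>V\<close> is the fractional integral of order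
  \<open>\<alpha>\<close> of the spatial integral of \<open>g\<close>, for which the estimate has been shown.\<close>

lemma time_hoelder:
  fixes v g :: "real \<times> (real ^ 'n) \<Rightarrow> real" and a b :: "real ^ 'n"
  assumes \<alpha>: "0 < \<alpha>" "\<alpha> < 1" and p: "1 < p" "1 / p < \<alpha>"
    and v: "continuous_on ({0..1} \<times> UNIV) v"
    and g: "g \<in> Lp p ({0<..<1} \<times> UNIV)" and frac: "is_frac_dt \<alpha> 1 UNIV v g"
    and st: "0 \<le> s" "s \<le> t" "t \<le> 1"
  defines "V \<equiv> (\<lambda>s. integral (cbox a b) (\<lambda>y. v (s, y)))"
  shows "\<bar>V t - V s\<bar> \<le> time_const \<alpha> p * Lp_norm p ({0<..<1} \<times> UNIV) g * (t - s) powr (\<alpha> - 1 / p)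
      * measure lborel (cbox a b) powr (1 - 1 / p)"
proof -
  have "open ({0<..<1} \<times> UNIV :: (real \<times> (real ^ 'n)) set)" by (intro open_Times) auto
  then have "({0<..<1} \<times> UNIV :: (real \<times> (real ^ 'n)) set) \<in> sets borel" by (rule borel_open)
  then obtain g' where g':
    "g' \<in> borel_measurable borel" "\<And>z. z \<notin> {0<..<1} \<times> UNIV \<Longrightarrow> g' z = 0"
    "integrable lborel (\<lambda>z. \<bar>g' z\<bar> powr p)"
    "(\<integral>z. \<bar>g' z\<bar> powr p \<partial>lborel) powr (1 / p) = Lp_norm p ({0<..<1} \<times> UNIV) g"
    "\<And>\<phi>. \<phi> \<in> borel_measurable borel \<Longrightarrow>
      (\<integral>z. g z * \<phi> z \<partial>lebesgue_on ({0<..<1} \<times> UNIV)) = (\<integral>z. g' z * \<phi> z \<partial>lborel)"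
    by (rule Lp_borel_version[OF g]) (rule that)
  have g'0: "g' z = 0" if "fst z \<notin> {0<..<1}" for z using that by (intro g'(2)) (auto simp: mem_Times_iff)
  define f where "f \<tau> = (\<integral>y. indicator (box a b) y * g' (\<tau>, y) \<partial>lborel)" for \<tau>
  note RL = RL_average_hoelder[OF \<alpha> p g'(1) g'0 g'(3), where a = a and b = b]
  have H1: "integrable lborel f" unfolding f_def[abs_def] by (rule RL(1))
  have H2: "integrable lborel (\<lambda>z. indicator (box a b) (snd z) * g' z)" by (rule RL(2))
  have H4: "\<bar>RL \<alpha> f t - RL \<alpha> f s\<bar> \<le> time_const \<alpha> p * Lp_norm p ({0<..<1} \<times> UNIV) g
      * (t - s) powr (\<alpha> - 1 / p) * measure lborel (box a b) powr (1 - 1 / p)" if "0 \<le> s" "s \<le> t" for s t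
    unfolding f_def[abs_def] g'(4)[symmetric] by (rule RL(4)) (use that in auto)
  define K where "K = time_const \<alpha> p * Lp_norm p ({0<..<1} \<times> UNIV) g * measure lborel (box a b) powr (1 - 1 / p)"
  have Hle: "\<bar>RL \<alpha> f t - RL \<alpha> f s\<bar> \<le> K * (t - s) powr (\<alpha> - 1 / p)" if "0 \<le> s" "s \<le> t" for s t
    using H4[OF that] by (simp add: K_def mult_ac)
  have "continuous_on {0..1} (RL \<alpha> f)"
  proof (rule hoelder_imp_continuous_on)
    show "\<alpha> - 1 / p > 0" using p by simp
    show "\<bar>RL \<alpha> f t - RL \<alpha> f s\<bar> \<le> K * norm (t - s) powr (\<alpha> - 1 / p)" if "s \<in> {0..1}" "t \<in> {0..1}" for s t
      using Hle[of s t] Hle[of t s] that by (cases "s \<le> t") (auto simp: abs_minus_commute)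
  qed
  moreover have "continuous_on {0..1} V"
    unfolding V_def
    by (rule integral_continuous_on_param) (use v in \<open>auto intro: continuous_on_subset\<close>)
  moreover have "RL 2 f T = RL 1 (RL (1 - \<alpha>) (\<lambda>s. indicator {0<..<1} s * V s)) T" if "0 < T" "T < 1" for T
    unfolding f_def V_def
    by (rule frac_dt_integrated[OF \<alpha> that v frac g'(1) g'0 H2 g'(5)])
  moreover have "f s = 0" if "s \<le> 0" for s
    using that g'0 by (simp add: f_def)
  ultimately have V: "V t = RL \<alpha> f t" if "t \<in> {0..1}" for t
    using fractional_inversion[OF \<alpha> H1, of V t] that by blast
  have "measure lborel (cbox a b) = measure lborel (box a b)"
    by (simp add: measure_lborel_cbox_eq measure_lborel_box_eq)
  then show ?thesis using Hle[OF st(1,2)] V[of s] V[of t] st by (simp add: K_def mult_ac)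
qed

section \<open>A Campanato lemma for means over cubes\<close>

text \<open>The mean over the cube with corner \<open>x\<close> and side \<open>r\<close>, written over the unit cube so that it makes
  sense for \<open>r = 0\<close>, depends continuously on \<open>r\<close>, and commutes with the mean for another side by
  Fubini's theorem.\<close>

definition cube_mean :: "real \<Rightarrow> ('a::euclidean_space \<Rightarrow> real) \<Rightarrow> 'a \<Rightarrow> real" where
  "cube_mean r w x = integral (cbox 0 One) (\<lambda>y. w (x + r *\<^sub>R y))"

lemma continuous_cube_mean:
  fixes w :: "'a::euclidean_space \<Rightarrow> real"
  assumes w: "continuous_on UNIV w"
  shows "continuous_on UNIV (cube_mean r w)"
  unfolding cube_mean_def
proof (rule integral_continuous_on_param)
  show "continuous_on (UNIV \<times> cbox 0 One) (\<lambda>(x, y). w (x + r *\<^sub>R y))"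
    unfolding split_def by (rule continuous_on_compose2[OF w]) (auto intro!: continuous_intros)
qed

lemma cube_mean_integrable:
  fixes w :: "'a::euclidean_space \<Rightarrow> real"
  assumes w: "continuous_on UNIV w"
  shows "(\<lambda>y. w (x + r *\<^sub>R y)) integrable_on cbox a b"
  by (intro integrable_continuous continuous_on_compose2[OF w]) (auto intro!: continuous_intros)

lemma cube_mean_swap:
  fixes w :: "'a::euclidean_space \<Rightarrow> real"
  assumes w: "continuous_on UNIV w"
  shows "cube_mean r (cube_mean s w) x = cube_mean s (cube_mean r w) x"
proof -
  have "integral (cbox 0 One) (\<lambda>y. integral (cbox 0 One) (\<lambda>y'. w (x + r *\<^sub>R y + s *\<^sub>R y')))
      = integral (cbox 0 One) (\<lambda>y'. integral (cbox 0 One) (\<lambda>y. w (x + r *\<^sub>R y + s *\<^sub>R y')))"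
    by (rule integral_swap_continuous)
      (auto simp: split_def intro!: continuous_on_compose2[OF w] continuous_intros)
  then show ?thesis by (simp add: cube_mean_def algebra_simps)
qed

lemma norm_unit_cube: "y \<in> cbox 0 One \<Longrightarrow> norm (y::'a::euclidean_space) \<le> DIM('a)"
proof -
  assume y: "y \<in> cbox 0 One"
  have "norm y \<le> (\<Sum>i\<in>Basis. \<bar>y \<bullet> i\<bar>)" by (rule norm_le_l1)
  also have "\<dots> \<le> (\<Sum>i\<in>(Basis::'a set). 1)" using y by (intro sum_mono) (auto simp: mem_box)
  finally show ?thesis by simp
qed

lemma cube_mean_close:
  fixes w :: "'a::euclidean_space \<Rightarrow> real"
  assumes w: "continuous_on UNIV w"
    and b: "\<And>y. y \<in> cbox 0 One \<Longrightarrow> \<bar>w (x + r *\<^sub>R y) - c\<bar> \<le> e"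
  shows "\<bar>cube_mean r w x - c\<bar> \<le> e"
proof -
  have "cube_mean r w x - c = integral (cbox 0 One) (\<lambda>y. w (x + r *\<^sub>R y) - c)"
    unfolding cube_mean_def using cube_mean_integrable[OF w]
    by (subst integral_diff) auto
  also have "norm \<dots> \<le> integral (cbox 0 (One::'a)) (\<lambda>y. e)"
    using b cube_mean_integrable[OF w]
    by (intro integral_norm_bound_integral integrable_diff) auto
  finally show ?thesis by simp
qed

lemma cube_mean_tendsto:
  fixes w :: "'a::euclidean_space \<Rightarrow> real"
  assumes w: "continuous_on UNIV w" and r: "r \<longlonglongrightarrow> 0"
  shows "(\<lambda>n. cube_mean (r n) w x) \<longlonglongrightarrow> w x"
proof -
  have c: "continuous_on UNIV (\<lambda>r. cube_mean r w x)"
    unfolding cube_mean_def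
  proof (rule integral_continuous_on_param)
    show "continuous_on (UNIV \<times> cbox 0 One) (\<lambda>(r, y). w (x + r *\<^sub>R y))"
      unfolding split_def by (rule continuous_on_compose2[OF w]) (auto intro!: continuous_intros)
  qed
  have "(\<lambda>n. cube_mean (r n) w x) \<longlonglongrightarrow> cube_mean 0 w x"
    using continuous_on_tendsto_compose[OF c r] by auto
  then show ?thesis by (simp add: cube_mean_def)
qed

text \<open>Both means are compared with the iterated mean.  The mean of side \<open>r\<close> of
  \<open>cube_mean (r / 2) w\<close> is close to \<open>cube_mean (r / 2) w x\<close>, and, in the other order, the mean of side
  \<open>r / 2\<close> of \<open>cube_mean r w\<close> is close to \<open>cube_mean r w x\<close>: in each case only translations at a
  fixed scale are involved.\<close>

lemma cube_mean_halving:
  fixes w :: "'a::euclidean_space \<Rightarrow> real"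
  assumes w: "continuous_on UNIV w" and C: "C \<ge> 0" and \<sigma>: "\<sigma> > 0" and r: "r > 0"
    and osc: "\<And>r x x'. r > 0 \<Longrightarrow>
        \<bar>cube_mean r w x - cube_mean r w x'\<bar> \<le> C * (1 + norm (x - x') / r) * r powr \<sigma>"
  shows "\<bar>cube_mean r w x - cube_mean (r / 2) w x\<bar> \<le> C * (2 + 3 * real DIM('a)) * r powr \<sigma>"
proof -
  define d where "d = real DIM('a)"
  define m where "m = cube_mean r (cube_mean (r / 2) w) x"
  have "\<bar>m - cube_mean (r / 2) w x\<bar> \<le> C * (1 + 2 * d) * r powr \<sigma>"
    unfolding m_def
  proof (rule cube_mean_close[OF continuous_cube_mean[OF w]])
    fix y :: 'a assume y: "y \<in> cbox 0 One"
    have "\<bar>cube_mean (r / 2) w (x + r *\<^sub>R y) - cube_mean (r / 2) w x\<bar> \<le> C * (1 + norm (r *\<^sub>R y) / (r / 2)) * (r / 2) powr \<sigma>"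
      using osc[of "r / 2" "x + r *\<^sub>R y" x] r by simp
    also have "\<dots> \<le> C * (1 + 2 * d) * r powr \<sigma>"
      using r C \<sigma> norm_unit_cube[OF y] by (intro mult_mono powr_mono2) (auto simp: d_def)
    finally show "\<bar>cube_mean (r / 2) w (x + r *\<^sub>R y) - cube_mean (r / 2) w x\<bar> \<le> C * (1 + 2 * d) * r powr \<sigma>" .
  qed
  moreover have "\<bar>m - cube_mean r w x\<bar> \<le> C * (1 + d) * r powr \<sigma>"
    unfolding m_def cube_mean_swap[OF w, of r]
  proof (rule cube_mean_close[OF continuous_cube_mean[OF w]])
    fix y :: 'a assume y: "y \<in> cbox 0 One"
    have "\<bar>cube_mean r w (x + (r / 2) *\<^sub>R y) - cube_mean r w x\<bar> \<le> C * (1 + norm ((r / 2) *\<^sub>R y) / r) * r powr \<sigma>"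
      using osc[of r "x + (r / 2) *\<^sub>R y" x] r by simp
    also have "\<dots> \<le> C * (1 + d) * r powr \<sigma>"
      using r C \<sigma> norm_unit_cube[OF y] by (intro mult_mono) (auto simp: d_def)
    finally show "\<bar>cube_mean r w (x + (r / 2) *\<^sub>R y) - cube_mean r w x\<bar> \<le> C * (1 + d) * r powr \<sigma>" .
  qed
  ultimately have "\<bar>cube_mean r w x - cube_mean (r / 2) w x\<bar> \<le> C * (1 + 2 * d) * r powr \<sigma> + C * (1 + d) * r powr \<sigma>"
    by linarith
  then show ?thesis by (simp add: d_def algebra_simps)
qed

text \<open>The differences of consecutive dyadic means are terms of a geometric series with ratio
  \<open>2\<^sup>-\<^sup>\<sigma>\<close>, and the means converge to \<open>w x\<close> by continuity.\<close>

lemma cube_mean_approx: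
  fixes w :: "'a::euclidean_space \<Rightarrow> real"
  assumes w: "continuous_on UNIV w" and C: "C \<ge> 0" and \<sigma>: "\<sigma> > 0" and r: "r > 0"
    and osc: "\<And>r x x'. r > 0 \<Longrightarrow>
        \<bar>cube_mean r w x - cube_mean r w x'\<bar> \<le> C * (1 + norm (x - x') / r) * r powr \<sigma>"
  shows "\<bar>cube_mean r w x - w x\<bar> \<le> C * (2 + 3 * real DIM('a)) / (1 - 2 powr - \<sigma>) * r powr \<sigma>"
proof -
  define B where "B = C * (2 + 3 * real DIM('a))"
  define \<theta> where "\<theta> = 2 powr - \<sigma>"
  have \<theta>: "0 < \<theta>" "\<theta> < 1" using \<sigma> by (auto simp: \<theta>_def powr_less_one)
  have B: "B \<ge> 0" using C by (simp add: B_def)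
  define a where "a n = cube_mean (r / 2 ^ n) w x" for n
  have step: "\<bar>a n - a (Suc n)\<bar> \<le> B * r powr \<sigma> * \<theta> ^ n" for n
  proof -
    have "\<bar>a n - a (Suc n)\<bar> \<le> B * (r / 2 ^ n) powr \<sigma>"
      using cube_mean_halving[OF w C \<sigma> _ osc, of "r / 2 ^ n" x] r
      by (simp add: a_def B_def field_simps)
    also have "(r / 2 ^ n) powr \<sigma> = r powr \<sigma> * \<theta> ^ n"
      using r by (simp add: powr_divide \<theta>_def powr_power powr_minus powr_realpow[symmetric] powr_powr
          field_simps del: powr_realpow)
    finally show ?thesis by (simp add: mult.assoc)
  qed
  have le: "\<bar>a 0 - a n\<bar> \<le> B / (1 - \<theta>) * r powr \<sigma>" for n
  proof -
    have "\<bar>a 0 - a n\<bar> \<le> (\<Sum>k<n. B * r powr \<sigma> * \<theta> ^ k)"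
    proof (induction n)
      case (Suc n) with step[of n] show ?case by simp
    qed simp
    also have "\<dots> = B * r powr \<sigma> * (\<Sum>k<n. \<theta> ^ k)" by (simp add: sum_distrib_left)
    also have "\<dots> \<le> B * r powr \<sigma> * (1 / (1 - \<theta>))"
    proof (rule mult_left_mono)
      show "(\<Sum>k<n. \<theta> ^ k) \<le> 1 / (1 - \<theta>)"
        using \<theta> by (subst geometric_sum) (auto simp: field_simps)
    qed (use B in simp)
    finally show ?thesis by simp
  qed
  have "(\<lambda>n. r / 2 ^ n) \<longlonglongrightarrow> 0"
    using tendsto_mult[OF tendsto_const[of r] LIMSEQ_power_zero[of "1/2::real"]] by (simp add: power_divide)
  then have "a \<longlonglongrightarrow> w x" unfolding a_def[abs_def] by (rule cube_mean_tendsto[OF w])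
  then have "\<bar>a 0 - w x\<bar> \<le> B / (1 - \<theta>) * r powr \<sigma>"
    by (intro LIMSEQ_le_const2[of "\<lambda>n. \<bar>a 0 - a n\<bar>"]) (use le in \<open>auto intro!: tendsto_intros\<close>)
  then show ?thesis by (simp add: a_def B_def \<theta>_def)
qed

section \<open>The estimate for continuous functions\<close>

lemma cube_mean_eq:
  fixes w :: "'a::euclidean_space \<Rightarrow> real"
  assumes w: "continuous_on UNIV w" and r: "r > 0"
  shows "cube_mean r w x = integral (cbox x (x + r *\<^sub>R One)) w / r ^ DIM('a)"
proof -
  have "(w has_integral integral (cbox x (x + r *\<^sub>R One)) w) (cbox x (x + r *\<^sub>R One))"
    by (intro integrable_integral integrable_continuous continuous_on_subset[OF w]) auto
  from has_integral_affinity'[OF this r, of x] show ?thesis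
    using r by (simp add: cube_mean_def add.commute[of _ x] integral_unique field_simps)
qed

lemma measure_cube:
  assumes "r > 0"
  shows "measure lborel (cbox x (x + r *\<^sub>R One :: 'a::euclidean_space)) = r ^ DIM('a)"
    and "0 \<le> s \<Longrightarrow> measure lborel (cbox (t, x) (t + s, x + r *\<^sub>R One :: 'a)) = s * r ^ DIM('a)"
proof -
  show *: "measure lborel (cbox x (x + r *\<^sub>R One :: 'a)) = r ^ DIM('a)"
    using assms by (subst measure_lborel_cbox_eq) (auto simp: inner_add_left)
  assume s: "0 \<le> s"
  have "measure lborel (cbox (t, x) (t + s, x + r *\<^sub>R One :: 'a))
      = measure lborel (cbox t (t + s)) * measure lborel (cbox x (x + r *\<^sub>R One :: 'a))"
    by (rule content_Pair)
  then show "measure lborel (cbox (t, x) (t + s, x + r *\<^sub>R One :: 'a)) = s * r ^ DIM('a)"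
    using s by (simp only: *) simp
qed

text \<open>The functions \<open>g\<close> and \<open>G\<close> are arbitrary weak derivatives of \<open>v\<close> in \<open>L\<^sub>p\<close>, so that they can later
  be chosen as sums of given derivatives of two summands of \<open>v\<close>.\<close>

locale continuous_with_weak_derivatives =
  fixes v g :: "real \<times> (real ^ 'n) \<Rightarrow> real" and G :: "real \<times> (real ^ 'n) \<Rightarrow> real ^ 'n" and \<alpha> p \<sigma> :: real
  assumes \<alpha>: "0 < \<alpha>" "\<alpha> < 1" and p: "1 < p"
    and \<sigma>: "\<sigma> = 1 - (real CARD('n) + 1 / \<alpha>) / p" "0 < \<sigma>"
    and v: "continuous_on ({0..1} \<times> UNIV) v" and v0: "\<And>x. v (0, x) = 0"
    and g: "g \<in> Lp p ({0<..<1} \<times> UNIV)" and frac: "is_frac_dt \<alpha> 1 UNIV v g"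
    and G: "G \<in> Lp p ({0<..<1} \<times> UNIV)" and weak: "is_weak_Dx ({0<..<1} \<times> UNIV) v G"
begin

text \<open>The factor \<open>C1\<close> comes from the oscillation of the means at one scale, \<open>K0\<close> from the sum over the
  dyadic scales.\<close>

definition "M = Lp_norm p ({0<..<1} \<times> UNIV) g + Lp_norm p ({0<..<1} \<times> UNIV) G"
definition "A r t x = cube_mean r (\<lambda>y. v (t, y)) x"
definition "C1 = 2 * time_const \<alpha> p + 1"
definition "K0 = (2 + 3 * real CARD('n)) / (1 - 2 powr - \<sigma>)"

lemma p\<alpha>: "1 / p < \<alpha>"
proof -
  have "(real CARD('n) + 1 / \<alpha>) / p < 1" using \<sigma> by simp
  then have "real CARD('n) + 1 / \<alpha> < p" using p by (simp add: field_simps)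
  then have "1 / \<alpha> < p" by (smt (verit) of_nat_0_le_iff)
  then show ?thesis using \<alpha> p by (simp add: field_simps)
qed

lemma M: "0 \<le> M" "Lp_norm p ({0<..<1} \<times> UNIV) g \<le> M" "Lp_norm p ({0<..<1} \<times> UNIV) G \<le> M"
  by (auto simp: M_def Lp_norm_nonneg)

lemma time_const_nonneg: "0 \<le> time_const \<alpha> p" by (simp add: time_const_def)

lemma v_slice: "t \<in> {0..1} \<Longrightarrow> continuous_on S (\<lambda>y. v (t, y))"
  by (rule continuous_on_compose2[OF v]) (auto intro!: continuous_intros)

text \<open>The factor \<open>r\<^sup>-\<^sup>d\<^sup>/\<^sup>p\<close> is the measure of the cube to the power \<open>1 - 1/p\<close>, divided by the measure
  itself.\<close>

lemma mean_time:
  assumes r: "r > 0" and st: "0 \<le> s" "0 \<le> t" "s \<le> 1" "t \<le> 1"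
  shows "\<bar>A r t x - A r s x\<bar> \<le> time_const \<alpha> p * M * \<bar>t - s\<bar> powr (\<alpha> - 1 / p) * r powr (- real CARD('n) / p)"
proof -
  have *: "\<bar>A r t x - A r s x\<bar> \<le> time_const \<alpha> p * M * (t - s) powr (\<alpha> - 1 / p) * r powr (- real CARD('n) / p)"
    if st: "0 \<le> s" "s \<le> t" "t \<le> 1" for s t
  proof -
    define V where "V s = integral (cbox x (x + r *\<^sub>R One)) (\<lambda>y. v (s, y))" for s
    have rd: "r ^ CARD('n) = r powr real CARD('n)" using r by (simp add: powr_realpow)
    have "\<bar>V t - V s\<bar> \<le> time_const \<alpha> p * Lp_norm p ({0<..<1} \<times> UNIV) g * (t - s) powr (\<alpha> - 1 / p)
      * (r ^ CARD('n)) powr (1 - 1 / p)"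
      using time_hoelder[OF \<alpha> p p\<alpha> v g frac st, of x "x + r *\<^sub>R One"] measure_cube(1)[OF r, of x]
      by (simp add: V_def)
    also have "\<dots> \<le> time_const \<alpha> p * M * (t - s) powr (\<alpha> - 1 / p) * (r ^ CARD('n)) powr (1 - 1 / p)"
      using M by (intro mult_right_mono mult_left_mono time_const_nonneg) auto
    finally have "\<bar>V t - V s\<bar> / r ^ CARD('n) \<le> time_const \<alpha> p * M * (t - s) powr (\<alpha> - 1 / p) * (r ^ CARD('n)) powr (1 - 1 / p) / r ^ CARD('n)"
      using r by (intro divide_right_mono) auto
    also have "\<dots> = time_const \<alpha> p * M * (t - s) powr (\<alpha> - 1 / p) * ((r ^ CARD('n)) powr (1 - 1 / p) / r ^ CARD('n))" by simp
    also have "(r ^ CARD('n)) powr (1 - 1 / p) / r ^ CARD('n) = r powr (- real CARD('n) / p)"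
      unfolding rd powr_powr using r by (simp add: algebra_simps flip: powr_diff)
    also have "\<bar>V t - V s\<bar> / r ^ CARD('n) = \<bar>A r t x - A r s x\<bar>"
      using cube_mean_eq[OF v_slice r, of t x] cube_mean_eq[OF v_slice r, of s x] st r
      by (simp add: A_def V_def flip: diff_divide_distrib)
    finally show ?thesis .
  qed
  show ?thesis
  proof (cases "s \<le> t")
    case True then show ?thesis using *[of s t] st by simp
  next
    case False then show ?thesis using *[of t s] st by (simp add: abs_minus_commute)
  qed
qed

lemma mean_zero: "A r 0 x = 0"
  by (simp add: A_def cube_mean_def v0)

text \<open>The exponents for the time scale \<open>\<tau> = r\<^sup>1\<^sup>/\<^sup>\<alpha>\<close>; this is where \<open>\<sigma>\<close> comes from.\<close>

lemma scaling:
  assumes r: "r > 0"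
  shows "(r powr (1 / \<alpha>)) powr (\<alpha> - 1 / p) * r powr (- real CARD('n) / p) = r powr \<sigma>"
    and "(r powr (1 / \<alpha>)) powr (- 1 / p) * r powr (- real CARD('n) / p) = r powr \<sigma> / r"
proof -
  have "1 / \<alpha> * (\<alpha> - 1 / p) + - real CARD('n) / p = \<sigma>" using \<alpha> p by (simp add: \<sigma> field_simps)
  then show "(r powr (1 / \<alpha>)) powr (\<alpha> - 1 / p) * r powr (- real CARD('n) / p) = r powr \<sigma>"
    by (simp only: powr_powr flip: powr_add)
  have "1 / \<alpha> * (- 1 / p) + - real CARD('n) / p = \<sigma> - 1" using \<alpha> p by (simp add: \<sigma> field_simps)
  then have "(r powr (1 / \<alpha>)) powr (- 1 / p) * r powr (- real CARD('n) / p) = r powr (\<sigma> - 1)"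
    by (simp only: powr_powr flip: powr_add)
  then show "(r powr (1 / \<alpha>)) powr (- 1 / p) * r powr (- real CARD('n) / p) = r powr \<sigma> / r"
    using r by (simp add: powr_diff)
qed

text \<open>Replace \<open>A r t\<close> by its mean over the time interval \<open>[t - \<tau>, t]\<close> with \<open>\<tau> = r\<^sup>1\<^sup>/\<^sup>\<alpha>\<close>; the time
  estimate bounds the error by a multiple of \<open>r\<^sup>\<sigma>\<close>.  The mean is an integral over a space-time box, to
  which \<open>translation_estimate\<close> applies.  The interval is cut off at time \<open>0\<close>, which amounts to extending
  \<open>v\<close> by its initial value \<open>0\<close> to negative times and makes all scales \<open>r > 0\<close> admissible.\<close>

lemma mean_oscillation:
  assumes r: "r > 0" and t: "0 < t" "t \<le> 1"
  shows "\<bar>A r t x - A r t x'\<bar> \<le> C1 * M * (1 + norm (x - x') / r) * r powr \<sigma>"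
proof -
  define \<tau> where "\<tau> = r powr (1 / \<alpha>)"
  define s0 where "s0 = max 0 (t - \<tau>)"
  define E where "E = time_const \<alpha> p * M * r powr \<sigma>"
  have \<tau>: "\<tau> > 0" using r by (simp add: \<tau>_def)
  have s0: "0 \<le> s0" "s0 < t" "t - s0 \<le> \<tau>" using t \<tau> by (auto simp: s0_def)
  have e: "0 \<le> \<alpha> - 1 / p" using p\<alpha> by simp
  have E: "E \<ge> 0" using M time_const_nonneg by (simp add: E_def)
  have close: "\<bar>A r t x - A r s x\<bar> \<le> E" if "0 \<le> s" "s \<le> t" "t - s \<le> \<tau>" for s x
  proof -
    have "\<bar>A r t x - A r s x\<bar> \<le> time_const \<alpha> p * M * \<bar>t - s\<bar> powr (\<alpha> - 1 / p) * r powr (- real CARD('n) / p)"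
      using mean_time[OF r, of s t x] that t by simp
    also have "\<dots> \<le> time_const \<alpha> p * M * \<tau> powr (\<alpha> - 1 / p) * r powr (- real CARD('n) / p)"
      using that e M time_const_nonneg by (intro mult_right_mono mult_left_mono powr_mono2) auto
    also have "\<dots> = E" using scaling(1)[OF r] by (simp add: E_def \<tau>_def mult.assoc)
    finally show ?thesis .
  qed
  define J where "J x = integral {s0..t} (\<lambda>s. A r s x)" for x
  have V: "A r s x = integral (cbox x (x + r *\<^sub>R One)) (\<lambda>y. v (s, y)) / r ^ CARD('n)" if "s \<in> {0..1}" for s x
    using cube_mean_eq[OF v_slice[OF that] r, of x] by (simp add: A_def)
  have contA: "continuous_on {s0..t} (\<lambda>s. A r s x)" for x
  proof -
    have "continuous_on {s0..t} (\<lambda>s. integral (cbox x (x + r *\<^sub>R One)) (\<lambda>y. v (s, y)) / r ^ CARD('n))"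
      by (intro continuous_on_divide continuous_on_const integral_continuous_on_param)
        (use r s0 t in \<open>auto intro!: continuous_on_subset[OF v]\<close>)
    then show ?thesis by (rule continuous_on_eq) (use V s0 t in auto)
  qed
  have mean: "\<bar>\<tau> * A r t x - J x\<bar> \<le> \<tau> * E" for x
  proof -
    have "integral {s0..t} (\<lambda>s. A r t x - A r s x) = (t - s0) * A r t x - J x"
      using contA[of x] s0 by (simp add: J_def integral_diff integrable_continuous_interval)
    moreover have "norm (integral (cbox s0 t) (\<lambda>s. A r t x - A r s x)) \<le> E * measure lborel (cbox s0 t)"
      using close s0 contA[of x] E
      by (intro integrable_bound integrable_continuous continuous_intros) (auto simp: s0_def)
    ultimately have 1: "\<bar>(t - s0) * A r t x - J x\<bar> \<le> E * (t - s0)" using s0 by simp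
    \<comment> \<open>If the interval is cut off, then its missing part carries the value at time 0, which is 0.\<close>
    have "\<bar>(\<tau> - (t - s0)) * A r t x\<bar> \<le> (\<tau> - (t - s0)) * E"
    proof (cases "t - \<tau> \<ge> 0")
      case True then show ?thesis by (simp add: s0_def)
    next
      case False
      then have "\<bar>A r t x\<bar> \<le> E" using close[of 0 x] t by (simp add: mean_zero)
      then show ?thesis using s0 by (simp add: abs_mult mult_left_mono)
    qed
    with 1 have "\<bar>((t - s0) * A r t x - J x) + (\<tau> - (t - s0)) * A r t x\<bar> \<le> E * (t - s0) + (\<tau> - (t - s0)) * E"
      by linarith
    then show ?thesis by (simp add: algebra_simps)
  qed
  have Jeq: "J x = integral (cbox (s0, x) (t, x + r *\<^sub>R One)) v / r ^ CARD('n)" for x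
  proof -
    have "continuous_on (cbox (s0, x) (t, x + r *\<^sub>R One)) (\<lambda>(s, y). v (s, y))"
      using s0 t by (auto simp: cbox_Pair_eq intro!: continuous_on_subset[OF v])
    from integral_prod_continuous[OF this]
    have "integral (cbox (s0, x) (t, x + r *\<^sub>R One)) v
      = integral {s0..t} (\<lambda>s. integral (cbox x (x + r *\<^sub>R One)) (\<lambda>y. v (s, y)))" by simp
    also have "\<dots> / r ^ CARD('n) = integral {s0..t} (\<lambda>s. integral (cbox x (x + r *\<^sub>R One)) (\<lambda>y. v (s, y)) / r ^ CARD('n))"
      by simp
    also have "\<dots> = J x" unfolding J_def
      by (rule Henstock_Kurzweil_Integration.integral_cong) (use V s0 t in auto)
    finally show ?thesis by simp
  qed
  define h where "h = x - x'"
  define m where "m = (t - s0) * r ^ CARD('n)"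
  have "\<bar>integral (cbox (s0, x' + h) (t, x' + r *\<^sub>R One + h)) v - integral (cbox (s0, x') (t, x' + r *\<^sub>R One)) v\<bar>
      \<le> norm h * Lp_norm p ({0<..<1} \<times> UNIV) G * measure lebesgue (cbox (s0, x') (t, x' + r *\<^sub>R One)) powr (1 - 1 / p)"
    by (rule translation_estimate[OF p v G weak s0(1) t(2)])
  also have "measure lebesgue (cbox (s0, x') (t, x' + r *\<^sub>R One)) = m"
    using measure_cube(2)[OF r, of "t - s0" s0 x'] s0 by (simp add: m_def)
  also have "x' + r *\<^sub>R One + h = x + r *\<^sub>R One" by (simp add: h_def)
  also have "x' + h = x" by (simp add: h_def)
  finally have "\<bar>J x - J x'\<bar> \<le> norm h * Lp_norm p ({0<..<1} \<times> UNIV) G * m powr (1 - 1 / p) / r ^ CARD('n)"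
    using r by (simp add: Jeq divide_right_mono flip: diff_divide_distrib)
  also have "\<dots> \<le> norm h * M * (\<tau> * r ^ CARD('n)) powr (1 - 1 / p) / r ^ CARD('n)"
    using r s0 M p by (intro divide_right_mono mult_mono powr_mono2) (auto simp: m_def Lp_norm_nonneg)
  also have "\<dots> = norm h * M * (\<tau> * (\<tau> powr (- 1 / p) * r powr (- real CARD('n) / p)))"
  proof -
    have rd: "r ^ CARD('n) = r powr real CARD('n)" using r by (simp add: powr_realpow)
    have 1: "(r ^ CARD('n)) powr (1 - 1 / p) / r ^ CARD('n) = r powr (- real CARD('n) / p)"
      unfolding rd powr_powr using r by (simp add: algebra_simps flip: powr_diff)
    have 2: "\<tau> powr (1 - 1 / p) = \<tau> * \<tau> powr (- 1 / p)"
      using \<tau> powr_add[of \<tau> 1 "- 1 / p"] by simp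
    have "norm h * M * (\<tau> * r ^ CARD('n)) powr (1 - 1 / p) / r ^ CARD('n)
      = norm h * M * (\<tau> powr (1 - 1 / p) * ((r ^ CARD('n)) powr (1 - 1 / p) / r ^ CARD('n)))"
      by (simp add: powr_mult)
    then show ?thesis unfolding 1 2 by (simp only: mult.assoc)
  qed
  also have "\<dots> = \<tau> * (M * (norm h / r) * r powr \<sigma>)"
    using scaling(2)[OF r] by (simp add: \<tau>_def)
  finally have JJ: "\<bar>J x - J x'\<bar> \<le> \<tau> * (M * (norm h / r) * r powr \<sigma>)" .
  have "\<tau> * \<bar>A r t x - A r t x'\<bar> = \<bar>\<tau> * A r t x - \<tau> * A r t x'\<bar>"
    using \<tau> by (simp add: abs_mult flip: right_diff_distrib)
  also have "\<dots> \<le> \<tau> * E + \<tau> * (M * (norm h / r) * r powr \<sigma>) + \<tau> * E"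
    using mean[of x] mean[of x'] JJ by linarith
  finally have "\<tau> * \<bar>A r t x - A r t x'\<bar> \<le> \<tau> * (2 * E + M * (norm h / r) * r powr \<sigma>)"
    by (simp add: algebra_simps)
  then have "\<bar>A r t x - A r t x'\<bar> \<le> 2 * E + M * (norm h / r) * r powr \<sigma>"
    using \<tau> by simp
  also have "\<dots> = (2 * time_const \<alpha> p * 1 + 1 * (norm h / r)) * (M * r powr \<sigma>)"
    by (simp add: E_def algebra_simps)
  also have "\<dots> \<le> (C1 * 1 + C1 * (norm h / r)) * (M * r powr \<sigma>)"
    using M r time_const_nonneg
    by (intro mult_right_mono add_mono) (auto simp: C1_def)
  also have "\<dots> = C1 * M * (1 + norm (x - x') / r) * r powr \<sigma>"
    by (simp add: h_def algebra_simps)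
  finally show ?thesis .
qed

lemma C1_nonneg: "C1 \<ge> 0" using time_const_nonneg by (simp add: C1_def)

lemma mean_approx:
  assumes r: "r > 0" and t: "0 < t" "t \<le> 1"
  shows "\<bar>A r t x - v (t, x)\<bar> \<le> C1 * M * K0 * r powr \<sigma>"
  using cube_mean_approx[of "\<lambda>y. v (t, y)" "C1 * M" \<sigma> r x] v_slice[of t UNIV] t r \<sigma>(2)
    mult_nonneg_nonneg[OF C1_nonneg M(1)] mean_oscillation[OF _ t]
  by (simp add: A_def K0_def)

text \<open>Go from \<open>(t, x)\<close> to \<open>(t, y)\<close> through means at scale \<open>r = |x - y|\<close>, and from \<open>(t, y)\<close> to
  \<open>(s, y)\<close> through means at scale \<open>r = |t - s|\<^sup>\<alpha>\<close>.\<close>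

lemma hoelder_estimate:
  assumes "0 < t" "t \<le> 1" "0 < s" "s \<le> 1"
  shows "\<bar>v (t, x) - v (s, y)\<bar> \<le> C1 * (2 * K0 + 2) * M * (\<bar>t - s\<bar> powr (\<sigma> * \<alpha>) + norm (x - y) powr \<sigma>)"
proof -
  have space: "\<bar>v (t, x) - v (t, y)\<bar> \<le> C1 * (2 * K0 + 2) * M * norm (x - y) powr \<sigma>"
  proof (cases "x = y")
    case False
    define r where "r = norm (x - y)"
    have r: "r > 0" using False by (simp add: r_def)
    have "\<bar>v (t, x) - v (t, y)\<bar> \<le> C1 * M * K0 * r powr \<sigma> + C1 * M * (1 + norm (x - y) / r) * r powr \<sigma> + C1 * M * K0 * r powr \<sigma>"
      using mean_approx[OF r assms(1,2), of x] mean_approx[OF r assms(1,2), of y] mean_oscillation[OF r assms(1,2), of x y]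
      by linarith
    also have "norm (x - y) / r = 1" using r by (simp add: r_def)
    finally show ?thesis by (simp add: r_def algebra_simps)
  qed simp
  have time: "\<bar>v (t, y) - v (s, y)\<bar> \<le> C1 * (2 * K0 + 2) * M * \<bar>t - s\<bar> powr (\<sigma> * \<alpha>)"
  proof (cases "s = t")
    case False
    define r where "r = \<bar>t - s\<bar> powr \<alpha>"
    have r: "r > 0" using False by (simp add: r_def)
    have r\<alpha>: "r powr (1 / \<alpha>) = \<bar>t - s\<bar>" using \<alpha> by (simp add: r_def powr_powr)
    have "\<bar>A r t y - A r s y\<bar> \<le> time_const \<alpha> p * M * \<bar>t - s\<bar> powr (\<alpha> - 1 / p) * r powr (- real CARD('n) / p)"
      using assms by (intro mean_time[OF r]) auto
    also have "\<dots> = time_const \<alpha> p * M * r powr \<sigma>"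
      using scaling(1)[OF r] by (simp add: r\<alpha> mult.assoc)
    also have "\<dots> \<le> C1 * 2 * M * r powr \<sigma>"
      using M time_const_nonneg by (intro mult_right_mono) (auto simp: C1_def)
    finally have "\<bar>v (t, y) - v (s, y)\<bar> \<le> C1 * M * K0 * r powr \<sigma> + C1 * 2 * M * r powr \<sigma> + C1 * M * K0 * r powr \<sigma>"
      using mean_approx[OF r assms(1,2), of y] mean_approx[OF r assms(3,4), of y] by linarith
    also have "r powr \<sigma> = \<bar>t - s\<bar> powr (\<sigma> * \<alpha>)" by (simp add: r_def powr_powr mult.commute)
    finally show ?thesis by (simp add: algebra_simps)
  qed simp
  show ?thesis using space time by (simp add: distrib_left)
qed

end

section \<open>Linearity of the weak derivatives\<close>

lemma compact_support_bounded_measurable: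
  fixes \<psi> :: "'a::euclidean_space \<Rightarrow> real"
  assumes c: "continuous_on D \<psi>" and K: "compact K" "K \<subseteq> D" and z: "\<And>z. z \<in> S - K \<Longrightarrow> \<psi> z = 0"
    and S: "S \<subseteq> D" "S \<in> sets lebesgue"
  obtains C where "\<psi> \<in> borel_measurable (lebesgue_on S)" "\<And>z. z \<in> S \<Longrightarrow> \<bar>\<psi> z\<bar> \<le> C"
proof -
  have "compact (\<psi> ` K)" by (rule compact_continuous_image[OF continuous_on_subset[OF c K(2)] K(1)])
  then obtain C where C: "\<forall>x\<in>\<psi> ` K. norm x \<le> C" using compact_imp_bounded bounded_iff by metis
  have "\<psi> \<in> borel_measurable (lebesgue_on S)"
    by (rule continuous_imp_measurable_on_sets_lebesgue[OF continuous_on_subset[OF c S(1)] S(2)])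
  moreover have "\<bar>\<psi> z\<bar> \<le> max C 0" if "z \<in> S" for z
    using C z[of z] that by (cases "z \<in> K") force+
  ultimately show thesis by (rule that)
qed

text \<open>A derivative of \<open>\<phi>\<close> within \<open>D\<close> is continuous up to the part of the boundary that belongs to \<open>D\<close>; on
  the open set \<open>S\<close> it is the ordinary derivative, and it vanishes off the support.\<close>

lemma test_function_derivative:
  fixes D S :: "'a::euclidean_space set"
  assumes \<phi>: "\<phi> \<in> C0_infty D" and S: "open S" "S \<subseteq> D"
  obtains \<phi>' K where "compact K" "K \<subseteq> D" "\<And>v. continuous_on D (\<lambda>z. \<phi>' z v)"
    "\<And>z. z \<in> S \<Longrightarrow> (\<phi> has_derivative \<phi>' z) (at z)" "continuous_on D \<phi>"
    "\<And>z. z \<in> D - K \<Longrightarrow> \<phi> z = 0" "\<And>z v. z \<in> S - K \<Longrightarrow> \<phi>' z v = 0"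
proof -
  from \<phi> have "Ck_on 1 D \<phi>" "Ck_on 0 D \<phi>" by (auto simp: C0_infty_def C_infty_def)
  then obtain \<phi>' where \<phi>': "\<And>z. z \<in> D \<Longrightarrow> (\<phi> has_derivative \<phi>' z) (at z within D)"
    "\<And>v. continuous_on D (\<lambda>z. \<phi>' z v)" "continuous_on D \<phi>" by auto
  from \<phi> obtain K where K: "compact K" "K \<subseteq> D" "\<And>z. z \<in> D - K \<Longrightarrow> \<phi> z = 0"
    by (auto simp: C0_infty_def)
  have d: "(\<phi> has_derivative \<phi>' z) (at z)" if "z \<in> S" for z
  proof -
    have "(\<phi> has_derivative \<phi>' z) (at z within S)"
      using \<phi>'(1)[of z] that S by (blast intro: has_derivative_subset)
    then show ?thesis using at_within_open[OF that S(1)] by simp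
  qed
  have "\<phi>' z v = 0" if "z \<in> S - K" for z v
  proof -
    have o: "open (S - K)" using S K(1) by (simp add: open_Diff compact_imp_closed)
    have "((\<lambda>_. 0) has_derivative (\<lambda>_. 0)) (at z)" by simp
    then have "(\<phi> has_derivative (\<lambda>_. 0)) (at z)"
      by (rule has_derivative_transform_within_open[OF _ o that]) (use K(3) S in auto)
    then have "\<phi>' z = (\<lambda>_. 0)" using d[of z] that has_derivative_unique by blast
    then show ?thesis by simp
  qed
  then show thesis using that[OF K(1,2) \<phi>'(2) d \<phi>'(3) K(3)] by blast
qed

lemma is_weak_Dx_integrable:
  fixes u :: "real \<times> (real ^ 'n) \<Rightarrow> real"
  assumes p: "1 < p" and D: "open D" and u: "u \<in> Lp p D" and G: "G \<in> Lp p D" and \<phi>: "\<phi> \<in> C0_infty D"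
  shows "integrable (lebesgue_on D) (\<lambda>z. G z $ i * \<phi> z)"
    and "integrable (lebesgue_on D) (\<lambda>z. u z * partial_x i \<phi> z)"
proof -
  have Dm: "D \<in> sets lebesgue" using D by (simp add: borel_open sets_completionI_sets)
  obtain \<phi>' K where \<phi>': "compact K" "K \<subseteq> D" "\<And>v. continuous_on D (\<lambda>z. \<phi>' z v)"
    "\<And>z. z \<in> D \<Longrightarrow> (\<phi> has_derivative \<phi>' z) (at z)" "continuous_on D \<phi>"
    "\<And>z. z \<in> D - K \<Longrightarrow> \<phi> z = 0" "\<And>z v. z \<in> D - K \<Longrightarrow> \<phi>' z v = 0"
    by (rule test_function_derivative[OF \<phi> D order_refl]) (rule that)
  obtain C where C: "\<phi> \<in> borel_measurable (lebesgue_on D)" "\<And>z. z \<in> D \<Longrightarrow> \<bar>\<phi> z\<bar> \<le> C"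
    by (rule compact_support_bounded_measurable[OF \<phi>'(5,1,2,6) order_refl Dm]) (assumption | rule that)+
  have "integrable (lebesgue_on D) (\<lambda>z. \<phi> z *\<^sub>R (axis i 1 \<bullet> G z))"
    by (rule Lp_imp_integrable_bounded_support[OF p Dm Lp_inner(1)[OF p G] \<phi>'(1) C \<phi>'(6)])
  then show "integrable (lebesgue_on D) (\<lambda>z. G z $ i * \<phi> z)" by (simp add: inner_axis' mult.commute)
  have px: "partial_x i \<phi> z = \<phi>' z (0, axis i 1)" if "z \<in> D" for z
    by (rule partial_x_eq[OF \<phi>'(4)[OF that]])
  obtain C' where C': "(\<lambda>z. \<phi>' z (0, axis i 1)) \<in> borel_measurable (lebesgue_on D)"
    "\<And>z. z \<in> D \<Longrightarrow> \<bar>\<phi>' z (0, axis i 1)\<bar> \<le> C'"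
    by (rule compact_support_bounded_measurable[OF \<phi>'(3,1,2,7) order_refl Dm, of "(0, axis i 1)"]) (assumption | rule that)+
  have "integrable (lebesgue_on D) (\<lambda>z. \<phi>' z (0, axis i 1) *\<^sub>R u z)"
    by (rule Lp_imp_integrable_bounded_support[OF p Dm u \<phi>'(1) C' \<phi>'(7)])
  also have "?this \<longleftrightarrow> integrable (lebesgue_on D) (\<lambda>z. u z * partial_x i \<phi> z)"
    by (rule Bochner_Integration.integrable_cong[OF refl]) (auto simp: px space_restrict_space)
  finally show "integrable (lebesgue_on D) (\<lambda>z. u z * partial_x i \<phi> z)" .
qed

lemma is_weak_Dx_add:
  fixes u v :: "real \<times> (real ^ 'n) \<Rightarrow> real"
  assumes p: "1 < p" and D: "open D"
    and u: "u \<in> Lp p D" "G \<in> Lp p D" "is_weak_Dx D u G"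
    and v: "v \<in> Lp p D" "H \<in> Lp p D" "is_weak_Dx D v H"
  shows "is_weak_Dx D (\<lambda>z. u z + v z) (\<lambda>z. G z + H z)"
  unfolding is_weak_Dx_def
proof (intro ballI allI)
  fix \<phi> i assume \<phi>: "\<phi> \<in> C0_infty D"
  note I = is_weak_Dx_integrable[OF p D u(1,2) \<phi>, of i] is_weak_Dx_integrable[OF p D v(1,2) \<phi>, of i]
  have "(\<integral>z. G z $ i * \<phi> z \<partial>lebesgue_on D) = - (\<integral>z. u z * partial_x i \<phi> z \<partial>lebesgue_on D)"
    "(\<integral>z. H z $ i * \<phi> z \<partial>lebesgue_on D) = - (\<integral>z. v z * partial_x i \<phi> z \<partial>lebesgue_on D)"
    using u(3) v(3) \<phi> by (auto simp: is_weak_Dx_def)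
  then show "(\<integral>z. (G z + H z) $ i * \<phi> z \<partial>lebesgue_on D)
      = - (\<integral>z. (u z + v z) * partial_x i \<phi> z \<partial>lebesgue_on D)"
    using I by (simp add: distrib_right)
qed

lemma is_weak_Dx_minus:
  "is_weak_Dx D u G \<Longrightarrow> is_weak_Dx D (\<lambda>z. - u z) (\<lambda>z. - G z)"
  by (simp add: is_weak_Dx_def)

text \<open>For almost every \<open>x\<close> the slices of \<open>u\<close> and of its Borel representative agree at almost every
  time, so that their fractional integrals agree at all times.\<close>

lemma frac_int_representative:
  fixes u u' :: "real \<times> (real ^ 'n) \<Rightarrow> real"
  assumes u'm: "u' \<in> borel_measurable borel"
    and ae: "AE z in lborel. fst z \<in> {0<..<1} \<longrightarrow> u' z = u z"
  shows "AE z in lborel. fst z \<in> {0<..<1} \<longrightarrow>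
     frac_int \<alpha> u z = (\<integral>s. RL_ker (1 - \<alpha>) (fst z - s) * (indicator {0<..<1} s * u' (s, snd z)) \<partial>lborel)"
proof -
  from ae obtain N where N: "\<And>z. z \<notin> N \<Longrightarrow> fst z \<in> {0<..<1} \<Longrightarrow> u' z = u z" "N \<in> null_sets lborel"
    by (elim AE_E3) auto
  then have Ns: "N \<in> null_sets (lborel \<Otimes>\<^sub>M lborel)" by (simp add: lborel_prod)
  have "AE z in lborel \<Otimes>\<^sub>M lborel. z \<notin> N" using Ns by (rule AE_not_in)
  from lborel_pair.AE_pair[OF this] have "AE s in lborel. AE y in lborel. (s, y) \<notin> N" .
  also have "?this \<longleftrightarrow> (AE y in lborel. AE s in lborel. (s, y) \<notin> N)"
  proof (rule lborel_pair.AE_commute)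
    have "{x \<in> space (lborel \<Otimes>\<^sub>M lborel). (fst x, snd x) \<notin> N} = space (lborel \<Otimes>\<^sub>M lborel) - N" by auto
    also have "\<dots> \<in> sets (lborel \<Otimes>\<^sub>M lborel)" using Ns by (intro sets.compl_sets null_setsD2)
    finally show "{x \<in> space (lborel \<Otimes>\<^sub>M lborel). (fst x, snd x) \<notin> N} \<in> sets (lborel \<Otimes>\<^sub>M lborel)" .
  qed
  finally obtain N2 where N2: "\<And>y. y \<notin> N2 \<Longrightarrow> (AE s in lborel. (s, y) \<notin> N)" "N2 \<in> null_sets lborel"
    by (elim AE_E3) auto
  have "AE z in (lborel :: real measure) \<Otimes>\<^sub>M lborel. snd z \<notin> N2"
  proof (rule lborel_pair.AE_pair_measure)
    have "{x \<in> space ((lborel :: real measure) \<Otimes>\<^sub>M lborel). snd x \<notin> N2} = space lborel \<times> (space lborel - N2)"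
      by (auto simp: space_pair_measure)
    also have "\<dots> \<in> sets ((lborel :: real measure) \<Otimes>\<^sub>M lborel)"
      by (rule pair_measureI[OF sets.top sets.compl_sets[OF null_setsD2[OF N2(2)]]])
    finally show "{x \<in> space ((lborel :: real measure) \<Otimes>\<^sub>M lborel). snd x \<notin> N2} \<in> sets ((lborel :: real measure) \<Otimes>\<^sub>M lborel)" .
    show "AE x in (lborel :: real measure). AE y in lborel. snd (x, y) \<notin> N2"
      using AE_not_in[OF N2(2)] by simp
  qed
  then have "AE z in (lborel :: (real \<times> (real ^ 'n)) measure). snd z \<notin> N2" unfolding lborel_prod .
  then show ?thesis
  proof (rule eventually_mono, intro impI)
    fix z :: "real \<times> (real ^ 'n)" assume y: "snd z \<notin> N2" and t: "fst z \<in> {0<..<1}"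
    define t y where "t = fst z" and "y = snd z"
    have tt: "0 < t" "t < 1" and z: "z = (t, y)" using t by (auto simp: t_def y_def)
    define k where "k s = 1 / Gamma (1 - \<alpha>) * (indicator {0<..<t} s * (t - s) powr (- \<alpha>))" for s
    have km [measurable]: "k \<in> borel_measurable borel" unfolding k_def[abs_def] by measurable
    have u'y [measurable]: "(\<lambda>s. u' (s, y)) \<in> borel_measurable borel"
      using measurable_compose[OF _ u'm, of "\<lambda>s. (s, y)" borel] by (simp add: borel_prod[symmetric])
    have "AE s in lborel. k s * u' (s, y) = k s * u (s, y)"
      using N2(1)[OF y[folded y_def]]
    proof (rule eventually_mono)
      fix s assume "(s, y) \<notin> N"
      then show "k s * u' (s, y) = k s * u (s, y)"
        using N(1)[of "(s, y)"] tt by (cases "s \<in> {0<..<t}") (auto simp: k_def)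
    qed
    then have aeL: "AE s in lebesgue. k s * u' (s, y) = k s * u (s, y)" by (rule AE_completion)
    have m1: "(\<lambda>s. k s * u' (s, y)) \<in> borel_measurable lborel" by measurable
    then have m2: "(\<lambda>s. k s * u' (s, y)) \<in> borel_measurable lebesgue" by (rule measurable_completion)
    have m3: "(\<lambda>s. k s * u (s, y)) \<in> borel_measurable lebesgue" by (rule borel_measurable_AE[OF m2 aeL])
    have "frac_int \<alpha> u z = 1 / Gamma (1 - \<alpha>) * (\<integral>s. indicator {0<..<t} s *\<^sub>R ((t - s) powr (- \<alpha>) * u (s, y)) \<partial>lebesgue)"
      unfolding frac_int_def z by (subst integral_restrict_space) auto
    also have "\<dots> = (\<integral>s. k s * u (s, y) \<partial>lebesgue)"
      by (simp add: k_def mult_ac flip: integral_mult_right_zero)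
    also have "\<dots> = (\<integral>s. k s * u' (s, y) \<partial>lebesgue)"
      by (rule integral_cong_AE[OF m2 m3 aeL, symmetric])
    also have "\<dots> = (\<integral>s. k s * u' (s, y) \<partial>lborel)" by (rule integral_completion[OF m1])
    also have "\<dots> = (\<integral>s. RL_ker (1 - \<alpha>) (t - s) * (indicator {0<..<1} s * u' (s, y)) \<partial>lborel)"
      using tt by (intro Bochner_Integration.integral_cong) (auto simp: k_def RL_ker_def split: split_indicator)
    finally show "frac_int \<alpha> u z = (\<integral>s. RL_ker (1 - \<alpha>) (fst z - s) * (indicator {0<..<1} s * u' (s, snd z)) \<partial>lborel)"
      by (simp add: t_def y_def)
  qed
qed

text \<open>Tonelli's theorem: for fixed \<open>s\<close> the kernel has a bounded integral over \<open>t \<in> (0, 1)\<close>, and \<open>u\<close> is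
  integrable over \<open>(0, 1)\<close> times the box.\<close>

lemma frac_int_locally_integrable:
  fixes u :: "real \<times> 'a::euclidean_space \<Rightarrow> real"
  assumes \<alpha>: "0 < \<alpha>" "\<alpha> < 1" and um [measurable]: "u \<in> borel_measurable borel"
    and ui: "integrable lborel (\<lambda>z. indicator (cbox a b) (snd z) * u z)"
  defines "w \<equiv> (\<lambda>z. \<integral>s. RL_ker (1 - \<alpha>) (fst z - s) * (indicator {0<..<1} s * u (s, snd z)) \<partial>lborel)"
  shows "AE z in lborel. fst z \<in> {0<..<1} \<longrightarrow> snd z \<in> cbox a b \<longrightarrow>
           integrable lborel (\<lambda>s. RL_ker (1 - \<alpha>) (fst z - s) * (indicator {0<..<1} s * u (s, snd z)))"
    and "integrable lborel (\<lambda>z. indicator {0<..<1} (fst z) * (indicator (cbox a b) (snd z) * w z))"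
proof -
  have um' [measurable]: "u \<in> borel_measurable (borel \<Otimes>\<^sub>M borel)" using um by (simp add: borel_prod)
  have wm: "w \<in> borel_measurable (borel \<Otimes>\<^sub>M borel)" unfolding w_def by measurable
  define I :: "'a \<Rightarrow> ennreal" where "I = indicator (cbox a b)"
  define J :: "real \<Rightarrow> ennreal" where "J = indicator {0<..<1}"
  have [measurable]: "I \<in> borel_measurable borel" "J \<in> borel_measurable borel"
    unfolding I_def J_def by measurable
  define F where "F t y s = ennreal (RL_ker (1 - \<alpha>) (t - s)) * (J s * ennreal \<bar>u (s, y)\<bar>)" for t y s
  define X where "X z = J (fst z) * (I (snd z) * (\<integral>\<^sup>+s. F (fst z) (snd z) s \<partial>lborel))" for z
  have Xm: "X \<in> borel_measurable (borel \<Otimes>\<^sub>M borel)" unfolding X_def[abs_def] F_def by measurable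
  have RL_ker0: "0 \<le> RL_ker (1 - \<alpha>) s" for s using \<alpha> by (intro RL_ker_nonneg) auto
  have nF: "ennreal (norm (RL_ker (1 - \<alpha>) (t - s) * (indicator {0<..<1} s * u (s, y)))) = F t y s" for t s y
    using RL_ker0 by (auto simp: F_def J_def abs_mult ennreal_mult' split: split_indicator)
  define c where "c = 1 / Gamma (2 - \<alpha>)"
  have c: "c \<ge> 0" using \<alpha> by (simp add: c_def Gamma_real_pos less_imp_le)
  have inner: "(\<integral>\<^sup>+t. J t * ennreal (RL_ker (1 - \<alpha>) (t - s)) \<partial>lborel) * J s \<le> ennreal c" for s
  proof (cases "s \<in> {0<..<1}")
    case True
    have "(\<integral>\<^sup>+t. J t * ennreal (RL_ker (1 - \<alpha>) (t - s)) \<partial>lborel) \<le> (\<integral>\<^sup>+t. ennreal (RL_ker 1 (1 - t) * RL_ker (1 - \<alpha>) (t - s)) \<partial>lborel)"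
      by (intro nn_integral_mono) (auto simp: J_def RL_ker_def[of 1] split: split_indicator)
    also have "\<dots> = ennreal (RL_ker (2 - \<alpha>) (1 - s))"
      using nn_integral_RL_ker_convolution[of 1 "1 - \<alpha>" 1 s] \<alpha> by simp
    also have "\<dots> \<le> ennreal c"
    proof (rule ennreal_leI)
      have "(1 - s) powr (1 - \<alpha>) \<le> 1" using True \<alpha> by (intro powr_le1) auto
      then show "RL_ker (2 - \<alpha>) (1 - s) \<le> c"
        using True \<alpha> Gamma_real_pos[of "2 - \<alpha>"] by (simp add: RL_ker_def c_def divide_right_mono)
    qed
    finally show ?thesis using True by (simp add: J_def)
  qed (simp add: J_def)
  have "(\<integral>\<^sup>+z. X z \<partial>(lborel \<Otimes>\<^sub>M lborel)) = (\<integral>\<^sup>+y. \<integral>\<^sup>+t. X (t, y) \<partial>lborel \<partial>lborel)"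
    using Xm by (intro lborel_pair.nn_integral_snd[symmetric]) simp
  also have "\<dots> \<le> (\<integral>\<^sup>+y. \<integral>\<^sup>+s. ennreal c * (I y * ennreal \<bar>u (s, y)\<bar>) \<partial>lborel \<partial>lborel)"
  proof (rule nn_integral_mono)
    fix y :: 'a
    have uy [measurable]: "(\<lambda>s. u (s, y)) \<in> borel_measurable borel" by measurable
    have "(\<integral>\<^sup>+t. X (t, y) \<partial>lborel) = (\<integral>\<^sup>+t. \<integral>\<^sup>+s. I y * (J t * F t y s) \<partial>lborel \<partial>lborel)"
      unfolding X_def F_def by (intro nn_integral_cong) (simp add: nn_integral_cmult[symmetric] mult_ac)
    also have "\<dots> = (\<integral>\<^sup>+s. \<integral>\<^sup>+t. I y * (J t * F t y s) \<partial>lborel \<partial>lborel)"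
      unfolding F_def by (rule lborel_pair.Fubini') measurable
    also have "\<dots> = (\<integral>\<^sup>+s. ((\<integral>\<^sup>+t. J t * ennreal (RL_ker (1 - \<alpha>) (t - s)) \<partial>lborel) * J s) * (I y * ennreal \<bar>u (s, y)\<bar>) \<partial>lborel)"
    proof (rule nn_integral_cong)
      fix s
      have "(\<integral>\<^sup>+t. J t * ennreal (RL_ker (1 - \<alpha>) (t - s)) \<partial>lborel) * (J s * (I y * ennreal \<bar>u (s, y)\<bar>))
          = (\<integral>\<^sup>+t. J t * ennreal (RL_ker (1 - \<alpha>) (t - s)) * (J s * (I y * ennreal \<bar>u (s, y)\<bar>)) \<partial>lborel)"
        by (rule nn_integral_multc[symmetric]) measurable
      then show "(\<integral>\<^sup>+t. I y * (J t * F t y s) \<partial>lborel)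
          = ((\<integral>\<^sup>+t. J t * ennreal (RL_ker (1 - \<alpha>) (t - s)) \<partial>lborel) * J s) * (I y * ennreal \<bar>u (s, y)\<bar>)"
        by (simp add: F_def mult_ac)
    qed
    also have "\<dots> \<le> (\<integral>\<^sup>+s. ennreal c * (I y * ennreal \<bar>u (s, y)\<bar>) \<partial>lborel)"
      by (intro nn_integral_mono mult_right_mono inner) simp
    finally show "(\<integral>\<^sup>+t. X (t, y) \<partial>lborel) \<le> (\<integral>\<^sup>+s. ennreal c * (I y * ennreal \<bar>u (s, y)\<bar>) \<partial>lborel)" .
  qed
  also have "\<dots> = (\<integral>\<^sup>+z. ennreal c * (I (snd z) * ennreal \<bar>u z\<bar>) \<partial>(lborel \<Otimes>\<^sub>M lborel))"
    by (subst lborel_pair.nn_integral_snd[symmetric]) auto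
  also have "\<dots> = ennreal c * (\<integral>\<^sup>+z. ennreal (norm (indicator (cbox a b) (snd z) * u z)) \<partial>(lborel \<Otimes>\<^sub>M lborel))"
    by (subst nn_integral_cmult[symmetric])
      (auto intro!: nn_integral_cong simp: I_def split: split_indicator)
  also have "\<dots> < \<infinity>"
    using ui by (auto simp: lborel_prod integrable_iff_bounded ennreal_mult_less_top)
  finally have Xfin: "(\<integral>\<^sup>+z. X z \<partial>(lborel \<Otimes>\<^sub>M lborel)) < \<infinity>" .
  have "AE z in lborel \<Otimes>\<^sub>M lborel. X z \<noteq> \<infinity>"
    using Xm Xfin by (intro nn_integral_noteq_infinite) auto
  then have "AE z in (lborel :: (real \<times> 'a) measure). X z \<noteq> \<infinity>" unfolding lborel_prod .
  then show "AE z in lborel. fst z \<in> {0<..<1} \<longrightarrow> snd z \<in> cbox a b \<longrightarrow>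
           integrable lborel (\<lambda>s. RL_ker (1 - \<alpha>) (fst z - s) * (indicator {0<..<1} s * u (s, snd z)))"
  proof (rule eventually_mono, intro impI)
    fix z assume X: "X z \<noteq> \<infinity>" and z: "fst z \<in> {0<..<1}" "snd z \<in> cbox a b"
    have [measurable]: "(\<lambda>s. u (s, snd z)) \<in> borel_measurable borel" by measurable
    show "integrable lborel (\<lambda>s. RL_ker (1 - \<alpha>) (fst z - s) * (indicator {0<..<1} s * u (s, snd z)))"
    proof (rule integrableI_bounded)
      show "(\<integral>\<^sup>+s. ennreal (norm (RL_ker (1 - \<alpha>) (fst z - s) * (indicator {0<..<1} s * u (s, snd z)))) \<partial>lborel) < \<infinity>"
        using X z unfolding nF by (simp add: X_def J_def I_def less_top)
    qed measurable
  qed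
  show "integrable lborel (\<lambda>z. indicator {0<..<1} (fst z) * (indicator (cbox a b) (snd z) * w z))"
  proof (rule integrableI_bounded)
    show "(\<lambda>z. indicator {0<..<1} (fst z) * (indicator (cbox a b) (snd z) * w z)) \<in> borel_measurable lborel"
      using wm unfolding lborel_prod[symmetric] by measurable
    have "ennreal (norm (indicator {0<..<1} (fst z) * (indicator (cbox a b) (snd z) * w z))) \<le> X z" for z
    proof -
      have "ennreal (norm (w z)) \<le> (\<integral>\<^sup>+s. F (fst z) (snd z) s \<partial>lborel)"
      proof (cases "integrable lborel (\<lambda>s. RL_ker (1 - \<alpha>) (fst z - s) * (indicator {0<..<1} s * u (s, snd z)))")
        case True
        then show ?thesis unfolding w_def nF[symmetric] by (rule integral_norm_bound_ennreal)
      qed (simp add: w_def not_integrable_integral_eq)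
      then show ?thesis by (auto simp: X_def J_def I_def split: split_indicator)
    qed
    then have "(\<integral>\<^sup>+z. ennreal (norm (indicator {0<..<1} (fst z) * (indicator (cbox a b) (snd z) * w z))) \<partial>lborel) \<le> (\<integral>\<^sup>+z. X z \<partial>lborel)"
      by (intro nn_integral_mono)
    also have "\<dots> < \<infinity>" using Xfin by (simp add: lborel_prod)
    finally show "(\<integral>\<^sup>+z. ennreal (norm (indicator {0<..<1} (fst z) * (indicator (cbox a b) (snd z) * w z))) \<partial>lborel) < \<infinity>" .
  qed
qed

definition slab :: "(real \<times> (real ^ 'n)) set" where "slab = {0<..<1} \<times> UNIV"

lemma slab:
  fixes z :: "real \<times> (real ^ 'n)"
  shows "open (slab :: (real \<times> (real ^ 'n)) set)" "(slab :: (real \<times> (real ^ 'n)) set) \<in> sets borel"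
    "(slab :: (real \<times> (real ^ 'n)) set) \<in> sets lebesgue" "z \<in> slab \<longleftrightarrow> fst z \<in> {0<..<1}"
proof -
  show o: "open (slab :: (real \<times> (real ^ 'n)) set)" unfolding slab_def by (intro open_Times) auto
  then show "(slab :: (real \<times> (real ^ 'n)) set) \<in> sets borel" "(slab :: (real \<times> (real ^ 'n)) set) \<in> sets lebesgue" by (simp_all add: borel_open sets_completionI_sets)
  show "z \<in> slab \<longleftrightarrow> fst z \<in> {0<..<1}" by (auto simp: slab_def mem_Times_iff)
qed

lemma frac_int_local:
  fixes u :: "real \<times> (real ^ 'n) \<Rightarrow> real" and a b :: "real ^ 'n"
  assumes \<alpha>: "0 < \<alpha>" "\<alpha> < 1" and p: "1 < p" and u: "u \<in> Lp p slab"
  obtains u' where "u' \<in> borel_measurable borel"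
    "AE z in lborel. fst z \<in> {0<..<1} \<longrightarrow> u' z = u z"
    "AE z in lborel. fst z \<in> {0<..<1} \<longrightarrow> snd z \<in> cbox a b \<longrightarrow>
           integrable lborel (\<lambda>s. RL_ker (1 - \<alpha>) (fst z - s) * (indicator {0<..<1} s * u' (s, snd z)))"
    "integrable lborel (\<lambda>z. indicator {0<..<1} (fst z) * (indicator (cbox a b) (snd z) *
       (\<integral>s. RL_ker (1 - \<alpha>) (fst z - s) * (indicator {0<..<1} s * u' (s, snd z)) \<partial>lborel)))"
proof -
  obtain u' where u': "u' \<in> borel_measurable borel" "\<And>z. z \<notin> slab \<Longrightarrow> u' z = 0"
    "AE z in lborel. z \<in> slab \<longrightarrow> u' z = u z" "integrable lborel (\<lambda>z. \<bar>u' z\<bar> powr p)"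
    by (rule Lp_borel_version[OF u slab(2)]) (rule that)
  have Q: "integrable lborel (indicator (cbox a b) :: _ \<Rightarrow> real)"
    by (rule integrable_real_indicator) (use emeasure_lborel_cbox_finite[of a b] in auto)
  have "integrable lborel (indicator {0<..<1::real} :: _ \<Rightarrow> real)"
    by (rule integrable_real_indicator) auto
  note box = lborel_product(1)[OF this Q]
  have "integrable lborel (\<lambda>z. indicator (cbox a b) (snd z) * u' z)"
  proof (rule Bochner_Integration.integrable_bound)
    show "integrable lborel (\<lambda>z. indicator {0<..<1} (fst z) * indicator (cbox a b) (snd z) + \<bar>u' z\<bar> powr p)"
      by (rule Bochner_Integration.integrable_add[OF box u'(4)])
    show "(\<lambda>z. indicator (cbox a b) (snd z) * u' z) \<in> borel_measurable lborel"
      unfolding lborel_prod[symmetric] using u'(1) unfolding borel_prod[symmetric] by measurable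
    have "\<bar>indicator (cbox a b) (snd z) * u' z\<bar> \<le> indicator {0<..<1} (fst z) * indicator (cbox a b) (snd z) + \<bar>u' z\<bar> powr p" for z
    proof (cases "z \<in> slab")
      case True
      have "\<bar>u' z\<bar> \<le> 1 + \<bar>u' z\<bar> powr p"
      proof (cases "\<bar>u' z\<bar> \<le> 1")
        case False
        then have "\<bar>u' z\<bar> powr 1 \<le> \<bar>u' z\<bar> powr p" using p by (intro powr_mono) auto
        with False show ?thesis by simp
      qed (simp add: add_increasing2)
      then show ?thesis using True slab(4)[of z] by (auto split: split_indicator)
    qed (use u'(2) in simp)
    then show "AE z in lborel. norm (indicator (cbox a b) (snd z) * u' z)
        \<le> norm (indicator {0<..<1} (fst z) * indicator (cbox a b) (snd z) + \<bar>u' z\<bar> powr p)"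
      by (intro AE_I2) (auto intro: order_trans[OF _ abs_ge_self])
  qed
  from frac_int_locally_integrable[OF \<alpha> u'(1) this] u'(1,3) show thesis
    by (intro that[of u']) (simp_all add: slab(4))
qed

text \<open>Additivity of the Bochner integral needs both integrals to converge, which is known only for
  almost every point.\<close>

lemma frac_int_add_AE:
  fixes u v :: "real \<times> (real ^ 'n) \<Rightarrow> real" and a b :: "real ^ 'n"
  assumes \<alpha>: "0 < \<alpha>" "\<alpha> < 1" and p: "1 < p" and u: "u \<in> Lp p slab" and v: "v \<in> Lp p slab"
  shows "AE z in lborel. fst z \<in> {0<..<1} \<longrightarrow> snd z \<in> cbox a b \<longrightarrow>
     frac_int \<alpha> (\<lambda>z. u z + v z) z = frac_int \<alpha> u z + frac_int \<alpha> v z"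
proof -
  obtain u' where u': "u' \<in> borel_measurable borel"
    "AE z in lborel. fst z \<in> {0<..<1} \<longrightarrow> u' z = u z"
    "AE z in lborel. fst z \<in> {0<..<1} \<longrightarrow> snd z \<in> cbox a b \<longrightarrow>
           integrable lborel (\<lambda>s. RL_ker (1 - \<alpha>) (fst z - s) * (indicator {0<..<1} s * u' (s, snd z)))"
    by (rule frac_int_local[OF \<alpha> p u]) (rule that)
  obtain v' where v': "v' \<in> borel_measurable borel"
    "AE z in lborel. fst z \<in> {0<..<1} \<longrightarrow> v' z = v z"
    "AE z in lborel. fst z \<in> {0<..<1} \<longrightarrow> snd z \<in> cbox a b \<longrightarrow>
           integrable lborel (\<lambda>s. RL_ker (1 - \<alpha>) (fst z - s) * (indicator {0<..<1} s * v' (s, snd z)))"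
    by (rule frac_int_local[OF \<alpha> p v]) (rule that)
  have uv: "(\<lambda>z. u' z + v' z) \<in> borel_measurable borel"
    "AE z in lborel. fst z \<in> {0<..<1} \<longrightarrow> u' z + v' z = u z + v z"
    using u'(1) v'(1) u'(2) v'(2) by auto
  show ?thesis
    using frac_int_representative[OF u'(1,2), of \<alpha>] frac_int_representative[OF v'(1,2), of \<alpha>]
      frac_int_representative[OF uv, of \<alpha>] u'(3) v'(3)
  proof eventually_elim
    case (elim z)
    show ?case
    proof (intro impI)
      assume z: "fst z \<in> {0<..<1}" "snd z \<in> cbox a b"
      have "(\<integral>s. RL_ker (1 - \<alpha>) (fst z - s) * (indicator {0<..<1} s * (u' (s, snd z) + v' (s, snd z))) \<partial>lborel)
        = (\<integral>s. RL_ker (1 - \<alpha>) (fst z - s) * (indicator {0<..<1} s * u' (s, snd z))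
            + RL_ker (1 - \<alpha>) (fst z - s) * (indicator {0<..<1} s * v' (s, snd z)) \<partial>lborel)"
        by (simp add: distrib_left)
      also have "\<dots> = (\<integral>s. RL_ker (1 - \<alpha>) (fst z - s) * (indicator {0<..<1} s * u' (s, snd z)) \<partial>lborel)
            + (\<integral>s. RL_ker (1 - \<alpha>) (fst z - s) * (indicator {0<..<1} s * v' (s, snd z)) \<partial>lborel)"
        using elim z by (intro Bochner_Integration.integral_add) auto
      finally show "frac_int \<alpha> (\<lambda>z. u z + v z) z = frac_int \<alpha> u z + frac_int \<alpha> v z"
        using elim z by simp
    qed
  qed
qed

lemma time_test_facts:
  fixes \<phi> :: "real \<times> (real ^ 'n) \<Rightarrow> real"
  assumes \<phi>: "\<phi> \<in> C0_infty ({0..<1} \<times> UNIV)"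
  obtains K a b C where "compact K" "\<And>z. z \<in> slab - K \<Longrightarrow> \<phi> z = 0"
    "\<phi> \<in> borel_measurable (lebesgue_on slab)" "\<And>z. z \<in> slab \<Longrightarrow> \<bar>\<phi> z\<bar> \<le> C"
    "partial_t \<phi> \<in> borel_measurable (lebesgue_on slab)" "\<And>z. z \<in> slab \<Longrightarrow> \<bar>partial_t \<phi> z\<bar> \<le> C"
    "\<And>z. z \<in> slab \<Longrightarrow> snd z \<notin> cbox a b \<Longrightarrow> partial_t \<phi> z = 0"
proof -
  have sub: "slab \<subseteq> {0..<1} \<times> (UNIV :: (real ^ 'n) set)" by (auto simp: slab_def)
  obtain \<phi>' K where \<phi>': "compact K" "K \<subseteq> {0..<1} \<times> UNIV" "\<And>v. continuous_on ({0..<1} \<times> UNIV) (\<lambda>z. \<phi>' z v)"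
    "\<And>z. z \<in> slab \<Longrightarrow> (\<phi> has_derivative \<phi>' z) (at z)" "continuous_on ({0..<1} \<times> UNIV) \<phi>"
    "\<And>z. z \<in> {0..<1} \<times> UNIV - K \<Longrightarrow> \<phi> z = 0" "\<And>z v. z \<in> slab - K \<Longrightarrow> \<phi>' z v = 0"
    by (rule test_function_derivative[OF \<phi> slab(1) sub]) (rule that)
  have \<phi>0: "\<phi> z = 0" if "z \<in> slab - K" for z using \<phi>'(6)[of z] that sub by blast
  obtain C where C: "\<phi> \<in> borel_measurable (lebesgue_on slab)" "\<And>z. z \<in> slab \<Longrightarrow> \<bar>\<phi> z\<bar> \<le> C"
    by (rule compact_support_bounded_measurable[OF \<phi>'(5,1,2) \<phi>0 sub slab(3)]) (assumption | rule that)+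
  obtain C' where C': "(\<lambda>z. \<phi>' z (1, 0)) \<in> borel_measurable (lebesgue_on slab)" "\<And>z. z \<in> slab \<Longrightarrow> \<bar>\<phi>' z (1, 0)\<bar> \<le> C'"
    by (rule compact_support_bounded_measurable[OF \<phi>'(3,1,2,7) sub slab(3), of "(1, 0)"]) (assumption | rule that)+
  have pt: "partial_t \<phi> z = \<phi>' z (1, 0)" if "z \<in> slab" for z by (rule partial_t_eq[OF \<phi>'(4)[OF that]])
  have "compact (snd ` K)" using \<phi>'(1) by (intro compact_continuous_image continuous_intros)
  then obtain a b where ab: "snd ` K \<subseteq> cbox a b" using compact_imp_bounded bounded_subset_cbox_symmetric by metis
  show thesis
  proof (rule that[of K "max C C'" a b, OF \<phi>'(1) \<phi>0 C(1)])
    show "partial_t \<phi> \<in> borel_measurable (lebesgue_on slab)"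
      using C'(1) by (rule measurable_cong[THEN iffD1, rotated]) (simp add: pt space_restrict_space)
    show "\<bar>\<phi> z\<bar> \<le> max C C'" if "z \<in> slab" for z using C(2)[OF that] by simp
    show "\<bar>partial_t \<phi> z\<bar> \<le> max C C'" if "z \<in> slab" for z using C'(2)[OF that] by (simp add: pt[OF that])
    show "partial_t \<phi> z = 0" if "z \<in> slab" "snd z \<notin> cbox a b" for z
      using \<phi>'(7)[of z "(1, 0)"] that ab by (auto simp: pt)
  qed
qed

lemma frac_int_test_integrable:
  fixes u \<psi> :: "real \<times> (real ^ 'n) \<Rightarrow> real"
  assumes \<alpha>: "0 < \<alpha>" "\<alpha> < 1" and p: "1 < p" and u: "u \<in> Lp p slab"
    and \<psi>: "\<psi> \<in> borel_measurable (lebesgue_on slab)" "\<And>z. z \<in> slab \<Longrightarrow> \<bar>\<psi> z\<bar> \<le> C"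
    "\<And>z. z \<in> slab \<Longrightarrow> snd z \<notin> cbox a b \<Longrightarrow> \<psi> z = 0"
  shows "integrable (lebesgue_on slab) (\<lambda>z. frac_int \<alpha> u z * \<psi> z)"
proof -
  obtain u' where u': "u' \<in> borel_measurable borel"
    "AE z in lborel. fst z \<in> {0<..<1} \<longrightarrow> u' z = u z"
    "integrable lborel (\<lambda>z. indicator {0<..<1} (fst z) * (indicator (cbox a b) (snd z) *
       (\<integral>s. RL_ker (1 - \<alpha>) (fst z - s) * (indicator {0<..<1} s * u' (s, snd z)) \<partial>lborel)))"
    by (rule frac_int_local[OF \<alpha> p u]) (rule that)
  define P where "P z = indicator {0<..<1} (fst z) * (indicator (cbox a b) (snd z) *
       (\<integral>s. RL_ker (1 - \<alpha>) (fst z - s) * (indicator {0<..<1} s * u' (s, snd z)) \<partial>lborel))" for z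
  have Pi: "integrable lebesgue P"
    using u'(3) unfolding P_def[abs_def] by (subst integrable_completion) (auto dest: borel_measurable_integrable)
  then have Pm: "P \<in> borel_measurable lebesgue" by (rule borel_measurable_integrable)
  define h0 where "h0 z = P z * (indicator slab z * \<psi> z)" for z
  have \<psi>m: "(\<lambda>z. indicator slab z * \<psi> z) \<in> borel_measurable lebesgue"
    using \<psi>(1) slab(3) by (subst (asm) borel_measurable_restrict_space_iff) auto
  have h0i: "integrable lebesgue h0"
  proof (rule Bochner_Integration.integrable_bound)
    show "integrable lebesgue (\<lambda>z. C * P z)" using Pi by simp
    show "h0 \<in> borel_measurable lebesgue" unfolding h0_def[abs_def] by (intro borel_measurable_times Pm \<psi>m)
    have "\<bar>h0 z\<bar> \<le> \<bar>C * P z\<bar>" for z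
    proof (cases "z \<in> slab")
      case True
      then have "\<bar>\<psi> z\<bar> \<le> \<bar>C\<bar>" using \<psi>(2)[OF True] by simp
      then show ?thesis using True by (simp add: h0_def abs_mult mult.commute[of "\<bar>C\<bar>"] mult_left_mono)
    qed (simp add: h0_def)
    then show "AE z in lebesgue. norm (h0 z) \<le> norm (C * P z)" by simp
  qed
  have "AE z in lebesgue. h0 z = indicator slab z *\<^sub>R (frac_int \<alpha> u z * \<psi> z)"
    using AE_completion[OF frac_int_representative[OF u'(1,2), of \<alpha>]]
  proof (rule eventually_mono)
    fix z
    assume *: "fst z \<in> {0<..<1} \<longrightarrow>
     frac_int \<alpha> u z = (\<integral>s. RL_ker (1 - \<alpha>) (fst z - s) * (indicator {0<..<1} s * u' (s, snd z)) \<partial>lborel)"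
    show "h0 z = indicator slab z *\<^sub>R (frac_int \<alpha> u z * \<psi> z)"
    proof (cases "z \<in> slab")
      case True
      then show ?thesis using * \<psi>(3)[OF True] slab(4)[of z]
        by (cases "snd z \<in> cbox a b") (simp_all add: h0_def P_def)
    qed (simp add: h0_def)
  qed
  moreover from borel_measurable_AE[OF borel_measurable_integrable[OF h0i] this]
  have "(\<lambda>z. indicator slab z *\<^sub>R (frac_int \<alpha> u z * \<psi> z)) \<in> borel_measurable lebesgue" .
  ultimately have "integrable lebesgue (\<lambda>z. indicator slab z *\<^sub>R (frac_int \<alpha> u z * \<psi> z))"
    using integrable_cong_AE[OF borel_measurable_integrable[OF h0i]] h0i by blast
  then show ?thesis using slab(3) by (subst integrable_restrict_space) auto
qed

lemma is_frac_dt_add: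
  fixes u v g h :: "real \<times> (real ^ 'n) \<Rightarrow> real"
  assumes \<alpha>: "0 < \<alpha>" "\<alpha> < 1" and p: "1 < p"
    and u: "u \<in> Lp p slab" "g \<in> Lp p slab" "is_frac_dt \<alpha> 1 UNIV u g"
    and v: "v \<in> Lp p slab" "h \<in> Lp p slab" "is_frac_dt \<alpha> 1 UNIV v h"
  shows "is_frac_dt \<alpha> 1 UNIV (\<lambda>z. u z + v z) (\<lambda>z. g z + h z)"
  unfolding is_frac_dt_def slab_def[symmetric]
proof
  fix \<phi> :: "real \<times> (real ^ 'n) \<Rightarrow> real" assume \<phi>: "\<phi> \<in> C0_infty ({0..<1} \<times> UNIV)"
  obtain K a b C where K: "compact K" "\<And>z. z \<in> slab - K \<Longrightarrow> \<phi> z = 0"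
    "\<phi> \<in> borel_measurable (lebesgue_on slab)" "\<And>z. z \<in> slab \<Longrightarrow> \<bar>\<phi> z\<bar> \<le> C"
    "partial_t \<phi> \<in> borel_measurable (lebesgue_on slab)" "\<And>z. z \<in> slab \<Longrightarrow> \<bar>partial_t \<phi> z\<bar> \<le> C"
    "\<And>z. z \<in> slab \<Longrightarrow> snd z \<notin> cbox a b \<Longrightarrow> partial_t \<phi> z = 0"
    by (rule time_test_facts[OF \<phi>]) (rule that)
  have gi: "integrable (lebesgue_on slab) (\<lambda>z. f z * \<phi> z)" if "f \<in> Lp p slab" for f :: "real \<times> (real ^ 'n) \<Rightarrow> real"
    using Lp_imp_integrable_bounded_support[OF p slab(3) that K(1,3,4,2)] by (simp add: mult.commute)
  have fi: "integrable (lebesgue_on slab) (\<lambda>z. frac_int \<alpha> f z * partial_t \<phi> z)" if "f \<in> Lp p slab" for f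
    by (rule frac_int_test_integrable[OF \<alpha> p that K(5,6,7)])
  have "(\<integral>z. frac_int \<alpha> (\<lambda>z. u z + v z) z * partial_t \<phi> z \<partial>lebesgue_on slab)
      = (\<integral>z. frac_int \<alpha> u z * partial_t \<phi> z + frac_int \<alpha> v z * partial_t \<phi> z \<partial>lebesgue_on slab)"
  proof (rule integral_cong_AE)
    show "(\<lambda>z. frac_int \<alpha> (\<lambda>z. u z + v z) z * partial_t \<phi> z) \<in> borel_measurable (lebesgue_on slab)"
      using fi[OF Lp_add(1)[OF p u(1) v(1)]] by (rule borel_measurable_integrable)
    show "(\<lambda>z. frac_int \<alpha> u z * partial_t \<phi> z + frac_int \<alpha> v z * partial_t \<phi> z) \<in> borel_measurable (lebesgue_on slab)"
      using fi[OF u(1)] fi[OF v(1)] by (intro borel_measurable_add borel_measurable_integrable)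
    have "AE z in lebesgue. z \<in> slab \<longrightarrow> frac_int \<alpha> (\<lambda>z. u z + v z) z * partial_t \<phi> z
      = frac_int \<alpha> u z * partial_t \<phi> z + frac_int \<alpha> v z * partial_t \<phi> z"
      using AE_completion[OF frac_int_add_AE[OF \<alpha> p u(1) v(1), of a b]]
    proof (rule eventually_mono, intro impI)
      fix z :: "real \<times> (real ^ 'n)" assume *: "fst z \<in> {0<..<1} \<longrightarrow> snd z \<in> cbox a b \<longrightarrow>
         frac_int \<alpha> (\<lambda>z. u z + v z) z = frac_int \<alpha> u z + frac_int \<alpha> v z" and z: "z \<in> slab"
      then show "frac_int \<alpha> (\<lambda>z. u z + v z) z * partial_t \<phi> z
      = frac_int \<alpha> u z * partial_t \<phi> z + frac_int \<alpha> v z * partial_t \<phi> z"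
        using K(7)[OF z] slab(4)[of z] by (cases "snd z \<in> cbox a b") (simp_all add: distrib_right)
    qed
    then show "AE z in lebesgue_on slab. frac_int \<alpha> (\<lambda>z. u z + v z) z * partial_t \<phi> z
      = frac_int \<alpha> u z * partial_t \<phi> z + frac_int \<alpha> v z * partial_t \<phi> z"
      using slab(3) by (subst AE_restrict_space_iff) auto
  qed
  also have "\<dots> = (\<integral>z. frac_int \<alpha> u z * partial_t \<phi> z \<partial>lebesgue_on slab) + (\<integral>z. frac_int \<alpha> v z * partial_t \<phi> z \<partial>lebesgue_on slab)"
    using fi[OF u(1)] fi[OF v(1)] by (rule Bochner_Integration.integral_add)
  finally show "(\<integral>z. (g z + h z) * \<phi> z \<partial>lebesgue_on slab)
      = - (\<integral>z. frac_int \<alpha> (\<lambda>z. u z + v z) z * partial_t \<phi> z \<partial>lebesgue_on slab)"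
    using u(3) v(3) \<phi> gi[OF u(2)] gi[OF v(2)] by (simp add: is_frac_dt_def slab_def distrib_right)
qed

lemma is_frac_dt_minus:
  "is_frac_dt \<alpha> T \<Omega> u g \<Longrightarrow> is_frac_dt \<alpha> T \<Omega> (\<lambda>z. - u z) (\<lambda>z. - g z)"
  by (simp add: is_frac_dt_def frac_int_def split_def)

lemma H_space_diff:
  fixes u v :: "real \<times> (real ^ 'n) \<Rightarrow> real"
  assumes \<alpha>: "0 < \<alpha>" "\<alpha> < 1" and p: "1 < p"
    and u: "u \<in> H_space \<alpha> p 1 UNIV" and v: "v \<in> H_space \<alpha> p 1 UNIV"
  shows "(\<lambda>z. u z - v z) \<in> H_space \<alpha> p 1 UNIV"
proof -
  from u obtain G g where u: "u \<in> Lp p slab" "G \<in> Lp p slab" "is_weak_Dx slab u G"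
    "g \<in> Lp p slab" "is_frac_dt \<alpha> 1 UNIV u g" by (auto simp: H_space_def slab_def)
  from v obtain H h where v: "v \<in> Lp p slab" "H \<in> Lp p slab" "is_weak_Dx slab v H"
    "h \<in> Lp p slab" "is_frac_dt \<alpha> 1 UNIV v h" by (auto simp: H_space_def slab_def)
  note m = Lp_minus[OF v(1)] Lp_minus[OF v(2)] is_weak_Dx_minus[OF v(3)] Lp_minus[OF v(4)] is_frac_dt_minus[OF v(5)]
  have "(\<lambda>z. u z + - v z) \<in> H_space \<alpha> p 1 UNIV"
    unfolding H_space_def slab_def[symmetric] mem_Collect_eq
    using Lp_add(1)[OF p u(1) m(1)] Lp_add(1)[OF p u(2) m(2)] Lp_add(1)[OF p u(4) m(4)]
      is_weak_Dx_add[OF p slab(1) u(1-3) m(1-3)] is_frac_dt_add[OF \<alpha> p u(1,4,5) m(1,4,5)] by blast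
  then show ?thesis by simp
qed

lemma H_space_chosen:
  assumes "u \<in> H_space \<alpha> p 1 UNIV"
  shows "weak_Dx p slab u \<in> Lp p slab" "is_weak_Dx slab u (weak_Dx p slab u)"
    "frac_dt \<alpha> p 1 UNIV u \<in> Lp p slab" "is_frac_dt \<alpha> 1 UNIV u (frac_dt \<alpha> p 1 UNIV u)" "u \<in> Lp p slab"
proof -
  from assms have 1: "\<exists>G. G \<in> Lp p slab \<and> is_weak_Dx slab u G" and 2: "\<exists>g. g \<in> Lp p slab \<and> is_frac_dt \<alpha> 1 UNIV u g"
    by (auto simp: H_space_def slab_def)
  show "weak_Dx p slab u \<in> Lp p slab" "is_weak_Dx slab u (weak_Dx p slab u)"
    using someI_ex[OF 1] by (auto simp: weak_Dx_def)
  show "frac_dt \<alpha> p 1 UNIV u \<in> Lp p slab" "is_frac_dt \<alpha> 1 UNIV u (frac_dt \<alpha> p 1 UNIV u)"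
    using someI_ex[OF 2] by (auto simp: frac_dt_def slab_def)
  show "u \<in> Lp p slab" using assms by (simp add: H_space_def slab_def)
qed

section \<open>Passage to the limit\<close>

text \<open>A set of full measure in an open set is dense, and a Hoelder continuous function on it is uniformly
  continuous.  So it extends continuously, with the same estimate.\<close>

lemma hoelder_extension:
  fixes u :: "real \<times> (real ^ 'n) \<Rightarrow> real"
  assumes D: "open D" and a: "0 < a" and b: "0 < b" and N: "0 \<le> N"
    and E: "E \<subseteq> D" "AE z in lebesgue. z \<in> D \<longrightarrow> z \<in> E"
    and h: "\<And>z w. z \<in> E \<Longrightarrow> w \<in> E \<Longrightarrow>
      \<bar>u z - u w\<bar> \<le> N * (\<bar>fst z - fst w\<bar> powr a + norm (snd z - snd w) powr b)"
  obtains u' where "is_cont_rep D u u'" "holder_seminorm a b D u' \<le> ennreal N"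
proof -
  have sub: "D \<subseteq> closure E"
  proof (rule ccontr)
    assume "\<not> D \<subseteq> closure E"
    then have ne: "D - closure E \<noteq> {}" by auto
    have "open (D - closure E)" using D by (intro open_Diff closed_closure)
    then have "\<not> negligible (D - closure E)" using ne by (rule open_not_negligible)
    moreover have "AE z in lebesgue. z \<notin> D - closure E"
      using E(2) by (rule eventually_mono) (use closure_subset in auto)
    then have "negligible (D - closure E)"
      by (simp add: negligible_iff_null_sets completion.AE_iff_null_sets \<open>open (D - closure E)\<close> borel_open sets_completionI_sets
          AE_iff_null_sets)
    ultimately show False by simp
  qed
  define \<rho> where "\<rho> r = N * (r powr a + r powr b)" for r :: real
  have d: "\<bar>fst z - fst w\<bar> \<le> dist z w" "norm (snd z - snd w) \<le> dist z w" for z w :: "real \<times> (real ^ 'n)"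
    using dist_fst_le[of z w] dist_snd_le[of z w] by (auto simp: dist_norm)
  have "uniformly_continuous_on E u"
    unfolding uniformly_continuous_on_def
  proof (intro allI impI)
    fix e :: real assume e: "0 < e"
    have "continuous_on {0..} \<rho>"
      unfolding \<rho>_def using a b by (intro continuous_intros continuous_on_powr') auto
    then obtain \<delta> where \<delta>: "\<delta> > 0" "\<And>r. 0 \<le> r \<Longrightarrow> dist r 0 < \<delta> \<Longrightarrow> dist (\<rho> r) (\<rho> 0) < e"
      using e unfolding continuous_on_iff by force
    show "\<exists>d>0. \<forall>x\<in>E. \<forall>x'\<in>E. dist x' x < d \<longrightarrow> dist (u x') (u x) < e"
    proof (intro exI[of _ \<delta>] conjI ballI impI)
      fix z w assume z: "z \<in> E" "w \<in> E" and zw: "dist w z < \<delta>"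
      have "\<bar>u w - u z\<bar> \<le> \<rho> (dist w z)"
        using d[of w z] a b N unfolding \<rho>_def
        by (intro order_trans[OF h[OF z(2,1)]] mult_left_mono add_mono powr_mono2) auto
      also have "\<dots> < e" using \<delta>(2)[of "dist w z"] zw by (simp add: dist_real_def \<rho>_def)
      finally show "dist (u w) (u z) < e" by (simp add: dist_real_def)
    qed (use \<delta> in auto)
  qed
  then obtain u' where u': "uniformly_continuous_on (closure E) u'" "\<And>x. x \<in> E \<Longrightarrow> u x = u' x"
    by (rule uniformly_continuous_on_extension_on_closure) (rule that)
  have c: "continuous_on (closure E) u'" using u'(1) by (rule uniformly_continuous_imp_continuous)
  have ineq: "\<bar>u' z - u' w\<bar> \<le> N * (\<bar>fst z - fst w\<bar> powr a + norm (snd z - snd w) powr b)"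
    if z: "z \<in> D" and w: "w \<in> D" for z w
  proof -
    obtain x where x: "\<And>n. x n \<in> E" "x \<longlonglongrightarrow> z" using z sub closure_sequential by (metis subsetD)
    obtain y where y: "\<And>n. y n \<in> E" "y \<longlonglongrightarrow> w" using w sub closure_sequential by (metis subsetD)
    have "x n \<in> closure E" "y n \<in> closure E" for n using x(1) y(1) closure_subset by blast+
    then have "(\<lambda>n. u' (x n)) \<longlonglongrightarrow> u' z" "(\<lambda>n. u' (y n)) \<longlonglongrightarrow> u' w"
      using continuous_on_tendsto_compose[OF c x(2)] continuous_on_tendsto_compose[OF c y(2)] z w sub by auto
    then have l1: "(\<lambda>n. \<bar>u' (x n) - u' (y n)\<bar>) \<longlonglongrightarrow> \<bar>u' z - u' w\<bar>" by (intro tendsto_intros)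
    have cr: "continuous_on UNIV (\<lambda>q :: (real \<times> (real ^ 'n)) \<times> (real \<times> (real ^ 'n)).
        N * (\<bar>fst (fst q) - fst (snd q)\<bar> powr a + norm (snd (fst q) - snd (snd q)) powr b))"
      using a b by (intro continuous_on_mult continuous_on_add continuous_on_powr' continuous_intros) auto
    have "(\<lambda>n. N * (\<bar>fst (x n) - fst (y n)\<bar> powr a + norm (snd (x n) - snd (y n)) powr b))
        \<longlonglongrightarrow> N * (\<bar>fst z - fst w\<bar> powr a + norm (snd z - snd w) powr b)"
      using continuous_on_tendsto_compose[OF cr tendsto_Pair[OF x(2) y(2)]] by simp
    with l1 show ?thesis
      by (rule LIMSEQ_le) (use h[OF x(1) y(1)] u'(2)[OF x(1)] u'(2)[OF y(1)] in auto)
  qed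
  show thesis
  proof (rule that[of u'])
    have "AE z in lebesgue_on D. u' z = u z"
    proof (subst AE_restrict_space_iff)
      show "AE z in lebesgue. z \<in> D \<longrightarrow> u' z = u z"
        using E(2) by (rule eventually_mono) (use u'(2) in auto)
    qed (use D in \<open>simp add: borel_open sets_completionI_sets\<close>)
    then show "is_cont_rep D u u'"
      using continuous_on_subset[OF c sub] by (simp add: is_cont_rep_def)
    show "holder_seminorm a b D u' \<le> ennreal N"
      unfolding holder_seminorm_def
    proof (rule SUP_least)
      fix q assume q: "q \<in> {(z, w). z \<in> D \<and> w \<in> D \<and> z \<noteq> w}"
      obtain t x s y where q_eq: "q = ((t, x), (s, y))" by (metis surj_pair)
      with q have z: "(t, x) \<in> D" "(s, y) \<in> D" and ne: "\<not> (t = s \<and> x = y)" by auto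
      have "0 < \<bar>t - s\<bar> powr a + norm (x - y) powr b"
        using ne by (cases "t = s") (auto simp: add_pos_nonneg)
      then have "\<bar>u' (t, x) - u' (s, y)\<bar> / (\<bar>t - s\<bar> powr a + norm (x - y) powr b) \<le> N"
        using ineq[OF z] by (simp add: pos_divide_le_eq)
      then show "(case q of (z, w) \<Rightarrow> (case z of (t, x) \<Rightarrow> \<lambda>(s, y).
          ennreal (\<bar>u' (t, x) - u' (s, y)\<bar> / (\<bar>t - s\<bar> powr a + norm (x - y) powr b))) w) \<le> ennreal N"
        by (simp add: q_eq ennreal_leI)
    qed
  qed
qed

text \<open>Write \<open>v = (v - \<psi>) + \<psi>\<close>.  The sums of the weak derivatives that enter the norms of \<open>v - \<psi>\<close> and
  \<open>\<psi>\<close> are weak derivatives of \<open>v\<close>.\<close>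

lemma H_space_estimate:
  fixes v \<psi> :: "real \<times> (real ^ 'n) \<Rightarrow> real"
  assumes \<alpha>: "0 < \<alpha>" "\<alpha> < 1" and p: "1 < p"
    and \<sigma>: "\<sigma> = 1 - (real CARD('n) + 1 / \<alpha>) / p" "0 < \<sigma>"
    and v: "continuous_on ({0..1} \<times> UNIV) v" "\<And>x. v (0, x) = 0"
    and H: "v \<in> H_space \<alpha> p 1 UNIV" "\<psi> \<in> H_space \<alpha> p 1 UNIV"
    and z: "z \<in> slab" "w \<in> slab"
  defines "N \<equiv> 4 * ((2 * time_const \<alpha> p + 1) * (2 * ((2 + 3 * real CARD('n)) / (1 - 2 powr - \<sigma>)) + 2))"
  shows "\<bar>v z - v w\<bar> \<le> N * (H_norm \<alpha> p 1 UNIV (\<lambda>z. v z - \<psi> z) + H_norm \<alpha> p 1 UNIV \<psi>)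
     * (\<bar>fst z - fst w\<bar> powr (\<sigma> * \<alpha>) + norm (snd z - snd w) powr \<sigma>)"
proof -
  define d where "d z = v z - \<psi> z" for z
  have d: "d \<in> H_space \<alpha> p 1 UNIV" unfolding d_def[abs_def] by (rule H_space_diff[OF \<alpha> p H])
  note D = H_space_chosen[OF d] and P = H_space_chosen[OF H(2)]
  define g where "g z = frac_dt \<alpha> p 1 UNIV d z + frac_dt \<alpha> p 1 UNIV \<psi> z" for z
  define G where "G z = weak_Dx p slab d z + weak_Dx p slab \<psi> z" for z
  have v_eq: "(\<lambda>z. d z + \<psi> z) = v" by (simp add: d_def)
  have g: "g \<in> Lp p slab" "is_frac_dt \<alpha> 1 UNIV v g"
    using Lp_add(1)[OF p D(3) P(3)] is_frac_dt_add[OF \<alpha> p D(5,3,4) P(5,3,4)] unfolding v_eq g_def[abs_def] by blast+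
  have G: "G \<in> Lp p slab" "is_weak_Dx slab v G"
    using Lp_add(1)[OF p D(1) P(1)] is_weak_Dx_add[OF p slab(1) D(5,1,2) P(5,1,2)] unfolding v_eq G_def[abs_def] by blast+
  interpret continuous_with_weak_derivatives v g G \<alpha> p \<sigma>
    by unfold_locales (use \<alpha> p \<sigma> v g G in \<open>auto simp: slab_def\<close>)
  have "M = Lp_norm p slab g + Lp_norm p slab G" by (simp only: M_def slab_def)
  also have "\<dots> \<le> 4 * (Lp_norm p slab (frac_dt \<alpha> p 1 UNIV d) + Lp_norm p slab (frac_dt \<alpha> p 1 UNIV \<psi>))
      + 4 * (Lp_norm p slab (weak_Dx p slab d) + Lp_norm p slab (weak_Dx p slab \<psi>))"
    unfolding g_def[abs_def] G_def[abs_def]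
    by (intro add_mono Lp_add(2)[OF p] D P)
  also have "\<dots> \<le> 4 * (H_norm \<alpha> p 1 UNIV d + H_norm \<alpha> p 1 UNIV \<psi>)"
    unfolding H_norm_def slab_def[symmetric] using Lp_norm_nonneg[of p slab d] Lp_norm_nonneg[of p slab \<psi>] by simp
  finally have M4: "M \<le> 4 * (H_norm \<alpha> p 1 UNIV d + H_norm \<alpha> p 1 UNIV \<psi>)" .
  have "0 < 1 - 2 powr - \<sigma>" using \<sigma>(2) by (simp add: powr_less_one)
  then have "0 \<le> K0" by (simp add: K0_def)
  have "\<bar>v z - v w\<bar> \<le> C1 * (2 * K0 + 2) * M * (\<bar>fst z - fst w\<bar> powr (\<sigma> * \<alpha>) + norm (snd z - snd w) powr \<sigma>)"
    using hoelder_estimate[of "fst z" "fst w" "snd z" "snd w"] z by (simp add: slab(4))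
  also have "\<dots> \<le> C1 * (2 * K0 + 2) * (4 * (H_norm \<alpha> p 1 UNIV d + H_norm \<alpha> p 1 UNIV \<psi>))
      * (\<bar>fst z - fst w\<bar> powr (\<sigma> * \<alpha>) + norm (snd z - snd w) powr \<sigma>)"
    using M4 C1_nonneg \<open>0 \<le> K0\<close> by (intro mult_right_mono mult_left_mono) auto
  finally have *: "\<bar>v z - v w\<bar> \<le> C1 * (2 * K0 + 2) * (4 * (H_norm \<alpha> p 1 UNIV d + H_norm \<alpha> p 1 UNIV \<psi>))
      * (\<bar>fst z - fst w\<bar> powr (\<sigma> * \<alpha>) + norm (snd z - snd w) powr \<sigma>)" .
  have "N = 4 * (C1 * (2 * K0 + 2))" by (simp only: N_def C1_def K0_def)
  then have "C1 * (2 * K0 + 2) * (4 * (H_norm \<alpha> p 1 UNIV d + H_norm \<alpha> p 1 UNIV \<psi>))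
      = N * (H_norm \<alpha> p 1 UNIV d + H_norm \<alpha> p 1 UNIV \<psi>)" by (simp only: mult_ac)
  with * show ?thesis unfolding d_def[abs_def] by (simp only:)
qed

lemma H_norm_nonneg: "0 \<le> H_norm \<alpha> p T \<Omega> u"
  by (simp add: H_norm_def Lp_norm_nonneg)

text \<open>The functions \<open>|d\<^sub>n|\<^sup>p\<close> converge to \<open>0\<close> in \<open>L\<^sub>1\<close>.\<close>

lemma AE_convergent_subsequence:
  fixes d :: "nat \<Rightarrow> 'a::euclidean_space \<Rightarrow> real"
  assumes p: "1 < p" and d: "\<And>n. d n \<in> Lp p D" and lim: "(\<lambda>n. Lp_norm p D (d n)) \<longlonglongrightarrow> 0"
  obtains r :: "nat \<Rightarrow> nat" where "strict_mono r" "AE z in lebesgue_on D. (\<lambda>n. d (r n) z) \<longlonglongrightarrow> 0"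
proof -
  have "(\<integral>z. norm (d n z) powr p \<partial>lebesgue_on D) = Lp_norm p D (d n) powr p" for n
    using p by (simp add: Lp_norm_def powr_powr)
  moreover have "(\<lambda>n. Lp_norm p D (d n) powr p) \<longlonglongrightarrow> 0"
    using p by (intro tendsto_zero_powrI[OF lim tendsto_const]) (auto simp: Lp_norm_nonneg)
  ultimately have "(\<lambda>n. \<integral>z. norm (norm (d n z) powr p) \<partial>lebesgue_on D) \<longlonglongrightarrow> 0" by simp
  moreover have "integrable (lebesgue_on D) (\<lambda>z. norm (d n z) powr p)" for n using d by (simp add: Lp_def)
  ultimately obtain r :: "nat \<Rightarrow> nat" where r: "strict_mono r"
    "AE z in lebesgue_on D. (\<lambda>n. norm (d (r n) z) powr p) \<longlonglongrightarrow> 0"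
    using tendsto_L1_AE_subseq[of "lebesgue_on D" "\<lambda>n z. norm (d n z) powr p"] by blast
  have "AE z in lebesgue_on D. (\<lambda>n. d (r n) z) \<longlonglongrightarrow> 0"
    using r(2)
  proof (rule eventually_mono)
    fix z assume lim: "(\<lambda>n. norm (d (r n) z) powr p) \<longlonglongrightarrow> 0"
    have "(\<lambda>n. (norm (d (r n) z) powr p) powr (1 / p)) \<longlonglongrightarrow> 0"
      by (rule tendsto_zero_powrI[OF lim tendsto_const]) (use p in simp_all)
    moreover have "(norm x powr p) powr (1 / p) = \<bar>x\<bar>" for x :: real using p by (simp add: powr_powr)
    ultimately have "(\<lambda>n. \<bar>d (r n) z\<bar>) \<longlonglongrightarrow> 0" by (simp only:)
    then show "(\<lambda>n. d (r n) z) \<longlonglongrightarrow> 0" by (rule tendsto_rabs_zero_cancel)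
  qed
  with r(1) show thesis by (rule that)
qed

theorem theoremA7:
  fixes \<alpha> p \<sigma> :: real
  assumes "0 < \<alpha>" and "\<alpha> < 1" and "1 < p"
    and "\<sigma> = 1 - (real CARD('n::finite) + 1 / \<alpha>) / p"
    and "0 < \<sigma>" and "\<sigma> < 1"
  shows "\<exists>N\<ge>0. \<forall>\<psi> \<in> H0_space \<alpha> p 1 (UNIV :: (real ^ 'n) set).
           \<exists>\<psi>'. is_cont_rep ({0<..<1} \<times> UNIV) \<psi> \<psi>' \<and>
             holder_seminorm (\<sigma> * \<alpha>) \<sigma> ({0<..<1} \<times> UNIV) \<psi>'
               \<le> ennreal (N * H_norm \<alpha> p 1 UNIV \<psi>)"
proof -
  define N where "N = 4 * ((2 * time_const \<alpha> p + 1) * (2 * ((2 + 3 * real CARD('n)) / (1 - 2 powr - \<sigma>)) + 2))"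
  have "0 < 1 - 2 powr - \<sigma>" using assms(5) by (simp add: powr_less_one)
  then have N: "N \<ge> 0" unfolding N_def time_const_def by (intro mult_nonneg_nonneg add_nonneg_nonneg divide_nonneg_pos) auto
  have "\<exists>\<psi>'. is_cont_rep slab \<psi> \<psi>' \<and> holder_seminorm (\<sigma> * \<alpha>) \<sigma> slab \<psi>' \<le> ennreal (N * H_norm \<alpha> p 1 UNIV \<psi>)"
    if \<psi>: "\<psi> \<in> H0_space \<alpha> p 1 (UNIV :: (real ^ 'n) set)" for \<psi>
  proof -
    from \<psi> have \<psi>H: "\<psi> \<in> H_space \<alpha> p 1 UNIV" by (simp add: H0_space_def)
    from \<psi> obtain v where v':
      "\<forall>n. v n \<in> C_infty ({0..1} \<times> UNIV) \<and> v n \<in> H_space \<alpha> p 1 UNIV \<and>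
            (\<exists>R. \<forall>t\<in>{0..1}. \<forall>x\<in>UNIV. norm x > R \<longrightarrow> v n (t, x) = 0) \<and>
            (\<forall>x\<in>UNIV. v n (0, x) = 0)"
      "(\<lambda>n. H_norm \<alpha> p 1 UNIV (\<lambda>z. v n z - \<psi> z)) \<longlonglongrightarrow> 0"
      unfolding H0_space_def by blast
    then have v: "v n \<in> C_infty ({0..1} \<times> UNIV)" "v n \<in> H_space \<alpha> p 1 UNIV" "v n (0, x) = 0"
        "(\<lambda>n. H_norm \<alpha> p 1 UNIV (\<lambda>z. v n z - \<psi> z)) \<longlonglongrightarrow> 0" for n x
      by auto
    have vc: "continuous_on ({0..1} \<times> UNIV) (v n)" for n
    proof -
      have "Ck_on 0 ({0..1} \<times> UNIV) (v n)" using v(1)[of n] unfolding C_infty_def by blast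
      then show ?thesis by simp
    qed
    have dL: "(\<lambda>z. v n z - \<psi> z) \<in> Lp p slab" for n
      by (rule H_space_chosen(5)[OF H_space_diff[OF assms(1,2,3) v(2) \<psi>H]])
    have "(\<lambda>n. Lp_norm p slab (\<lambda>z. v n z - \<psi> z)) \<longlonglongrightarrow> 0"
    proof (rule tendsto_sandwich[OF _ _ tendsto_const v(4)])
      show "\<forall>\<^sub>F n in sequentially. Lp_norm p slab (\<lambda>z. v n z - \<psi> z) \<le> H_norm \<alpha> p 1 UNIV (\<lambda>z. v n z - \<psi> z)"
        by (intro always_eventually allI) (simp add: H_norm_def slab_def Lp_norm_nonneg)
    qed (simp add: Lp_norm_nonneg)
    then obtain r :: "nat \<Rightarrow> nat" where r: "strict_mono r"
      "AE z in lebesgue_on slab. (\<lambda>n. v (r n) z - \<psi> z) \<longlonglongrightarrow> 0"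
      by (rule AE_convergent_subsequence[OF assms(3) dL]) (rule that)
    define E where "E = {z \<in> slab. (\<lambda>n. v (r n) z) \<longlonglongrightarrow> \<psi> z}"
    have E: "AE z in lebesgue. z \<in> slab \<longrightarrow> z \<in> E"
    proof -
      have "AE z in lebesgue. z \<in> slab \<longrightarrow> (\<lambda>n. v (r n) z - \<psi> z) \<longlonglongrightarrow> 0"
        using r(2) slab(3) by (subst (asm) AE_restrict_space_iff) auto
      then show ?thesis by (rule eventually_mono) (auto simp: E_def LIM_zero_iff)
    qed
    have h: "\<bar>\<psi> z - \<psi> w\<bar> \<le> N * H_norm \<alpha> p 1 UNIV \<psi> * (\<bar>fst z - fst w\<bar> powr (\<sigma> * \<alpha>) + norm (snd z - snd w) powr \<sigma>)"
      if z: "z \<in> E" and w: "w \<in> E" for z w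
    proof (rule LIMSEQ_le)
      show "(\<lambda>n. \<bar>v (r n) z - v (r n) w\<bar>) \<longlonglongrightarrow> \<bar>\<psi> z - \<psi> w\<bar>"
        using z w by (intro tendsto_intros) (auto simp: E_def)
      have "(\<lambda>n. H_norm \<alpha> p 1 UNIV (\<lambda>z. v (r n) z - \<psi> z)) \<longlonglongrightarrow> 0"
        using LIMSEQ_subseq_LIMSEQ[OF v(4) r(1)] by (simp add: o_def)
      then have "(\<lambda>n. N * (H_norm \<alpha> p 1 UNIV (\<lambda>z. v (r n) z - \<psi> z) + H_norm \<alpha> p 1 UNIV \<psi>)
          * (\<bar>fst z - fst w\<bar> powr (\<sigma> * \<alpha>) + norm (snd z - snd w) powr \<sigma>))
        \<longlonglongrightarrow> N * (0 + H_norm \<alpha> p 1 UNIV \<psi>) * (\<bar>fst z - fst w\<bar> powr (\<sigma> * \<alpha>) + norm (snd z - snd w) powr \<sigma>)"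
        by (intro tendsto_intros)
      then show "(\<lambda>n. N * (H_norm \<alpha> p 1 UNIV (\<lambda>z. v (r n) z - \<psi> z) + H_norm \<alpha> p 1 UNIV \<psi>)
          * (\<bar>fst z - fst w\<bar> powr (\<sigma> * \<alpha>) + norm (snd z - snd w) powr \<sigma>))
        \<longlonglongrightarrow> N * H_norm \<alpha> p 1 UNIV \<psi> * (\<bar>fst z - fst w\<bar> powr (\<sigma> * \<alpha>) + norm (snd z - snd w) powr \<sigma>)"
        by simp
      show "\<exists>n0. \<forall>n\<ge>n0. \<bar>v (r n) z - v (r n) w\<bar> \<le> N * (H_norm \<alpha> p 1 UNIV (\<lambda>z. v (r n) z - \<psi> z) + H_norm \<alpha> p 1 UNIV \<psi>)
          * (\<bar>fst z - fst w\<bar> powr (\<sigma> * \<alpha>) + norm (snd z - snd w) powr \<sigma>)"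
        unfolding N_def
        by (intro exI allI impI H_space_estimate assms(1-5) vc v(2,3) \<psi>H) (use z w in \<open>auto simp: E_def\<close>)
    qed
    have sub: "E \<subseteq> slab" by (auto simp: E_def)
    have pos: "0 < \<sigma> * \<alpha>" and NH: "0 \<le> N * H_norm \<alpha> p 1 UNIV \<psi>"
      using assms(1,5) by (auto intro!: mult_nonneg_nonneg N H_norm_nonneg)
    show ?thesis
    proof (rule hoelder_extension[OF slab(1) pos assms(5) NH sub E])
      fix z w assume "z \<in> E" "w \<in> E"
      then show "\<bar>\<psi> z - \<psi> w\<bar> \<le> N * H_norm \<alpha> p 1 UNIV \<psi>
          * (\<bar>fst z - fst w\<bar> powr (\<sigma> * \<alpha>) + norm (snd z - snd w) powr \<sigma>)" by (rule h)
    next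
      fix \<psi>' assume "is_cont_rep slab \<psi> \<psi>'"
        "holder_seminorm (\<sigma> * \<alpha>) \<sigma> slab \<psi>' \<le> ennreal (N * H_norm \<alpha> p 1 UNIV \<psi>)"
      then show ?thesis by blast
    qed
  qed
  then show ?thesis using N unfolding slab_def by blast
qed

end
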